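(* Let $(\gamma,\nu):I\to\Delta_1$ be a spacelike Legendre curve with curvature $(m,n)$ such that $\{t\in I:n(t)\ne0\}$ is dense in $I$. Suppose that there exists a smooth function $f:I\to\mathbb R$ such that $m(t)+f(t)n(t)=0$ for all $t\in I$. For a horocyclic parallel $P^\pm(\gamma,\lambda_\pm)$ write $m_P^\pm=\lambda_\pm n+m$. Then the following assertions hold. (1) For any $t_0\in I$, there exists a horocyclic parallel $P^\pm(\gamma,\lambda_\pm)$ of $\gamma$ such that $Ev^\pm(\gamma)(t_0)=P^\pm(\gamma,\lambda_\pm)(t_0)$ and $m_P^\pm(t_0)=0$. That is, the image of $Ev^\pm(\gamma)$ is contained in the set of singular values of horocyclic parallels of $\gamma$. (2) Let $t_0\in I$ and let $P^\pm(\gamma,\lambda_\pm)$ be a horocyclic parallel satisfying $Ev^\pm(\gamma)(t_0)=P^\pm(\gamma,\lambda_\pm)(t_0)$ and $m_P^\pm(t_0)=0$, and suppose that $n(t_0)\neq0$. Then $t_0$ is a regular point of $Ev^\pm(\gamma)$ if and only if $t_0$ is a $(2,3)$-cusp of $P^\pm(\gamma,\lambda_\pm)$. (3) Let $t_0\in I$ and let $P^\pm(\gamma,\lambda_\pm)$ be a horocyclic parallel satisfying $Ev^\pm(\gamma)(t_0)=P^\pm(\gamma,\lambda_\pm)(t_0)$ and $m_P^\pm(t_0)=0$. Then $t_0$ is a $(2,3)$-cusp of $Ev^\pm(\gamma)$ if and only if $t_0$ is a $(3,4)$-cusp of $P^\pm(\gamma,\lambda_\pm)$.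
   Context: All maps are $C^\infty$; $I\subset\mathbb R$ is an interval; a dot denotes $d/dt$. In every formula with $\pm,\mp$ the upper signs are taken together and the lower signs together. $\mathbb R^3_1$ is $\mathbb R^3$ with $\langle x,y\rangle=-x_1y_1+x_2y_2+x_3y_3$ and $x\wedge y=(-(x_2y_3-x_3y_2),\,x_3y_1-x_1y_3,\,x_1y_2-x_2y_1)$. $H^2=\{x:\langle x,x\rangle=-1,\ x_1>0\}$, $S^2_1=\{x:\langle x,x\rangle=1\}$, $\Delta_1=\{(\nu_1,\nu_2)\in H^2\times S_1^2:\langle\nu_1,\nu_2\rangle=0\}$. A spacelike Legendre curve is a map $(\gamma,\nu):I\to\Delta_1$ with $\langle\dot\gamma,\nu\rangle=0$ on $I$; put $\mu=\gamma\wedge\nu$. Its curvature is the pair $(m,n)$ with $\dot\gamma=m\mu$, $\dot\nu=n\mu$ (then $\dot\mu=m\gamma-n\nu$). Horocyclic evolute: $Ev^\pm(\gamma)=\gamma+f\nu+\frac{f^2}{2}(\gamma\pm\mu)$. Horocyclic parallel: $P^\pm(\gamma,\lambda_\pm)=\gamma+\lambda_\pm\nu+\frac{\lambda_\pm^2}{2}(\gamma\pm\mu)$, where $\lambda_\pm$ is a solution of $\dot\lambda_\pm=\mp(\frac{\lambda_\pm^2n}{2}+\lambda_\pm m)$. Convention: if a solution does not exist on all of $I$, the horocyclic parallel is considered on a subinterval of $I$ containing $t_0$ on which the solution exists. $(P^\pm(\gamma,\lambda_\pm),\nu_P^\pm)$ with $\nu_P^\pm=\lambda_\pm\gamma+\nu\pm\lambda_\pm\mu$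 is a spacelike Legendre curve with curvature $(m_P^\pm,n_P^\pm)=(\lambda_\pm n+m,\,n)$; a singular value is a value at a parameter where the derivative of the curve vanishes. A smooth curve has an $(i,j)$-cusp at $t_0$ ("$t_0$ is an $(i,j)$-cusp") if its germ at $t_0$ is $\mathcal A$-equivalent (equivalent up to local diffeomorphisms in source and target) to the germ $t\mapsto(t^i,t^j)$ at the origin. *)

theory Defs
  imports "HOL-Analysis.Analysis"
begin

section \<open>Smooth maps, diffeomorphisms and germs\<close>

text \<open>Of class \<open>C^k\<close>; only meaningful for open \<open>U\<close>.\<close>

primrec Ck_on :: "nat \<Rightarrow> ('a::euclidean_space \<Rightarrow> 'b::euclidean_space) \<Rightarrow> 'a set \<Rightarrow> bool" where
  "Ck_on 0 f U \<longleftrightarrow> continuous_on U f"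
| "Ck_on (Suc k) f U \<longleftrightarrow>
     (\<forall>x\<in>U. f differentiable (at x)) \<and> (\<forall>v. Ck_on k (\<lambda>x. frechet_derivative f (at x) v) U)"

text \<open>Smoothness on an arbitrary subset of a Euclidean space: \<open>f\<close> is locally the restriction of
  a smooth map defined on an open set.  This covers intervals that contain some of their
  endpoints as well as maps defined on an embedded surface.\<close>

definition smooth_map_on :: "'a set \<Rightarrow> ('a::euclidean_space \<Rightarrow> 'b::euclidean_space) \<Rightarrow> bool" where
  "smooth_map_on S f \<longleftrightarrow>
     (\<forall>x\<in>S. \<exists>U F. open U \<and> x \<in> U \<and> (\<forall>k. Ck_on k F U) \<and> (\<forall>y\<in>U \<inter> S. F y = f y))"

definition diffeomorphism_on ::
    "'a::euclidean_space set \<Rightarrow> 'b::euclidean_space set \<Rightarrow> ('a \<Rightarrow> 'b) \<Rightarrow> bool" where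
  "diffeomorphism_on X Y F \<longleftrightarrow>
     (\<exists>G. homeomorphism X Y F G \<and> smooth_map_on X F \<and> smooth_map_on Y G)"

text \<open>\<open>A\<close>-equivalence of the germ at \<open>t\<^sub>0\<close> of \<open>c : I \<rightarrow> N\<close> and the germ at \<open>s\<^sub>0\<close> of \<open>d : \<real> \<rightarrow> M\<close>.
  For \<open>t\<^sub>0\<close> in the interior of \<open>I\<close> one may shrink \<open>U\<close> so that \<open>U \<subseteq> I\<close>, and this is the usual
  notion.  If \<open>t\<^sub>0\<close> is an endpoint belonging to \<open>I\<close>, the source diffeomorphism is still one of
  neighbourhoods in \<open>\<real>\<close>, and only the restriction to \<open>I\<close> of the transformed germ is compared.\<close>

definition A_equivalent_germs ::
    "real set \<Rightarrow> 'a::euclidean_space set \<Rightarrow> (real \<Rightarrow> 'a) \<Rightarrow> real \<Rightarrow>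
     'b::euclidean_space set \<Rightarrow> (real \<Rightarrow> 'b) \<Rightarrow> real \<Rightarrow> bool" where
  "A_equivalent_germs I N c t\<^sub>0 M d s\<^sub>0 \<longleftrightarrow>
     (\<exists>U V \<phi> W W' \<Phi>.
        open U \<and> t\<^sub>0 \<in> U \<and> open V \<and> s\<^sub>0 \<in> V \<and> diffeomorphism_on U V \<phi> \<and> \<phi> t\<^sub>0 = s\<^sub>0 \<and>
        openin (top_of_set N) W \<and> c t\<^sub>0 \<in> W \<and> openin (top_of_set M) W' \<and> d s\<^sub>0 \<in> W' \<and>
        diffeomorphism_on W W' \<Phi> \<and> \<Phi> (c t\<^sub>0) = d s\<^sub>0 \<and>
        (\<forall>t\<in>U \<inter> I. c t \<in> W \<and> \<Phi> (c t) = d (\<phi> t)))"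

definition is_cusp ::
    "nat \<Rightarrow> nat \<Rightarrow> real set \<Rightarrow> 'a::euclidean_space set \<Rightarrow> (real \<Rightarrow> 'a) \<Rightarrow> real \<Rightarrow> bool" where
  "is_cusp i j I N c t\<^sub>0 \<longleftrightarrow>
     t\<^sub>0 \<in> I \<and> A_equivalent_germs I N c t\<^sub>0 (UNIV :: (real \<times> real) set) (\<lambda>t. (t ^ i, t ^ j)) 0"

definition regular_point :: "real set \<Rightarrow> (real \<Rightarrow> 'a::euclidean_space) \<Rightarrow> real \<Rightarrow> bool" where
  "regular_point I c t\<^sub>0 \<longleftrightarrow> (\<exists>v. v \<noteq> 0 \<and> (c has_vector_derivative v) (at t\<^sub>0 within I))"

definition singular_point :: "real set \<Rightarrow> (real \<Rightarrow> 'a::euclidean_space) \<Rightarrow> real \<Rightarrow> bool" where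
  "singular_point I c t\<^sub>0 \<longleftrightarrow> (c has_vector_derivative 0) (at t\<^sub>0 within I)"


section \<open>Minkowski space and spacelike Legendre curves\<close>

definition lorentz :: "real ^ 3 \<Rightarrow> real ^ 3 \<Rightarrow> real" where
  "lorentz x y = - (x$1 * y$1) + x$2 * y$2 + x$3 * y$3"

definition lorentz_cross :: "real ^ 3 \<Rightarrow> real ^ 3 \<Rightarrow> real ^ 3" where
  "lorentz_cross x y =
     vector [- (x$2 * y$3 - x$3 * y$2), x$3 * y$1 - x$1 * y$3, x$1 * y$2 - x$2 * y$1]"

definition hyperbolic_plane :: "(real ^ 3) set" where
  "hyperbolic_plane = {x. lorentz x x = -1 \<and> x$1 > 0}"

definition de_Sitter_plane :: "(real ^ 3) set" where
  "de_Sitter_plane = {x. lorentz x x = 1}"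

definition Delta1 :: "((real ^ 3) \<times> (real ^ 3)) set" where
  "Delta1 = {(v, w). v \<in> hyperbolic_plane \<and> w \<in> de_Sitter_plane \<and> lorentz v w = 0}"

definition spacelike_Legendre_curve ::
    "real set \<Rightarrow> (real \<Rightarrow> real ^ 3) \<Rightarrow> (real \<Rightarrow> real ^ 3) \<Rightarrow> bool" where
  "spacelike_Legendre_curve I \<gamma> \<nu> \<longleftrightarrow>
     smooth_map_on I \<gamma> \<and> smooth_map_on I \<nu> \<and> (\<forall>t\<in>I. (\<gamma> t, \<nu> t) \<in> Delta1) \<and>
     (\<forall>t\<in>I. lorentz (vector_derivative \<gamma> (at t within I)) (\<nu> t) = 0)"

definition Legendre_mu :: "(real \<Rightarrow> real ^ 3) \<Rightarrow> (real \<Rightarrow> real ^ 3) \<Rightarrow> real \<Rightarrow> real ^ 3" where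
  "Legendre_mu \<gamma> \<nu> t = lorentz_cross (\<gamma> t) (\<nu> t)"

definition has_Legendre_curvature ::
    "real set \<Rightarrow> (real \<Rightarrow> real ^ 3) \<Rightarrow> (real \<Rightarrow> real ^ 3) \<Rightarrow> (real \<Rightarrow> real) \<Rightarrow> (real \<Rightarrow> real) \<Rightarrow> bool" where
  "has_Legendre_curvature I \<gamma> \<nu> m n \<longleftrightarrow>
     (\<forall>t\<in>I. (\<gamma> has_vector_derivative m t *\<^sub>R Legendre_mu \<gamma> \<nu> t) (at t within I) \<and>
            (\<nu> has_vector_derivative n t *\<^sub>R Legendre_mu \<gamma> \<nu> t) (at t within I))"


section \<open>Horocyclic evolutes and parallels\<close>

text \<open>The sign \<open>\<sigma> \<in> {1, -1}\<close> encodes \<open>\<plusminus>\<close>; correspondingly \<open>- \<sigma>\<close> encodes \<open>\<mp>\<close>.\<close>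

definition horocyclic_evolute ::
    "real \<Rightarrow> (real \<Rightarrow> real ^ 3) \<Rightarrow> (real \<Rightarrow> real ^ 3) \<Rightarrow> (real \<Rightarrow> real) \<Rightarrow> real \<Rightarrow> real ^ 3" where
  "horocyclic_evolute \<sigma> \<gamma> \<nu> f t =
     \<gamma> t + f t *\<^sub>R \<nu> t + ((f t)\<^sup>2 / 2) *\<^sub>R (\<gamma> t + \<sigma> *\<^sub>R Legendre_mu \<gamma> \<nu> t)"

definition horocyclic_parallel ::
    "real \<Rightarrow> (real \<Rightarrow> real ^ 3) \<Rightarrow> (real \<Rightarrow> real ^ 3) \<Rightarrow> (real \<Rightarrow> real) \<Rightarrow> real \<Rightarrow> real ^ 3" where
  "horocyclic_parallel \<sigma> \<gamma> \<nu> lam t =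
     \<gamma> t + lam t *\<^sub>R \<nu> t + ((lam t)\<^sup>2 / 2) *\<^sub>R (\<gamma> t + \<sigma> *\<^sub>R Legendre_mu \<gamma> \<nu> t)"

definition parallel_ode_solution ::
    "real \<Rightarrow> (real \<Rightarrow> real) \<Rightarrow> (real \<Rightarrow> real) \<Rightarrow> real set \<Rightarrow> (real \<Rightarrow> real) \<Rightarrow> bool" where
  "parallel_ode_solution \<sigma> m n J lam \<longleftrightarrow>
     smooth_map_on J lam \<and>
     (\<forall>t\<in>J. (lam has_real_derivative - \<sigma> * ((lam t)\<^sup>2 * n t / 2 + lam t * m t)) (at t within J))"

text \<open>\<open>lam\<close>, considered on \<open>J\<close>, defines a horocyclic parallel: \<open>J\<close> is a subinterval of \<open>I\<close> that is
  a neighbourhood of \<open>t\<^sub>0\<close> relative to \<open>I\<close>, and \<open>J\<close> is all of \<open>I\<close> whenever the solution with this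
  value at \<open>t\<^sub>0\<close> exists on all of \<open>I\<close>.\<close>

definition defines_parallel ::
    "real \<Rightarrow> real set \<Rightarrow> (real \<Rightarrow> real) \<Rightarrow> (real \<Rightarrow> real) \<Rightarrow> real \<Rightarrow> real set \<Rightarrow> (real \<Rightarrow> real) \<Rightarrow> bool" where
  "defines_parallel \<sigma> I m n t\<^sub>0 J lam \<longleftrightarrow>
     is_interval J \<and> J \<subseteq> I \<and> t\<^sub>0 \<in> J \<and> (\<exists>U. open U \<and> t\<^sub>0 \<in> U \<and> U \<inter> I \<subseteq> J) \<and>
     parallel_ode_solution \<sigma> m n J lam \<and>
     (J = I \<or> \<not> (\<exists>lam'. parallel_ode_solution \<sigma> m n I lam' \<and> lam' t\<^sub>0 = lam t\<^sub>0))"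

definition parallel_singular_values ::
    "real \<Rightarrow> real set \<Rightarrow> (real \<Rightarrow> real ^ 3) \<Rightarrow> (real \<Rightarrow> real ^ 3) \<Rightarrow> (real \<Rightarrow> real) \<Rightarrow> (real \<Rightarrow> real) \<Rightarrow>
     (real ^ 3) set" where
  "parallel_singular_values \<sigma> I \<gamma> \<nu> m n =
     {horocyclic_parallel \<sigma> \<gamma> \<nu> lam s | t\<^sub>0 J lam s.
        defines_parallel \<sigma> I m n t\<^sub>0 J lam \<and> s \<in> J \<and>
        singular_point J (horocyclic_parallel \<sigma> \<gamma> \<nu> lam) s}"

end

theory Submission
  imports Defs
begin

text \<open>
For a real parameter \<open>l\<close> put \<open>P = \<gamma> + l \<nu> + l\<^sup>2/2 (\<gamma> + \<sigma> \<mu>)\<close>. The frame of \<open>P\<close> consists of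
\<open>P\<close>, \<open>par_nu\<close> and \<open>par_mu\<close>, and \<open>P' = (l n + m) par_mu + (l' + \<sigma> (l\<^sup>2 n / 2 + l m)) par_nu\<close>.
The differential equation of the parallels kills the second term, \<open>m + f n = 0\<close> kills the first
one for the evolute. So both curves have a velocity \<open>g w\<close> with \<open>w\<close> a frame vector, and such a curve
has a (2,3)-cusp (a (3,4)-cusp) exactly where \<open>g\<close> has a simple (double) zero and \<open>w\<close>, \<open>w'\<close> are
independent. With \<open>e = f' - \<sigma> n f\<^sup>2 / 2\<close> and \<open>h = lam - f\<close> the factors are \<open>e\<close> for the evolute
and \<open>h n\<close> for the parallel, where \<open>h' = - e - \<sigma> n h\<^sup>2 / 2\<close>; this translates the conditions
into each other.

The recognition of the cusps is reduced to jets: a smooth function whose Taylor exponents lie in the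
semigroup generated by \<open>i\<close> and \<open>i + 1\<close> is a smooth function of \<open>(t\<^sup>i, t\<^sup>i\<^sup>+\<^sup>1)\<close>, by Borel's
theorem and because a flat function of \<open>t\<close> is a smooth function of any odd power of \<open>t\<close>. Applied
to both components of a plane curve this gives a smooth map of the plane that carries the model
cusp to the curve, and the inverse function theorem makes it a diffeomorphism. At an endpoint of the
interval everything is applied to a local smooth extension, whose derivatives at the endpoint are
the one-sided ones.
\<close>

section \<open>Calculus of smooth maps\<close>

text \<open>What ties the two sides of each equivalence together is \<open>n\<close>. Where its
  velocity factor vanishes, each curve has a frame vector that turns into the other one at speed
  \<open>n\<close> up to sign: the derivative of \<open>par_nu\<close> along the evolute is
  \<open>n\<close> times \<open>par_mu\<close>, that of \<open>par_mu\<close> along the parallel is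
  \<open>- n\<close> times \<open>par_nu\<close>. The Lorentz cross product of \<open>par_mu\<close>
  and \<open>par_nu\<close> is the curve point, and its positive first component is minus the
  determinant of their last two components. So independence can be tested in the graph chart by the
  last two coordinates, and it means exactly \<open>n \<noteq> 0\<close>. This is part of both cusp
  conditions in (3); in (2), regularity of the evolute says nothing about \<open>n\<close>.

  The obstacle in the normal form is that a root of \<open>t ^ i\<close> is not smooth at 0. A
  formal solution by power series leaves a flat error, and flatness outweighs every negative power
  of the root that differentiation produces. An even root would lose the sign of \<open>t\<close>,
  but one of \<open>i\<close> and \<open>i + 1\<close> is odd.\<close>

declare Ck_on.simps(2) [simp del]

lemma Ck_on_cong:
  assumes "open U" "\<And>x. x \<in> U \<Longrightarrow> f x = g x" "Ck_on k f U"
  shows "Ck_on k g U"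
  using assms(2,3)
proof (induction k arbitrary: f g)
  case 0
  then show ?case using continuous_on_cong by force
next
  case (Suc k)
  have fd: "f differentiable at x" if "x \<in> U" for x using Suc.prems that by (auto simp: Ck_on.simps(2))
  have gd: "g differentiable at x" if "x \<in> U" for x
    using fd[OF that] Suc.prems(1) that assms(1)
    by (metis differentiable_def has_derivative_transform_within_open)
  have eq: "frechet_derivative f (at x) = frechet_derivative g (at x)" if "x \<in> U" for x
    using frechet_derivative_transform_within_open[OF fd[OF that] assms(1) that] Suc.prems(1) by blast
  have "Ck_on k (\<lambda>x. frechet_derivative g (at x) v) U" for v
  proof (rule Suc.IH)
    show "frechet_derivative f (at x) v = frechet_derivative g (at x) v" if "x \<in> U" for x
      using eq[OF that] by simp
    show "Ck_on k (\<lambda>x. frechet_derivative f (at x) v) U" using Suc.prems by (simp add: Ck_on.simps(2))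
  qed
  then show ?case using gd by (simp add: Ck_on.simps(2))
qed

lemma Ck_on_subset: "Ck_on k f U \<Longrightarrow> V \<subseteq> U \<Longrightarrow> Ck_on k f V"
proof (induction k arbitrary: f)
  case 0
  then show ?case using continuous_on_subset by auto
next
  case (Suc k)
  then show ?case by (auto simp: Ck_on.simps(2))
qed

text \<open>\<open>frechet_derivative\<close> is a choice; uniqueness of the derivative lets any
  explicit formula \<open>f'\<close> stand in for it.\<close>

lemma Ck_on_SucI:
  assumes "open U" "\<And>x. x \<in> U \<Longrightarrow> (f has_derivative f' x) (at x)"
    and "\<And>v. Ck_on k (\<lambda>x. f' x v) U"
  shows "Ck_on (Suc k) f U"
proof -
  have "frechet_derivative f (at x) = f' x" if "x \<in> U" for x
    using assms(2)[OF that] by (metis frechet_derivative_at)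
  then have "Ck_on k (\<lambda>x. frechet_derivative f (at x) v) U" for v
    by (intro Ck_on_cong[OF assms(1) _ assms(3)[of v]]) auto
  then show ?thesis using assms(2) by (auto simp: differentiable_def Ck_on.simps(2))
qed

lemma Ck_on_SucD: "Ck_on (Suc k) f U \<Longrightarrow> Ck_on k f U"
proof (induction k arbitrary: f)
  case 0
  then show ?case
    by (auto simp: Ck_on.simps(2)
        intro!: continuous_at_imp_continuous_on differentiable_imp_continuous_within)
next
  case (Suc k)
  then show ?case by (auto simp: Ck_on.simps(2))
qed

lemma has_derivative_frechet:
  "Ck_on (Suc k) f U \<Longrightarrow> x \<in> U \<Longrightarrow> (f has_derivative frechet_derivative f (at x)) (at x)"
  using frechet_derivative_works by (auto simp: Ck_on.simps(2))

lemma Ck_on_const: "open U \<Longrightarrow> Ck_on k (\<lambda>x. c) U"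
  by (induction k arbitrary: c) (auto intro!: Ck_on_SucI[where f'="\<lambda>_ _. 0"])

lemma Ck_on_linear:
  assumes "open U" "bounded_linear L" shows "Ck_on k L U"
proof (cases k)
  case 0
  then show ?thesis using assms by (simp add: linear_continuous_on)
next
  case (Suc j)
  then show ?thesis using assms
    by (auto intro!: Ck_on_SucI[where f'="\<lambda>_. L"] Ck_on_const bounded_linear_imp_has_derivative)
qed

lemma Ck_on_add:
  assumes "open U" shows "Ck_on k f U \<Longrightarrow> Ck_on k g U \<Longrightarrow> Ck_on k (\<lambda>x. f x + g x) U"
proof (induction k arbitrary: f g)
  case 0
  then show ?case by (auto intro: continuous_on_add)
next
  case (Suc k)
  show ?case
  proof (rule Ck_on_SucI[OF assms])
    show "((\<lambda>x. f x + g x) has_derivative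
        (\<lambda>v. frechet_derivative f (at x) v + frechet_derivative g (at x) v)) (at x)"
      if "x \<in> U" for x
      using has_derivative_frechet Suc.prems that by (intro has_derivative_add) blast+
    show "Ck_on k (\<lambda>x. frechet_derivative f (at x) v + frechet_derivative g (at x) v) U" for v
      using Suc by (auto simp: Ck_on.simps(2))
  qed
qed

lemma Ck_on_sum:
  assumes "open U" "finite A" "\<And>i. i \<in> A \<Longrightarrow> Ck_on k (f i) U"
  shows "Ck_on k (\<lambda>x. \<Sum>i\<in>A. f i x) U"
  using assms(2,3)
  by (induction A rule: finite_induct) (auto intro: Ck_on_add Ck_on_const assms(1))

lemma Ck_on_bilinear:
  assumes "open U" "bounded_bilinear B"
  shows "Ck_on k f U \<Longrightarrow> Ck_on k g U \<Longrightarrow> Ck_on k (\<lambda>x. B (f x) (g x)) U"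
proof (induction k arbitrary: f g)
  case 0
  then show ?case using bounded_bilinear.continuous_on[OF assms(2)] by auto
next
  case (Suc k)
  show ?case
  proof (rule Ck_on_SucI[OF assms(1)])
    show "((\<lambda>x. B (f x) (g x)) has_derivative
        (\<lambda>v. B (f x) (frechet_derivative g (at x) v) + B (frechet_derivative f (at x) v) (g x))) (at x)"
      if "x \<in> U" for x
      using has_derivative_frechet[OF Suc.prems(1) that] has_derivative_frechet[OF Suc.prems(2) that]
      by (rule bounded_bilinear.FDERIV[OF assms(2)])
    show "Ck_on k (\<lambda>x. B (f x) (frechet_derivative g (at x) v) + B (frechet_derivative f (at x) v) (g x)) U" for v
      using Suc.prems Ck_on_SucD[OF Suc.prems(1)] Ck_on_SucD[OF Suc.prems(2)]
      by (intro Ck_on_add assms(1) Suc.IH) (auto simp: Ck_on.simps(2))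
  qed
qed

lemma Ck_on_compose:
  assumes "open U" "open V" "f ` U \<subseteq> V"
  shows "Ck_on k g V \<Longrightarrow> Ck_on k f U \<Longrightarrow> Ck_on k (\<lambda>x. g (f x)) U"
proof (induction k arbitrary: g)
  case 0
  then show ?case using assms continuous_on_compose2 by auto
next
  case (Suc k)
  let ?f' = "\<lambda>x. frechet_derivative f (at x)" and ?g' = "\<lambda>x. frechet_derivative g (at x)"
  \<comment> \<open>\<open>Ck_on\<close> controls derivatives only in fixed directions, but here the
    direction \<open>?f' x v\<close> moves with \<open>x\<close>. Expanding it in
    \<open>Basis\<close> leaves fixed directions \<open>b\<close> with coefficients of class
    \<open>C^k\<close>.\<close>
  have exp: "?g' (f x) (?f' x v) = (\<Sum>b\<in>Basis. (?f' x v \<bullet> b) *\<^sub>R ?g' (f x) b)" if "x \<in> U" for x v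
  proof -
    have "f x \<in> V" using that assms by auto
    then have "linear (?g' (f x))"
      using has_derivative_frechet[OF Suc.prems(1)] has_derivative_linear by blast
    then have "?g' (f x) (\<Sum>b\<in>Basis. (?f' x v \<bullet> b) *\<^sub>R b) = (\<Sum>b\<in>Basis. (?f' x v \<bullet> b) *\<^sub>R ?g' (f x) b)"
      by (simp add: linear_sum linear_scale)
    then show ?thesis by (simp add: euclidean_representation)
  qed
  have "Ck_on k (\<lambda>x. ?g' (f x) (?f' x v)) U" for v
  proof (rule Ck_on_cong[OF assms(1)])
    show "(\<Sum>b\<in>Basis. (?f' x v \<bullet> b) *\<^sub>R ?g' (f x) b) = ?g' (f x) (?f' x v)" if "x \<in> U" for x
      using exp[OF that] by simp
    have "Ck_on k (\<lambda>x. ?f' x v) U" "Ck_on k f U" "\<And>b. Ck_on k (\<lambda>y. ?g' y b) V"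
      using Suc.prems Ck_on_SucD[OF Suc.prems(2)] by (auto simp: Ck_on.simps(2))
    then show "Ck_on k (\<lambda>x. \<Sum>b\<in>Basis. (?f' x v \<bullet> b) *\<^sub>R ?g' (f x) b) U"
      by (intro Ck_on_sum assms(1) Ck_on_bilinear[OF _ bounded_bilinear_scaleR]
          Ck_on_bilinear[OF _ bounded_bilinear_inner] Ck_on_const Suc.IH) auto
  qed
  moreover have "((\<lambda>x. g (f x)) has_derivative (\<lambda>v. ?g' (f x) (?f' x v))) (at x)" if "x \<in> U" for x
  proof -
    have "f x \<in> V" using that assms by auto
    then show ?thesis
      using has_derivative_compose[OF has_derivative_frechet[OF Suc.prems(2) that]
        has_derivative_frechet[OF Suc.prems(1)]] by auto
  qed
  ultimately show ?case by (intro Ck_on_SucI[OF assms(1)])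
qed

text \<open>Openness is bundled in, since \<open>Ck_on\<close> is meaningful only on open sets; the
  closure rules below then carry a single hypothesis per function.\<close>

definition smooth :: "'a::euclidean_space set \<Rightarrow> ('a \<Rightarrow> 'b::euclidean_space) \<Rightarrow> bool" where
  "smooth U f \<longleftrightarrow> open U \<and> (\<forall>k. Ck_on k f U)"

lemma smoothD: "smooth U f \<Longrightarrow> open U" "smooth U f \<Longrightarrow> Ck_on k f U"
  by (auto simp: smooth_def)

lemma smooth_cong:
  "smooth U f \<Longrightarrow> (\<And>x. x \<in> U \<Longrightarrow> f x = g x) \<Longrightarrow> smooth U g"
  unfolding smooth_def using Ck_on_cong[of U f g] by auto

lemma smooth_subset: "smooth U f \<Longrightarrow> V \<subseteq> U \<Longrightarrow> open V \<Longrightarrow> smooth V f"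
  unfolding smooth_def using Ck_on_subset by blast

lemma smooth_has_derivative:
  "smooth U f \<Longrightarrow> x \<in> U \<Longrightarrow> (f has_derivative frechet_derivative f (at x)) (at x)"
  using has_derivative_frechet smoothD(2) by blast

lemma smooth_frechet: "smooth U f \<Longrightarrow> smooth U (\<lambda>x. frechet_derivative f (at x) v)"
  unfolding smooth_def by (metis Ck_on.simps(2))

lemma smooth_continuous: "smooth U f \<Longrightarrow> continuous_on U f"
  using smoothD(2)[of U f 0] by simp

lemma smooth_derivI:
  assumes "open U" "\<And>x. x \<in> U \<Longrightarrow> (f has_derivative f' x) (at x)"
    and "\<And>v. smooth U (\<lambda>x. f' x v)"
  shows "smooth U f"
proof -
  have "Ck_on (Suc k) f U" for k
    using Ck_on_SucI[OF assms(1,2)] assms(3) smoothD(2) by blast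
  then show ?thesis using assms(1) Ck_on_SucD unfolding smooth_def by blast
qed

lemma smooth_const: "open U \<Longrightarrow> smooth U (\<lambda>x. c)"
  by (simp add: smooth_def Ck_on_const)

lemma smooth_linear: "open U \<Longrightarrow> bounded_linear L \<Longrightarrow> smooth U L"
  by (simp add: smooth_def Ck_on_linear)

lemma smooth_ident: "open U \<Longrightarrow> smooth U (\<lambda>x. x)"
  by (rule smooth_linear) auto

lemma smooth_compose:
  "smooth V g \<Longrightarrow> smooth U f \<Longrightarrow> f ` U \<subseteq> V \<Longrightarrow> smooth U (\<lambda>x. g (f x))"
  unfolding smooth_def using Ck_on_compose by blast

lemma smooth_compose_linear:
  "bounded_linear L \<Longrightarrow> smooth U f \<Longrightarrow> smooth U (\<lambda>x. L (f x))"
  using smooth_compose[OF smooth_linear[OF open_UNIV]] by blast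

lemma smooth_bilinear:
  "bounded_bilinear B \<Longrightarrow> smooth U f \<Longrightarrow> smooth U g \<Longrightarrow> smooth U (\<lambda>x. B (f x) (g x))"
  by (simp add: smooth_def Ck_on_bilinear)

lemma smooth_add:
  "smooth U f \<Longrightarrow> smooth U g \<Longrightarrow> smooth U (\<lambda>x. f x + g x)"
  by (simp add: smooth_def Ck_on_add)

lemma smooth_sum:
  "open U \<Longrightarrow> finite A \<Longrightarrow> (\<And>i. i \<in> A \<Longrightarrow> smooth U (f i)) \<Longrightarrow> smooth U (\<lambda>x. \<Sum>i\<in>A. f i x)"
  by (simp add: smooth_def Ck_on_sum)

lemma smooth_uminus: "smooth U f \<Longrightarrow> smooth U (\<lambda>x. - f x)"
  by (rule smooth_compose_linear) (auto intro: bounded_linear_minus)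

lemma smooth_diff:
  "smooth U f \<Longrightarrow> smooth U g \<Longrightarrow> smooth U (\<lambda>x. f x - g x)"
  using smooth_add[OF _ smooth_uminus, of U f g] by simp

lemmas smooth_scaleR = smooth_bilinear[OF bounded_bilinear_scaleR]
lemmas smooth_nth = smooth_compose_linear[OF bounded_linear_vec_nth]

lemma smooth_mult:
  fixes f g :: "'a::euclidean_space \<Rightarrow> real"
  shows "smooth U f \<Longrightarrow> smooth U g \<Longrightarrow> smooth U (\<lambda>x. f x * g x)"
  by (rule smooth_bilinear[OF bounded_bilinear_mult])

lemma smooth_Pair:
  assumes "smooth U f" "smooth U g" shows "smooth U (\<lambda>x. (f x, g x))"
proof -
  have "smooth U (\<lambda>x. (f x, 0) + (0, g x))"
    using assms by (intro smooth_add smooth_compose_linear[where L="\<lambda>x. (x, 0)"]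
        smooth_compose_linear[where L="\<lambda>x. (0, x)"])
      (auto intro!: bounded_linear_Pair bounded_linear_zero bounded_linear_ident)
  then show ?thesis by simp
qed

lemma smooth_power:
  fixes f :: "'a::euclidean_space \<Rightarrow> real"
  assumes "smooth U f" shows "smooth U (\<lambda>x. f x ^ n)"
  using assms
  by (induction n) (auto intro: smooth_mult smooth_const smoothD)

lemma smooth_vec:
  fixes f :: "'a::euclidean_space \<Rightarrow> real ^ 'n"
  assumes "\<And>i. smooth U (\<lambda>x. f x $ i)" shows "smooth U f"
proof (rule smooth_cong)
  show "smooth U (\<lambda>x. \<Sum>i\<in>UNIV. (f x $ i) *\<^sub>R axis i 1)"
    using assms smoothD(1)[OF assms]
    by (intro smooth_sum smooth_scaleR smooth_const) auto
  show "(\<Sum>i\<in>UNIV. (f x $ i) *\<^sub>R axis i 1) = f x" for x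
    using basis_expansion[of "f x"] by (simp add: scalar_mult_eq_scaleR)
qed

text \<open>The derivative is a multiple of the square of the same function, so each order of
  differentiability follows from the one below.\<close>

lemma smooth_inverse_real: "smooth {x::real. x \<noteq> 0} inverse"
proof -
  have o: "open {x::real. x \<noteq> 0}" by (rule open_Collect_neq) (auto intro: continuous_intros)
  have "Ck_on k inverse {x::real. x \<noteq> 0}" for k
  proof (induction k)
    case 0
    then show ?case by (auto intro!: continuous_intros)
  next
    case (Suc k)
    show ?case
    proof (rule Ck_on_SucI[OF o])
      show "(inverse has_derivative (\<lambda>v. - (inverse x * v * inverse x))) (at x)"
        if "x \<in> {x::real. x \<noteq> 0}" for x
        using that by (intro has_derivative_inverse') auto
      have "Ck_on k (\<lambda>x::real. (- v) * (inverse x * inverse x)) {x. x \<noteq> 0}" for v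
        by (intro Ck_on_bilinear[OF o bounded_bilinear_mult] Suc Ck_on_const o)
      then show "Ck_on k (\<lambda>x::real. - (inverse x * v * inverse x)) {x. x \<noteq> 0}" for v
        by (simp add: mult_ac)
    qed
  qed
  then show ?thesis using o by (simp add: smooth_def)
qed

lemma smooth_inverse:
  fixes f :: "'a::euclidean_space \<Rightarrow> real"
  assumes "smooth U f" "\<And>x. x \<in> U \<Longrightarrow> f x \<noteq> 0" shows "smooth U (\<lambda>x. inverse (f x))"
  by (rule smooth_compose[OF smooth_inverse_real assms(1)]) (use assms(2) in auto)

lemma smooth_divide:
  fixes f g :: "'a::euclidean_space \<Rightarrow> real"
  assumes "smooth U f" "smooth U g" "\<And>x. x \<in> U \<Longrightarrow> g x \<noteq> 0"
  shows "smooth U (\<lambda>x. f x / g x)"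
  unfolding divide_inverse using assms by (intro smooth_mult smooth_inverse)

lemma smooth_sqrt_real: "smooth {x::real. x > 0} sqrt"
proof -
  have o: "open {x::real. x > 0}" by (simp add: open_Collect_less)
  have o2: "open {x::real. x \<noteq> 0}" by (rule open_Collect_neq) (auto intro: continuous_intros)
  have "Ck_on k sqrt {x::real. x > 0}" for k
  proof (induction k)
    case 0
    then show ?case by (auto intro!: continuous_intros)
  next
    case (Suc k)
    show ?case
    proof (rule Ck_on_SucI[OF o])
      show "(sqrt has_derivative (\<lambda>v. (v / 2) * inverse (sqrt x))) (at x)"
        if "x \<in> {x::real. x > 0}" for x
        using DERIV_real_sqrt[of x] that
        by (auto simp: has_field_derivative_def mult_ac elim!: has_derivative_eq_rhs)
      show "Ck_on k (\<lambda>x::real. (v / 2) * inverse (sqrt x)) {x. x > 0}" for v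
        by (intro Ck_on_bilinear[OF o bounded_bilinear_mult] Ck_on_const o
            Ck_on_compose[OF o o2 _ smoothD(2)[OF smooth_inverse_real] Suc]) auto
    qed
  qed
  then show ?thesis using o by (simp add: smooth_def)
qed

section \<open>Functions of one real variable and their iterated derivatives\<close>

lemmas real_vector_derivative_iff = has_real_derivative_iff_has_vector_derivative

text \<open>A total operator on functions, so that \<open>^^\<close> can iterate it; its values are
  meaningful only where the two-sided derivative exists.\<close>

definition vderiv :: "(real \<Rightarrow> 'a::real_normed_vector) \<Rightarrow> real \<Rightarrow> 'a" where
  "vderiv f t = vector_derivative f (at t)"

lemma smooth_has_vderiv:
  fixes f :: "real \<Rightarrow> 'a::euclidean_space"
  assumes "smooth U f" "x \<in> U" shows "(f has_vector_derivative vderiv f x) (at x)"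
  unfolding vderiv_def using smooth_has_derivative[OF assms]
  by (meson differentiable_def vector_derivative_works)

lemma smooth_vderiv:
  fixes f :: "real \<Rightarrow> 'a::euclidean_space"
  assumes "smooth U f" shows "smooth U (vderiv f)"
proof (rule smooth_cong[OF smooth_frechet[OF assms, of 1]])
  fix x assume "x \<in> U"
  then show "frechet_derivative f (at x) 1 = vderiv f x"
    using smooth_has_vderiv[OF assms] frechet_derivative_at
    unfolding has_vector_derivative_def by (metis scaleR_one)
qed

lemma smooth_funpow_vderiv:
  fixes f :: "real \<Rightarrow> 'a::euclidean_space"
  assumes "smooth U f" shows "smooth U ((vderiv ^^ k) f)"
  by (induction k) (auto intro: assms smooth_vderiv)

lemma vderiv_eqI: "(f has_vector_derivative f') (at x) \<Longrightarrow> vderiv f x = f'"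
  unfolding vderiv_def by (rule vector_derivative_at)

lemma smooth_vderivI:
  fixes f :: "real \<Rightarrow> 'a::euclidean_space"
  assumes "\<And>x. x \<in> U \<Longrightarrow> (f has_vector_derivative g x) (at x)" "smooth U g"
  shows "smooth U f"
proof (rule smooth_derivI)
  show o: "open U" using smoothD(1)[OF assms(2)] .
  show "(f has_derivative (\<lambda>v. v *\<^sub>R g x)) (at x)" if "x \<in> U" for x
    using assms(1)[OF that] by (simp add: has_vector_derivative_def)
  show "smooth U (\<lambda>x. v *\<^sub>R g x)" for v
    by (rule smooth_scaleR[OF smooth_const[OF o] assms(2)])
qed

text \<open>For functions whose derivatives of all orders are explicitly known: the shifted sines,
  the exponential function and the series in Borel's theorem.\<close>

lemma smooth_derivative_sequence:
  fixes d :: "nat \<Rightarrow> real \<Rightarrow> 'a::euclidean_space"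
  assumes "open U" "\<And>k x. x \<in> U \<Longrightarrow> (d k has_vector_derivative d (Suc k) x) (at x)"
  shows "smooth U (d k)"
proof -
  have "Ck_on j (d k) U" for j
  proof (induction j arbitrary: k)
    case 0
    then show ?case using assms(2)
      by (auto intro!: continuous_at_imp_continuous_on has_vector_derivative_continuous)
  next
    case (Suc j)
    show ?case
      using assms
      by (intro Ck_on_SucI[where f'="\<lambda>x v. v *\<^sub>R d (Suc k) x"] Suc Ck_on_const
          Ck_on_bilinear[OF assms(1) bounded_bilinear_scaleR])
        (auto simp: has_vector_derivative_def)
  qed
  then show ?thesis using assms(1) by (simp add: smooth_def)
qed

lemma vderiv_scaleR:
  fixes f :: "real \<Rightarrow> 'a::euclidean_space" and g :: "real \<Rightarrow> real"
  assumes "smooth U f" "smooth U g" "x \<in> U"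
  shows "vderiv (\<lambda>x. g x *\<^sub>R f x) x = vderiv g x *\<^sub>R f x + g x *\<^sub>R vderiv f x"
  using smooth_has_vderiv[OF assms(1,3)] smooth_has_vderiv[OF assms(2,3)]
  by (intro vderiv_eqI) (auto intro!: derivative_eq_intros simp: real_vector_derivative_iff)

lemma vderiv_mult:
  fixes p q :: "real \<Rightarrow> real"
  shows "smooth U p \<Longrightarrow> smooth U q \<Longrightarrow> s \<in> U \<Longrightarrow>
    vderiv (\<lambda>s. p s * q s) s = vderiv p s * q s + p s * vderiv q s"
  using vderiv_scaleR[of U q p s] by simp

lemma vderiv_add:
  fixes f :: "real \<Rightarrow> 'a::euclidean_space"
  assumes "smooth U f" "smooth U g" "x \<in> U"
  shows "vderiv (\<lambda>x. f x + g x) x = vderiv f x + vderiv g x"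
  using smooth_has_vderiv[OF assms(1,3)] smooth_has_vderiv[OF assms(2,3)]
  by (intro vderiv_eqI) (auto intro!: derivative_eq_intros)

text \<open>An interval with nonempty interior has no isolated points, so the derivative within
  \<open>I\<close> is unique even at an endpoint, and the two-sided derivative of an extension has
  to coincide with it.\<close>

lemma vderiv_within_eq:
  fixes F :: "real \<Rightarrow> 'a::euclidean_space"
  assumes "smooth U F" "is_interval I" "interior I \<noteq> {}" "x \<in> U \<inter> I"
    and "\<And>t. t \<in> U \<inter> I \<Longrightarrow> F t = f t" "(f has_vector_derivative d) (at x within I)"
  shows "vderiv F x = d"
proof -
  have lim: "x islimpt I"
    using assms(2-4) connected_imp_perfect[of I x] is_interval_connected[of I]
    by (metis IntD2 interior_singleton)
  have "(F has_vector_derivative d) (at x within I)"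
  proof -
    obtain e where e: "e > 0" "ball x e \<subseteq> U"
      using smoothD(1)[OF assms(1)] assms(4) open_contains_ball by blast
    show ?thesis
      by (rule has_vector_derivative_transform_within[OF assms(6) e(1)])
        (use assms e in \<open>auto simp: dist_commute subset_iff\<close>)
  qed
  moreover have "(F has_vector_derivative vderiv F x) (at x within I)"
    using smooth_has_vderiv[OF assms(1)] assms(4) has_vector_derivative_at_within by blast
  ultimately show ?thesis
    using lim by (metis at_within_eq_bot_iff trivial_limit_within vector_derivative_within)
qed

section \<open>Smooth local inverses\<close>

text \<open>\<open>R v x\<close> is the preimage of \<open>v\<close> under the derivative at
  \<open>x\<close>. Supplying it as a smooth function of \<open>x\<close> avoids discussing the
  inversion of linear maps: the local inverse has the derivative \<open>R v (g y)\<close> in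
  direction \<open>v\<close>, so \<open>g\<close> of class \<open>C^k\<close> gives \<open>g\<close>
  of class \<open>C^(k+1)\<close>.\<close>

lemma smooth_local_inverse:
  fixes f :: "'a::euclidean_space \<Rightarrow> 'a"
  assumes f: "smooth U f" "x0 \<in> U"
    and R: "\<And>v. smooth U (R v)"
      "\<And>x v. x \<in> U \<Longrightarrow> frechet_derivative f (at x) (R v x) = v"
  obtains U' V g where "open U'" "U' \<subseteq> U" "x0 \<in> U'" "open V" "f x0 \<in> V"
    "homeomorphism U' V f g" "smooth V g"
proof -
  let ?f' = "\<lambda>x. frechet_derivative f (at x)"
  have bl: "bounded_linear (?f' x)" if "x \<in> U" for x
    using smooth_has_derivative[OF f(1) that] has_derivative_bounded_linear by blast
  have surj: "surj (?f' x)" if "x \<in> U" for x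
    by (rule surjI[of _ "\<lambda>v. R v x"]) (rule R(2)[OF that])
  have inj: "inj (?f' x)" if "x \<in> U" for x
    using linear_surj_imp_inj[OF bounded_linear.linear[OF bl[OF that]] surj[OF that]] .
  have inv: "inv (?f' x) v = R v x" if "x \<in> U" for x v
    using inj[OF that] R(2)[OF that] by (metis inv_f_f)
  \<comment> \<open>The inverse function theorem wants the derivative as a continuous map into the
    bounded linear functions; continuity is checked on basis vectors.\<close>
  define F where "F = (\<lambda>x. Blinfun (?f' x))"
  have F: "blinfun_apply (F x) = ?f' x" if "x \<in> U" for x
    unfolding F_def using bl[OF that] by (rule bounded_linear_Blinfun_apply)
  have contF: "continuous_on U F"
  proof (rule continuous_on_blinfun_componentwise)
    fix i :: 'a
    have "continuous_on U (\<lambda>x. ?f' x i)"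
      by (intro smooth_continuous smooth_frechet f)
    then show "continuous_on U (\<lambda>x. blinfun_apply (F x) i)"
      using continuous_on_cong F by (metis (mono_tags, lifting))
  qed
  define G where "G = Blinfun (inv (?f' x0))"
  have "linear (inv (?f' x0))"
    using bounded_linear.linear[OF bl[OF f(2)]] inj[OF f(2)] by (rule inj_linear_imp_inv_linear)
  then have G: "blinfun_apply G = inv (?f' x0)"
    unfolding G_def by (intro bounded_linear_Blinfun_apply) (rule linear_conv_bounded_linear[THEN iffD1])
  have GF: "G o\<^sub>L F x0 = id_blinfun"
    by (rule blinfun_eqI) (simp add: G F f inj)
  have derF: "(f has_derivative blinfun_apply (F x)) (at x)" if "x \<in> U" for x
    using smooth_has_derivative[OF f(1) that] F[OF that] by simp
  obtain U' V g g' where U': "open U'" "U' \<subseteq> U" "x0 \<in> U'" "open V" "f x0 \<in> V" "homeomorphism U' V f g"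
    and g: "\<And>y. y \<in> V \<Longrightarrow> (g has_derivative (g' y)) (at y)"
      "\<And>y. y \<in> V \<Longrightarrow> g' y = inv (blinfun_apply (F (g y)))"
    using inverse_function_theorem[OF smoothD(1)[OF f(1)] derF contF f(2) GF] by metis
  have gV: "g ` V \<subseteq> U" using U' by (auto simp: homeomorphism_def)
  have der: "(g has_derivative (\<lambda>v. R v (g y))) (at y)" if "y \<in> V" for y
  proof -
    have "g y \<in> U" using gV that by auto
    then have "g' y = (\<lambda>v. R v (g y))" using g(2)[OF that] F inv by auto
    then show ?thesis using g(1)[OF that] by simp
  qed
  have "Ck_on k g V" for k
  proof (induction k)
    case 0
    then show ?case using U'(6) by (simp add: homeomorphism_def)
  next
    case (Suc k)
    show ?case
      by (rule Ck_on_SucI[OF U'(4) der])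
        (use Ck_on_compose[OF U'(4) smoothD(1)[OF f(1)] gV smoothD(2)[OF R(1)] Suc] in auto)
  qed
  then have "smooth V g" using U'(4) by (simp add: smooth_def)
  then show ?thesis using that U' by blast
qed

lemma frechet_derivative_real:
  fixes f :: "real \<Rightarrow> 'a::euclidean_space"
  assumes "smooth U f" "x \<in> U"
  shows "frechet_derivative f (at x) v = v *\<^sub>R vderiv f x"
  using smooth_has_vderiv[OF assms] frechet_derivative_at
  unfolding has_vector_derivative_def by metis

lemma smooth_local_inverse_real:
  fixes f :: "real \<Rightarrow> real"
  assumes f: "smooth U f" "x0 \<in> U" "vderiv f x0 \<noteq> 0"
  obtains U' V g where "open U'" "U' \<subseteq> U" "x0 \<in> U'" "open V" "f x0 \<in> V"
    "homeomorphism U' V f g" "smooth V g"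
proof -
  define U1 where "U1 = U \<inter> {x \<in> U. vderiv f x \<in> - {0}}"
  have "open U1"
    unfolding U1_def using smooth_continuous[OF smooth_vderiv[OF f(1)]] smoothD(1)[OF f(1)]
    by (intro open_Int) (auto simp: continuous_on_open_vimage vimage_def Int_def conj_commute
        dest!: spec[of _ "- {0}"])
  then have sm: "smooth U1 f" using f smooth_subset[OF f(1)] by (auto simp: U1_def)
  have "x0 \<in> U1" using f by (auto simp: U1_def)
  moreover have "smooth U1 (\<lambda>x. v / vderiv f x)" for v
    by (rule smooth_divide[OF smooth_const smooth_vderiv[OF sm]])
      (use \<open>open U1\<close> in \<open>auto simp: U1_def\<close>)
  moreover have "frechet_derivative f (at x) (v / vderiv f x) = v" if "x \<in> U1" for x v
    using frechet_derivative_real[OF sm that] that by (simp add: U1_def)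
  ultimately show ?thesis
    using smooth_local_inverse[OF sm, of x0 "\<lambda>v x. v / vderiv f x"] that
    by (metis (no_types, lifting) U1_def inf.boundedE)
qed

definition jacobian :: "(real \<times> real \<Rightarrow> real) \<Rightarrow> (real \<times> real \<Rightarrow> real) \<Rightarrow> real \<times> real \<Rightarrow> real" where
  "jacobian p q z =
     frechet_derivative p (at z) (1, 0) * frechet_derivative q (at z) (0, 1) -
     frechet_derivative p (at z) (0, 1) * frechet_derivative q (at z) (1, 0)"

lemma frechet_derivative_plane:
  fixes p :: "real \<times> real \<Rightarrow> 'a::euclidean_space"
  assumes "smooth U p" "z \<in> U"
  shows "frechet_derivative p (at z) (a, b) =
    a *\<^sub>R frechet_derivative p (at z) (1, 0) + b *\<^sub>R frechet_derivative p (at z) (0, 1)"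
proof -
  have "linear (frechet_derivative p (at z))"
    using smooth_has_derivative[OF assms] has_derivative_linear by blast
  then have "frechet_derivative p (at z) (a *\<^sub>R (1, 0) + b *\<^sub>R (0, 1)) =
    a *\<^sub>R frechet_derivative p (at z) (1, 0) + b *\<^sub>R frechet_derivative p (at z) (0, 1)"
    by (simp only: linear_add linear_scale)
  then show ?thesis by simp
qed

lemma smooth_local_inverse_plane:
  assumes p: "smooth U p" and q: "smooth U q" and z0: "z0 \<in> U" "jacobian p q z0 \<noteq> 0"
  obtains U' V g where "open U'" "U' \<subseteq> U" "z0 \<in> U'" "open V" "(p z0, q z0) \<in> V"
    "homeomorphism U' V (\<lambda>z. (p z, q z)) g" "smooth V g"
proof -
  let ?p1 = "\<lambda>z. frechet_derivative p (at z) (1, 0)" and ?p2 = "\<lambda>z. frechet_derivative p (at z) (0, 1)"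
  let ?q1 = "\<lambda>z. frechet_derivative q (at z) (1, 0)" and ?q2 = "\<lambda>z. frechet_derivative q (at z) (0, 1)"
  let ?J = "jacobian p q"
  have smJ: "smooth U ?J"
    unfolding jacobian_def using p q by (intro smooth_diff smooth_mult smooth_frechet)
  define U1 where "U1 = U \<inter> {x \<in> U. ?J x \<in> - {0}}"
  have "open U1"
    unfolding U1_def using smooth_continuous[OF smJ] smoothD(1)[OF p]
    by (intro open_Int) (auto simp: continuous_on_open_vimage vimage_def Int_def conj_commute
        dest!: spec[of _ "- {0}"])
  then have sm: "smooth U1 p" "smooth U1 q" "smooth U1 ?J"
    using smooth_subset[OF p] smooth_subset[OF q] smooth_subset[OF smJ]
    by (auto simp: U1_def)
  \<comment> \<open>Cramer's rule for the Jacobian matrix of \<open>(p, q)\<close>.\<close>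
  define R where "R = (\<lambda>v z. ((fst v * ?q2 z - snd v * ?p2 z) / ?J z, (snd v * ?p1 z - fst v * ?q1 z) / ?J z))"
  have "x0 \<in> U1 \<Longrightarrow> ?J x0 \<noteq> 0" for x0 by (auto simp: U1_def)
  then have R: "smooth U1 (R v)" for v
    unfolding R_def
    by (intro smooth_Pair smooth_divide sm smooth_diff smooth_mult
        smooth_const \<open>open U1\<close> smooth_frechet) auto
  have smf: "smooth U1 (\<lambda>z. (p z, q z))" by (intro smooth_Pair sm)
  have fr: "frechet_derivative (\<lambda>z. (p z, q z)) (at z) w =
      (frechet_derivative p (at z) w, frechet_derivative q (at z) w)" if "z \<in> U1" for z w
    using frechet_derivative_at[OF has_derivative_Pair[OF smooth_has_derivative[OF sm(1) that]
      smooth_has_derivative[OF sm(2) that]], THEN fun_cong, of w] by (rule sym)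
  have inv: "frechet_derivative (\<lambda>z. (p z, q z)) (at z) (R v z) = v" if "z \<in> U1" for z v
  proof -
    obtain v1 v2 where v: "v = (v1, v2)" by (cases v)
    have J: "?p1 z * ?q2 z - ?p2 z * ?q1 z \<noteq> 0" using that by (auto simp: U1_def jacobian_def)
    have "frechet_derivative p (at z) (R v z) =
        ((v1 * ?q2 z - v2 * ?p2 z) * ?p1 z + (v2 * ?p1 z - v1 * ?q1 z) * ?p2 z) / ?J z"
      unfolding R_def v by (subst frechet_derivative_plane[OF sm(1) that]) (simp add: add_divide_distrib)
    also have "\<dots> = v1" using J by (simp add: jacobian_def field_simps)
    finally have 1: "frechet_derivative p (at z) (R v z) = v1" .
    have "frechet_derivative q (at z) (R v z) =
        ((v1 * ?q2 z - v2 * ?p2 z) * ?q1 z + (v2 * ?p1 z - v1 * ?q1 z) * ?q2 z) / ?J z"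
      unfolding R_def v by (subst frechet_derivative_plane[OF sm(2) that]) (simp add: add_divide_distrib)
    also have "\<dots> = v2" using J by (simp add: jacobian_def field_simps)
    finally show ?thesis using 1 fr[OF that] v by simp
  qed
  have z: "z0 \<in> U1" using z0 by (auto simp: U1_def)
  show ?thesis
    by (rule smooth_local_inverse[OF smf z R inv]) (use that in \<open>auto simp: U1_def\<close>)
qed

text \<open>\<open>X\<close> need not be open, as for a piece of the hyperbolic plane; one smooth
  map on an open superset then serves as the extension at all points.\<close>

lemma diffeomorphism_onI:
  fixes F :: "'a::euclidean_space \<Rightarrow> 'b::euclidean_space"
  assumes "homeomorphism X Y F G" "smooth X' F" "X \<subseteq> X'" "smooth Y' G" "Y \<subseteq> Y'"
  shows "diffeomorphism_on X Y F"
proof -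
  have "smooth_map_on X F"
    unfolding smooth_map_on_def using assms(2,3)
    by (intro ballI exI[of _ X'] exI[of _ F]) (auto simp: smooth_def)
  moreover have "smooth_map_on Y G"
    unfolding smooth_map_on_def using assms(4,5)
    by (intro ballI exI[of _ Y'] exI[of _ G]) (auto simp: smooth_def)
  ultimately show ?thesis
    using assms(1) unfolding diffeomorphism_on_def by blast
qed

lemma smooth_map_on_local:
  assumes "smooth_map_on S f" "x \<in> S"
  obtains U F where "x \<in> U" "smooth U F" "\<forall>y\<in>U \<inter> S. F y = f y"
proof -
  from bspec[OF assms(1)[unfolded smooth_map_on_def] assms(2)]
  obtain U F where U: "open U" "x \<in> U" "\<forall>k. Ck_on k F U" "\<forall>y\<in>U \<inter> S. F y = f y"
    by (elim exE conjE)
  show ?thesis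
    by (rule that[of U F]) (use U in \<open>auto simp: smooth_def\<close>)
qed

text \<open>The extensions in \<open>smooth_map_on\<close> vary with the point, but on an open set
  they agree with \<open>f\<close> nearby, and being of class \<open>C^k\<close> is a local
  property.\<close>

lemma smooth_map_on_open:
  assumes "smooth_map_on U f" "open U" shows "smooth U f"
proof -
  have loc: "\<exists>V. open V \<and> x \<in> V \<and> V \<subseteq> U \<and> smooth V f" if x: "x \<in> U" for x
  proof -
    obtain V F where V: "x \<in> V" "smooth V F" "\<forall>y\<in>V \<inter> U. F y = f y"
      using smooth_map_on_local[OF assms(1) x] by blast
    have "open V" using V(2) by (rule smoothD)
    have "smooth (V \<inter> U) F"
      by (rule smooth_subset[OF V(2)]) (use \<open>open V\<close> assms(2) in auto)
    then have "smooth (V \<inter> U) f" by (rule smooth_cong) (use V in auto)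
    then show ?thesis using V \<open>open V\<close> assms(2) x by (intro exI[of _ "V \<inter> U"]) auto
  qed
  have glue: "Ck_on k h U" if "\<And>x. x \<in> U \<Longrightarrow> \<exists>V. x \<in> V \<and> open V \<and> Ck_on k h V" for k h
    using that
  proof (induction k arbitrary: h)
    case 0
    then show ?case
      by (intro iffD2[OF Ck_on.simps(1)] continuous_at_imp_continuous_on ballI)
        (metis Ck_on.simps(1) continuous_on_eq_continuous_at)
  next
    case (Suc k)
    have "h differentiable at x" if "x \<in> U" for x
      using Suc.prems[OF that] by (auto simp: Ck_on.simps(2))
    moreover have "Ck_on k (\<lambda>x. frechet_derivative h (at x) v) U" for v
    proof (rule Suc.IH)
      show "\<exists>V. x \<in> V \<and> open V \<and> Ck_on k (\<lambda>x. frechet_derivative h (at x) v) V"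
        if "x \<in> U" for x
        using Suc.prems[OF that] by (auto simp: Ck_on.simps(2))
    qed
    ultimately show ?case by (simp add: Ck_on.simps(2))
  qed
  have "Ck_on k f U" for k
  proof (rule glue)
    show "\<exists>V. x \<in> V \<and> open V \<and> Ck_on k f V" if "x \<in> U" for x
      using loc[OF that] smoothD(2) by blast
  qed
  then show ?thesis using assms(2) by (simp add: smooth_def)
qed

section \<open>Taylor expansions and flat functions\<close>

abbreviation O_pow :: "nat \<Rightarrow> (real \<Rightarrow> real) set" where
  "O_pow N \<equiv> O[at 0](\<lambda>t. t ^ N)"

text \<open>A Landau condition rather than one on derivatives: jets of sums and composites come from
  algebra with error terms, and \<open>has_jet_unique\<close> turns them back into Taylor
  coefficients.\<close>

definition has_jet :: "nat \<Rightarrow> (real \<Rightarrow> real) \<Rightarrow> (nat \<Rightarrow> real) \<Rightarrow> bool" where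
  "has_jet N g a \<longleftrightarrow> (\<lambda>t. g t - (\<Sum>n<N. a n * t ^ n)) \<in> O_pow N"

lemma power_bigo_power:
  fixes m n :: nat
  assumes "n \<le> m" shows "(\<lambda>t::real. t ^ m) \<in> O_pow n"
proof (rule bigoI[where c=1])
  have "eventually (\<lambda>t::real. dist t 0 < 1) (at 0)"
    by (auto simp: eventually_at intro!: exI[of _ 1])
  then show "\<forall>\<^sub>F t::real in at 0. norm (t ^ m) \<le> 1 * norm (t ^ n)"
  proof eventually_elim
    case (elim t)
    have "\<bar>t\<bar> ^ m \<le> \<bar>t\<bar> ^ n" using assms elim by (intro power_decreasing) auto
    then show ?case by (simp add: power_abs)
  qed
qed

lemma cmult_power_bigo: "l \<le> m \<Longrightarrow> (\<lambda>t. c * t ^ m) \<in> O_pow l"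
  using power_bigo_power by (cases "c = 0") auto

lemma bigo_power_mono:
  "f \<in> O_pow m \<Longrightarrow> n \<le> m \<Longrightarrow> f \<in> O_pow n"
  using landau_o.big_trans power_bigo_power by blast

lemma power_not_bigo:
  fixes c :: real
  assumes "(\<lambda>t. c * t ^ n) \<in> O[at 0](\<lambda>t. t ^ Suc n)" shows "c = 0"
proof -
  obtain C where C: "\<forall>\<^sub>F t in at 0. norm (c * t ^ n) \<le> C * norm (t ^ Suc n)"
    using landau_o.bigE[OF assms] by blast
  then have "\<forall>\<^sub>F t in at (0::real). \<bar>c\<bar> \<le> C * \<bar>t\<bar>"
    using eventually_neq_at_within[of 0 0 UNIV]
  proof eventually_elim
    case (elim t)
    then have "\<bar>c\<bar> * \<bar>t\<bar> ^ n \<le> (C * \<bar>t\<bar>) * \<bar>t\<bar> ^ n"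
      by (simp add: abs_mult power_abs mult_ac)
    moreover have "\<bar>t\<bar> ^ n > 0" using elim by auto
    ultimately show ?case using mult_le_cancel_right_pos by blast
  qed
  moreover have "((\<lambda>t. C * \<bar>t\<bar>) \<longlongrightarrow> C * \<bar>0\<bar>) (at (0::real))"
    by (intro tendsto_intros)
  ultimately have "\<bar>c\<bar> \<le> C * \<bar>0\<bar>"
    by (intro tendsto_lowerbound) auto
  then show ?thesis by simp
qed

lemma has_jet_mono:
  assumes "has_jet M g a" "N \<le> M" shows "has_jet N g a"
proof -
  have split: "(\<Sum>n<M. a n * t ^ n) = (\<Sum>n<N. a n * t ^ n) + (\<Sum>n=N..<M. a n * t ^ n)" for t :: real
    using sum.atLeastLessThan_concat[of 0 N M "\<lambda>n. a n * t ^ n"] assms(2)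
    by (simp add: atLeast0LessThan)
  have "(\<lambda>t. g t - (\<Sum>n<M. a n * t ^ n) + (\<Sum>n=N..<M. a n * t ^ n)) \<in> O_pow N"
  proof (rule sum_in_bigo)
    show "(\<lambda>t. g t - (\<Sum>n<M. a n * t ^ n)) \<in> O_pow N"
      using assms bigo_power_mono unfolding has_jet_def by blast
    show "(\<lambda>t. \<Sum>n=N..<M. a n * t ^ n) \<in> O_pow N"
    proof (rule big_sum_in_bigo)
      fix n assume "n \<in> {N..<M}"
      then show "(\<lambda>t. a n * t ^ n) \<in> O_pow N"
        using power_bigo_power by (cases "a n = 0") auto
    qed
  qed
  then show ?thesis unfolding has_jet_def split by (simp add: algebra_simps)
qed

text \<open>Strong induction: once the lower coefficients agree, the difference of the two
  remainders is a multiple of \<open>t ^ n\<close> that is \<open>O(t ^ (n + 1))\<close>, hence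
  zero.\<close>

lemma has_jet_unique:
  assumes "has_jet N g a" "has_jet N g b" "n < N" shows "a n = b n"
  using assms(3)
proof (induction n rule: less_induct)
  case (less n)
  have "has_jet (Suc n) g a" "has_jet (Suc n) g b"
    using assms has_jet_mono less.prems by auto
  then have "(\<lambda>t. (g t - (\<Sum>j<Suc n. b j * t ^ j)) - (g t - (\<Sum>j<Suc n. a j * t ^ j)))
      \<in> O[at 0](\<lambda>t. t ^ Suc n)"
    unfolding has_jet_def by (rule sum_in_bigo(2)[rotated])
  moreover have "(\<Sum>j<n. a j * t ^ j) = (\<Sum>j<n. b j * t ^ j)" for t
    using less by (intro sum.cong) auto
  ultimately have "(\<lambda>t. (a n - b n) * t ^ n) \<in> O[at 0](\<lambda>t. t ^ Suc n)"
    by (simp add: algebra_simps)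
  then show ?case using power_not_bigo by fastforce
qed

lemma has_jet_add:
  assumes "has_jet N f a" "has_jet N g b"
  shows "has_jet N (\<lambda>t. f t + g t) (\<lambda>n. a n + b n)"
  using sum_in_bigo(1)[OF assms[unfolded has_jet_def]]
  unfolding has_jet_def by (simp add: algebra_simps sum.distrib)

lemma has_jet_cmult:
  assumes "has_jet N f a" shows "has_jet N (\<lambda>t. c * f t) (\<lambda>n. c * a n)"
proof -
  have "(\<lambda>t. c * (f t - (\<Sum>n<N. a n * t ^ n))) \<in> O_pow N"
    using assms unfolding has_jet_def by (cases "c = 0") auto
  then show ?thesis unfolding has_jet_def by (simp add: algebra_simps sum_distrib_left)
qed

lemma has_jet_diff:
  assumes "has_jet N f a" "has_jet N g b"
  shows "has_jet N (\<lambda>t. f t - g t) (\<lambda>n. a n - b n)"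
  using has_jet_add[OF assms(1) has_jet_cmult[OF assms(2), of "- 1"]] by simp

lemma has_jet_sum:
  assumes "\<And>i. i \<in> A \<Longrightarrow> has_jet N (f i) (a i)"
  shows "has_jet N (\<lambda>t. \<Sum>i\<in>A. f i t) (\<lambda>n. \<Sum>i\<in>A. a i n)"
proof -
  have "(\<lambda>t. \<Sum>i\<in>A. (f i t - (\<Sum>n<N. a i n * t ^ n))) \<in> O_pow N"
    using assms unfolding has_jet_def by (intro big_sum_in_bigo)
  then show ?thesis
    unfolding has_jet_def by (simp add: sum_subtractf sum_distrib_right sum.swap[of _ A])
qed

lemma has_jet_power_compose:
  assumes "\<And>N. has_jet N g a" "i > 0"
  shows "has_jet N (\<lambda>t. t ^ k * g (t ^ i))
    (\<lambda>n. if k \<le> n \<and> i dvd (n - k) then a ((n - k) div i) else 0)" (is "has_jet N ?f ?b")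
proof -
  have lim: "filterlim (\<lambda>t::real. t ^ i) (at 0) (at 0)"
  proof (rule filterlim_atI)
    show "((\<lambda>t::real. t ^ i) \<longlongrightarrow> 0) (at 0)"
    proof -
      have "((\<lambda>t::real. t ^ i) \<longlongrightarrow> 0 ^ i) (at 0)" by (intro tendsto_intros)
      then show ?thesis using assms(2) by (simp add: power_0_left)
    qed
    show "\<forall>\<^sub>F t::real in at 0. t ^ i \<noteq> 0"
      by (rule eventually_mono[OF eventually_neq_at_within[of 0 0 UNIV]]) simp
  qed
  have "(\<lambda>t. g (t ^ i) - (\<Sum>n<N. a n * (t ^ i) ^ n)) \<in> O[at 0](\<lambda>t. (t ^ i) ^ N)"
    using landau_o.big.compose[OF assms(1)[of N, unfolded has_jet_def] lim] .
  then have "(\<lambda>t. t ^ k * (g (t ^ i) - (\<Sum>n<N. a n * (t ^ i) ^ n))) \<in> O[at 0](\<lambda>t. t ^ k * (t ^ i) ^ N)"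
    by (rule landau_o.big.mult_left)
  moreover have "(\<Sum>n<k + i * N. ?b n * t ^ n) = (\<Sum>n<N. a n * t ^ (k + i * n))" for t :: real
  proof -
    \<comment> \<open>Exponents not of the form \<open>k + i * q\<close> have coefficient zero;
      dropping them leaves \<open>t ^ k\<close> times the truncated series of \<open>g\<close> at
      \<open>t ^ i\<close>.\<close>
    have "(\<Sum>n<k + i * N. ?b n * t ^ n) = (\<Sum>n\<in>(\<lambda>n. k + i * n) ` {..<N}. ?b n * t ^ n)"
    proof (rule sum.mono_neutral_right)
      show "\<forall>n\<in>{..<k + i * N} - (\<lambda>n. k + i * n) ` {..<N}. ?b n * t ^ n = 0"
      proof
        fix n assume n: "n \<in> {..<k + i * N} - (\<lambda>n. k + i * n) ` {..<N}"
        have "\<not> (k \<le> n \<and> i dvd (n - k))"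
        proof
          assume "k \<le> n \<and> i dvd (n - k)"
          then obtain q where "n - k = i * q" "k \<le> n" by blast
          then have "n = k + i * q" by simp
          moreover have "q < N" using n calculation assms(2) by auto
          ultimately show False using n by blast
        qed
        then show "?b n * t ^ n = 0" by (simp only: if_False mult_zero_left)
      qed
    qed (use assms(2) in auto)
    also have "\<dots> = (\<Sum>n<N. a n * t ^ (k + i * n))"
      using assms(2) by (subst sum.reindex) (auto simp: inj_on_def)
    finally show ?thesis .
  qed
  ultimately have "has_jet (k + i * N) ?f ?b"
    unfolding has_jet_def
    by (simp add: right_diff_distrib sum_distrib_left power_add power_mult[symmetric] mult_ac)
  moreover have "N \<le> k + i * N" using assms(2) by (simp add: trans_le_add2)
  ultimately show ?thesis by (rule has_jet_mono)
qed

definition tcoeff :: "(real \<Rightarrow> real) \<Rightarrow> nat \<Rightarrow> real" where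
  "tcoeff g n = (vderiv ^^ n) g 0 / fact n"

lemma ball_subset_open:
  fixes U :: "real set"
  assumes "open U" "x \<in> U" obtains d where "d > 0" "{x - d..x + d} \<subseteq> U"
  using assms open_contains_cball[of U] by (metis cball_eq_atLeastAtMost)

lemma smooth_has_jet:
  assumes "smooth U g" "0 \<in> U" shows "has_jet N g (tcoeff g)"
proof -
  obtain d where d: "d > 0" "{-d..d} \<subseteq> U"
    using ball_subset_open[OF smoothD(1)[OF assms(1)] assms(2)] by auto
  let ?D = "\<lambda>n. (vderiv ^^ n) g"
  have der: "(?D n has_real_derivative ?D (Suc n) t) (at t)" if "t \<in> U" for n t
    using smooth_has_vderiv[OF smooth_funpow_vderiv[OF assms(1)] that, of n]
    by (simp add: real_vector_derivative_iff)
  \<comment> \<open>Bounds the derivative in the Lagrange remainder. The order is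
    \<open>Suc N\<close> because \<open>Taylor\<close> needs a positive one.\<close>
  have "compact (?D (Suc N) ` {-d..d})"
    using d by (intro compact_continuous_image continuous_on_subset[OF
        smooth_continuous[OF smooth_funpow_vderiv[OF assms(1)]]]) auto
  then obtain C where C: "\<And>t. t \<in> {-d..d} \<Longrightarrow> norm (?D (Suc N) t) \<le> C"
    by (meson bounded_iff compact_imp_bounded imageI)
  have "has_jet (Suc N) g (tcoeff g)"
    unfolding has_jet_def
  proof (rule bigoI)
    have "\<forall>\<^sub>F t::real in at 0. t \<in> {-d<..<d} - {0}"
      using d by (intro eventually_at_in_open) auto
    then show "\<forall>\<^sub>F t in at 0. norm (g t - (\<Sum>n<Suc N. tcoeff g n * t ^ n))
        \<le> (C / fact (Suc N)) * norm (t ^ Suc N)"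
    proof eventually_elim
      case (elim t)
      then obtain s where s: "if t < 0 then t < s \<and> s < 0 else 0 < s \<and> s < t"
        "g t = (\<Sum>m<Suc N. ?D m 0 / fact m * (t - 0) ^ m) + ?D (Suc N) s / fact (Suc N) * (t - 0) ^ Suc N"
        using Taylor[of "Suc N" ?D g "-d" d 0 t] der d by (auto simp: subset_iff)
      have "norm (?D (Suc N) s) \<le> C" using s elim by (intro C) (auto split: if_splits)
      moreover have "g t - (\<Sum>n<Suc N. tcoeff g n * t ^ n) = ?D (Suc N) s / fact (Suc N) * t ^ Suc N"
        unfolding s(2) by (simp add: tcoeff_def del: sum.lessThan_Suc)
      ultimately show ?case
        by (simp only: norm_mult norm_divide) (intro mult_mono divide_mono, auto)
    qed
  qed
  then show ?thesis by (rule has_jet_mono) simp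
qed

section \<open>Flat functions and odd roots\<close>

lemma smooth_flat_funpow:
  assumes "smooth U g" "0 \<in> U" "\<And>N. has_jet N g (\<lambda>_. 0)"
  shows "(vderiv ^^ n) g 0 = 0"
  using has_jet_unique[OF smooth_has_jet[OF assms(1,2)] assms(3), of n "Suc n"]
  by (simp add: tcoeff_def)

lemma smooth_flat_vderiv:
  assumes "smooth U g" "0 \<in> U" "\<And>N. has_jet N g (\<lambda>_. 0)"
  shows "has_jet N (vderiv g) (\<lambda>_. 0)"
proof -
  have "(vderiv ^^ n) (vderiv g) 0 = 0" for n
    using smooth_flat_funpow[OF assms, of "Suc n"] by (simp add: funpow_swap1)
  then have "tcoeff (vderiv g) = (\<lambda>_. 0)" by (simp add: tcoeff_def fun_eq_iff)
  then show ?thesis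
    using smooth_has_jet[OF smooth_vderiv[OF assms(1)] assms(2)] by metis
qed

text \<open>With \<open>s = root k x\<close>, differentiation preserves the shape
  \<open>r s / s ^ j\<close>: \<open>r\<close> becomes \<open>(s * r' - j * r) / k\<close>, which is
  flat again, and \<open>j\<close> becomes \<open>j + k\<close>. At \<open>x = 0\<close> the
  function and the claimed derivative are zero because \<open>r 0 = 0\<close>, and the difference
  quotient is \<open>r s / s ^ (j + k)\<close>, which tends to 0 by flatness.\<close>

lemma flat_root_deriv:
  assumes k: "odd k" and r: "smooth U r" "0 \<in> U" "\<And>N. has_jet N r (\<lambda>_. 0)"
    and x: "root k x \<in> U"
  shows "((\<lambda>x. r (root k x) / root k x ^ j) has_real_derivative
    (root k x * vderiv r (root k x) - j * r (root k x)) / k / root k x ^ (j + k)) (at x)"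
proof (cases "x = 0")
  case False
  let ?s = "root k x"
  have s: "?s \<noteq> 0" using False k by (metis odd_pos real_root_eq_0_iff)
  have "(r has_real_derivative vderiv r ?s) (at ?s)"
    using smooth_has_vderiv[OF r(1) x]
    by (simp add: real_vector_derivative_iff)
  then have 1: "((\<lambda>x. r (root k x)) has_real_derivative
      vderiv r ?s * inverse (k * ?s ^ (k - Suc 0))) (at x)"
    using DERIV_chain2[OF _ DERIV_odd_real_root[OF k False]] by blast
  have 2: "((\<lambda>x. root k x ^ j) has_real_derivative
      j * (inverse (k * ?s ^ (k - Suc 0)) * ?s ^ (j - Suc 0))) (at x)"
    by (rule DERIV_power[OF DERIV_odd_real_root[OF k False], of j])
  have "?s ^ k = ?s * ?s ^ (k - Suc 0)"
    using k by (metis Suc_pred odd_pos power_Suc One_nat_def)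
  moreover have "real k > 0" using k by (simp add: odd_pos)
  ultimately have "(vderiv r ?s * inverse (k * ?s ^ (k - Suc 0)) * ?s ^ j
      - r ?s * (j * (inverse (k * ?s ^ (k - Suc 0)) * ?s ^ (j - Suc 0)))) / (?s ^ j * ?s ^ j) =
    (?s * vderiv r ?s - j * r ?s) / k / ?s ^ (j + k)"
    using s by (cases j) (simp_all add: field_simps power_add)
  then show ?thesis
    using DERIV_divide[OF 1 2] s by simp
next
  case True
  have k0: "k > 0" using k by (simp add: odd_pos)
  have "r 0 = 0"
    using smooth_flat_funpow[OF r, of 0] by simp
  have "(\<lambda>t. r t) \<in> O[at 0](\<lambda>t. t ^ Suc (j + k))" using r(3)[of "Suc (j + k)"]
    by (simp add: has_jet_def)
  then have "(\<lambda>t. r t / t ^ (j + k)) \<in> O[at 0](\<lambda>t. t ^ Suc (j + k) / t ^ (j + k))"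
    by (intro landau_o.big.divide_right eventually_mono[OF eventually_neq_at_within[of 0 0 UNIV]]) auto
  also have "(\<lambda>t. t ^ Suc (j + k) / t ^ (j + k)) \<in> O[at 0](\<lambda>t::real. t)"
    by (intro bigoI[where c=1]) (auto simp: eventually_at_filter)
  finally have "(\<lambda>t. r t / t ^ (j + k)) \<in> O[at 0](\<lambda>t. t)" .
  then obtain C where C: "\<forall>\<^sub>F t in at 0. norm (r t / t ^ (j + k)) \<le> C * norm t"
    using landau_o.bigE by blast
  have "((\<lambda>t::real. C * norm t) \<longlongrightarrow> C * norm (0::real)) (at 0)"
    by (intro tendsto_mult tendsto_const tendsto_norm[OF tendsto_ident_at])
  then have lim: "((\<lambda>t. r t / t ^ (j + k)) \<longlongrightarrow> 0) (at 0)"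
    by (intro Lim_null_comparison[OF C]) simp
  have "filterlim (root k) (at 0) (at 0)"
  proof (rule filterlim_atI)
    show "(root k \<longlongrightarrow> 0) (at 0)"
      using tendsto_real_root[OF tendsto_ident_at, of k 0 UNIV] by simp
    show "\<forall>\<^sub>F x in at 0. root k x \<noteq> 0" using k0 by (auto simp: eventually_at_filter)
  qed
  from filterlim_compose[OF lim this]
  have "((\<lambda>h. r (root k h) / root k h ^ (j + k)) \<longlongrightarrow> 0) (at 0)" .
  then show ?thesis
    using True k \<open>r 0 = 0\<close> k0
    by (simp add: has_field_derivative_iff power_add odd_real_root_pow field_simps)
qed

lemma smooth_flat_root:
  assumes k: "odd k" and r: "smooth U r" "0 \<in> U" "\<And>N. has_jet N r (\<lambda>_. 0)"
  shows "smooth {x. root k x \<in> U} (\<lambda>x. r (root k x))"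
proof -
  have op: "open {x. root k x \<in> U}"
    using open_vimage[OF smoothD(1)[OF r(1)] continuous_on_real_root[OF continuous_on_id], of k]
    by (simp add: vimage_def)
  \<comment> \<open>Generalised over all flat \<open>r\<close> and all \<open>j\<close>, so that
    differentiation stays within the induction hypothesis; the goal is the case
    \<open>j = 0\<close>.\<close>
  have "Ck_on N (\<lambda>x. r (root k x) / root k x ^ j) {x. root k x \<in> U}"
    if "smooth U r" "\<And>N. has_jet N r (\<lambda>_. 0)" for N r j
    using that
  proof (induction N arbitrary: r j)
    case 0
    then show ?case
      using flat_root_deriv[OF k 0(1) r(2) 0(2)]
      by (auto intro!: continuous_at_imp_continuous_on DERIV_isCont)
  next
    case (Suc N)
    let ?q = "\<lambda>s. (s * vderiv r s - j * r s) / k"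
    have "smooth U (\<lambda>s. inverse k * (s * vderiv r s - j * r s))"
      using smoothD(1)[OF Suc.prems(1)]
      by (intro smooth_mult smooth_diff smooth_const smooth_ident
          smooth_vderiv Suc.prems)
    then have q: "smooth U ?q" by (simp add: field_simps)
    have qf: "has_jet M ?q (\<lambda>_. 0)" for M
    proof -
      have "(\<lambda>s. vderiv r s) \<in> O_pow M" "r \<in> O_pow M"
        using smooth_flat_vderiv[OF Suc.prems(1) r(2) Suc.prems(2), of M] Suc.prems(2)[of M]
        by (auto simp: has_jet_def)
      moreover have "(\<lambda>s::real. s) \<in> O[at 0](\<lambda>t. 1)"
        using power_bigo_power[of 0 1] by simp
      ultimately have "(\<lambda>s. (1 / k) * (s * vderiv r s - j * r s)) \<in> O[at 0](\<lambda>t. 1 * (1 * t ^ M))"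
        using landau_o.big.mult[of "\<lambda>s. s" "at 0" "\<lambda>_. 1" "vderiv r" "\<lambda>t. t ^ M"]
          landau_o.big.mult[of "\<lambda>s. real j" "at 0" "\<lambda>_. 1" r "\<lambda>t. t ^ M"]
        by (intro landau_o.big.mult sum_in_bigo) auto
      then show ?thesis by (simp add: has_jet_def)
    qed
    have "Ck_on N (\<lambda>x. ?q (root k x) / root k x ^ (j + k) * v) {x. root k x \<in> U}" for v
      by (intro Ck_on_bilinear[OF op bounded_bilinear_mult] Ck_on_const op Suc.IH[OF q qf])
    then show ?case
    proof (intro Ck_on_SucI[OF op])
      show "((\<lambda>x. r (root k x) / root k x ^ j) has_derivative
          (\<lambda>v. ?q (root k x) / root k x ^ (j + k) * v)) (at x)" if "x \<in> {x. root k x \<in> U}" for x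
        using flat_root_deriv[OF k Suc.prems(1) r(2) Suc.prems(2), of x j] that
        unfolding has_field_derivative_def by blast
    qed
  qed
  from this[OF r(1,3), of _ 0] show ?thesis using op by (simp add: smooth_def)
qed

section \<open>Borel's theorem\<close>

lemma funpow_vderiv_add:
  fixes f g :: "real \<Rightarrow> 'a::euclidean_space"
  assumes "smooth UNIV f" "smooth UNIV g"
  shows "(vderiv ^^ k) (\<lambda>x. f x + g x) = (\<lambda>x. (vderiv ^^ k) f x + (vderiv ^^ k) g x)"
proof (induction k)
  case (Suc k)
  show ?case
    using vderiv_add[OF smooth_funpow_vderiv[OF assms(1), of k]
        smooth_funpow_vderiv[OF assms(2), of k]] by (simp add: Suc fun_eq_iff)
qed simp

text \<open>Global bounds do the work of compact support: rescaling the argument by \<open>L\<close>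
  costs only a factor \<open>L ^ p\<close> in the \<open>p\<close>-th derivative, uniformly in
  \<open>x\<close>.\<close>

definition bounded_smooth :: "(real \<Rightarrow> real) \<Rightarrow> bool" where
  "bounded_smooth u \<longleftrightarrow> smooth UNIV u \<and> (\<forall>k. \<exists>B. \<forall>x. \<bar>(vderiv ^^ k) u x\<bar> \<le> B)"

lemma bounded_smooth_vderiv: "bounded_smooth u \<Longrightarrow> bounded_smooth (vderiv u)"
  unfolding bounded_smooth_def
  by (metis comp_apply funpow_Suc_right smooth_vderiv)

lemma bounded_smooth_mult:
  assumes "bounded_smooth u" "bounded_smooth v" shows "bounded_smooth (\<lambda>x. u x * v x)"
proof -
  have "\<exists>B. \<forall>x. \<bar>(vderiv ^^ k) (\<lambda>x. u x * v x) x\<bar> \<le> B"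
    if "bounded_smooth u" "bounded_smooth v" for k u v
    using that
  proof (induction k arbitrary: u v)
    case 0
    obtain B C where B: "\<And>x. \<bar>u x\<bar> \<le> B" "\<And>x. \<bar>v x\<bar> \<le> C"
      using 0 unfolding bounded_smooth_def by (metis funpow_0)
    have "\<bar>u x * v x\<bar> \<le> B * C" for x
      using mult_mono[OF B(1)[of x] B(2)[of x]] B(1)[of x] by (simp add: abs_mult)
    then show ?case by auto
  next
    case (Suc k)
    have sm: "smooth UNIV u" "smooth UNIV v" "smooth UNIV (vderiv u)" "smooth UNIV (vderiv v)"
      using Suc.prems smooth_vderiv unfolding bounded_smooth_def by blast+
    have "vderiv (\<lambda>x. u x * v x) = (\<lambda>x. vderiv u x * v x + u x * vderiv v x)"
      using vderiv_scaleR[OF sm(2,1)] by (simp add: fun_eq_iff)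
    then have eq: "(vderiv ^^ Suc k) (\<lambda>x. u x * v x) =
        (\<lambda>x. (vderiv ^^ k) (\<lambda>x. vderiv u x * v x) x + (vderiv ^^ k) (\<lambda>x. u x * vderiv v x) x)"
      using funpow_vderiv_add[OF smooth_mult[OF sm(3,2)] smooth_mult[OF sm(1,4)]]
      by (simp add: funpow_swap1)
    obtain B C where B: "\<And>x. \<bar>(vderiv ^^ k) (\<lambda>x. vderiv u x * v x) x\<bar> \<le> B"
        "\<And>x. \<bar>(vderiv ^^ k) (\<lambda>x. u x * vderiv v x) x\<bar> \<le> C"
      using Suc bounded_smooth_vderiv by metis
    have "\<bar>(vderiv ^^ Suc k) (\<lambda>x. u x * v x) x\<bar> \<le> B + C" for x
      unfolding eq using B[of x] by linarith
    then show ?case by blast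
  qed
  then show ?thesis
    using assms smooth_mult unfolding bounded_smooth_def by blast
qed

text \<open>Differentiation shifts the phase by \<open>pi / 2\<close>, so every derivative is again
  a sine.\<close>

lemma bounded_smooth_sin: "bounded_smooth sin"
proof -
  have d: "((\<lambda>x. sin (x + real k * (pi / 2))) has_vector_derivative sin (x + real (Suc k) * (pi / 2))) (at x)"
    for k x
  proof -
    have "sin (x + real (Suc k) * (pi / 2)) = cos (x + real k * (pi / 2))"
    proof -
      have "x + real (Suc k) * (pi / 2) = (x + real k * (pi / 2)) + pi / 2" by (simp add: field_simps)
      then show ?thesis by (simp only: sin_add) simp
    qed
    then show ?thesis
      by (auto intro!: derivative_eq_intros simp: real_vector_derivative_iff[symmetric])
  qed
  have sm: "smooth UNIV (\<lambda>x. sin (x + real 0 * (pi / 2)))"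
    using smooth_derivative_sequence[OF open_UNIV, of "\<lambda>k x. sin (x + real k * (pi / 2))" 0] d
    by blast
  have "(vderiv ^^ k) sin = (\<lambda>x. sin (x + real k * (pi / 2)))" for k
  proof (induction k)
    case (Suc k)
    have "vderiv (\<lambda>x. sin (x + real k * (pi / 2))) = (\<lambda>x. sin (x + real (Suc k) * (pi / 2)))"
      by (rule ext, rule vderiv_eqI, rule d)
    then show ?case by (simp only: Suc funpow.simps comp_apply)
  qed simp
  then show ?thesis using sm unfolding bounded_smooth_def by (auto intro!: exI[of _ 1])
qed

lemma bounded_smooth_sin_power: "bounded_smooth (\<lambda>x. sin x ^ k)"
proof (induction k)
  case 0
  have "(vderiv ^^ k) (\<lambda>x. 1) = (if k = 0 then (\<lambda>x. 1::real) else (\<lambda>x. 0))" for k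
  proof (induction k)
    case (Suc k)
    have "vderiv (\<lambda>x. c::real) = (\<lambda>x. 0)" for c
      by (auto simp: fun_eq_iff intro!: vderiv_eqI derivative_eq_intros)
    then show ?case using Suc by simp
  qed simp
  then show ?case
    unfolding bounded_smooth_def using smooth_const[OF open_UNIV]
    by (auto intro!: exI[of _ 1])
next
  case (Suc k)
  then show ?case using bounded_smooth_mult[OF bounded_smooth_sin] by simp
qed

text \<open>From \<open>sin x = x + O(x ^ 2)\<close>, induction on \<open>k\<close> gives
  \<open>sin x ^ k = x ^ k + O(x ^ (k + 1))\<close>. This triangular shape makes the coefficients in
  Borel's theorem solvable.\<close>

lemma tcoeff_sin_power:
  "n < k \<Longrightarrow> tcoeff (\<lambda>x. sin x ^ k) n = 0" "tcoeff (\<lambda>x. sin x ^ k) k = 1"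
proof -
  have sm: "smooth UNIV (sin :: real \<Rightarrow> real)" "smooth UNIV (\<lambda>x::real. sin x ^ k)"
    using bounded_smooth_sin bounded_smooth_sin_power[of k] by (auto simp: bounded_smooth_def)
  have "(sin has_vector_derivative cos x) (at x)" for x :: real
    using DERIV_sin[of x] by (simp only: real_vector_derivative_iff)
  then have "vderiv sin 0 = 1" using vderiv_eqI by (metis cos_zero)
  then have "tcoeff sin 0 = 0" "tcoeff sin 1 = 1"
    by (simp_all add: tcoeff_def)
  then have "(\<lambda>x. sin x - x) \<in> O_pow 2"
    using smooth_has_jet[OF sm(1), of 2] unfolding has_jet_def by (simp add: numeral_2_eq_2)
  note s2 = this
  have "(\<lambda>x. (sin x - x) + x) \<in> O_pow 1"
    by (rule sum_in_bigo(1)[OF bigo_power_mono[OF s2]]) auto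
  then have s1: "sin \<in> O[at 0](\<lambda>x::real. x)" by simp
  have "(\<lambda>x. sin x ^ k - x ^ k) \<in> O[at 0](\<lambda>x::real. x ^ Suc k)"
  proof (induction k)
    case (Suc k)
    have "(\<lambda>x. sin x * (sin x ^ k - x ^ k) + x ^ k * (sin x - x)) \<in> O[at 0](\<lambda>x::real. x ^ Suc (Suc k))"
    proof (rule sum_in_bigo)
      show "(\<lambda>x. sin x * (sin x ^ k - x ^ k)) \<in> O[at 0](\<lambda>x::real. x ^ Suc (Suc k))"
        using landau_o.big.mult[OF s1 Suc] by simp
      show "(\<lambda>x. x ^ k * (sin x - x)) \<in> O[at 0](\<lambda>x::real. x ^ Suc (Suc k))"
        using landau_o.big.mult_left[OF s2, of "\<lambda>x. x ^ k"] by (simp add: power2_eq_square mult_ac)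
    qed
    then show ?case by (simp add: algebra_simps)
  qed simp
  moreover have "(\<Sum>n<Suc k. (if n = k then 1 else 0) * x ^ n) = x ^ k" for x :: real
    by (simp add: sum.neutral)
  ultimately have "has_jet (Suc k) (\<lambda>x. sin x ^ k) (\<lambda>n. if n = k then 1 else 0)"
    unfolding has_jet_def by simp
  then have "tcoeff (\<lambda>x. sin x ^ k) n = (if n = k then 1 else 0)" if "n < Suc k" for n
    using has_jet_unique[OF smooth_has_jet[OF sm(2)] _ that] by simp
  then show "n < k \<Longrightarrow> tcoeff (\<lambda>x. sin x ^ k) n = 0" "tcoeff (\<lambda>x. sin x ^ k) k = 1"
    by auto
qed

definition sin_power_bound :: "nat \<Rightarrow> nat \<Rightarrow> real" where
  "sin_power_bound k p = (SOME B. \<forall>x. \<bar>(vderiv ^^ p) (\<lambda>x. sin x ^ k) x\<bar> \<le> B)"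

lemma sin_power_bound: "\<bar>(vderiv ^^ p) (\<lambda>x. sin x ^ k) x\<bar> \<le> sin_power_bound k p"
  using bounded_smooth_sin_power[of k] someI_ex[of "\<lambda>B. \<forall>x. \<bar>(vderiv ^^ p) (\<lambda>x. sin x ^ k) x\<bar> \<le> B"]
  unfolding bounded_smooth_def sin_power_bound_def by blast

text \<open>The scale \<open>L\<close> is chosen so that for every \<open>p < k\<close> the
  \<open>p\<close>-th derivative of \<open>c / L ^ k * sin (L * x) ^ k\<close> is at most
  \<open>(1/2) ^ k\<close> in absolute value: it carries the factor
  \<open>L ^ p / L ^ k \<le> 1 / L\<close>. The summand 1 keeps \<open>L\<close> at least 1.\<close>

definition borel_scale :: "nat \<Rightarrow> real \<Rightarrow> real" where
  "borel_scale k c = 1 + 2 ^ k * \<bar>c\<bar> * (\<Sum>p<k. sin_power_bound k p)"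

text \<open>Solves a triangular system for the Taylor coefficients at 0: in degree \<open>n\<close>
  the terms with \<open>k < n\<close> are subtracted, the term with \<open>k = n\<close> enters with
  factor 1, and later ones contribute nothing. The scale of a term depends on its own coefficient,
  hence the recursion through \<open>borel_scale\<close>.\<close>

function borel_coeff :: "(nat \<Rightarrow> real) \<Rightarrow> nat \<Rightarrow> real" where
  "borel_coeff a n = a n - (\<Sum>k<n. borel_coeff a k * borel_scale k (borel_coeff a k) ^ n /
     borel_scale k (borel_coeff a k) ^ k * tcoeff (\<lambda>x. sin x ^ k) n)"
  by auto
termination by (relation "Wellfounded.measure snd") auto

declare borel_coeff.simps [simp del]

text \<open>The powers of the sine replace the usual cut-off monomials: their derivatives
  are bounded, and the jet of the \<open>k\<close>-th one starts with \<open>x ^ k\<close>, so the coefficients of the series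
  are found recursively.\<close>

theorem borel:
  fixes a :: "nat \<Rightarrow> real"
  obtains F where "smooth UNIV F" "tcoeff F = a"
proof -
  define c where "c = borel_coeff a"
  define L where "L k = borel_scale k (c k)" for k
  define u where "u k p = (vderiv ^^ p) (\<lambda>x. sin x ^ k)" for k p
  \<comment> \<open>The \<open>p\<close>-th derivative of the \<open>k\<close>-th summand
    \<open>c k / L k ^ k * sin (L k * x) ^ k\<close>.\<close>
  define d where "d p k x = c k * L k ^ p / L k ^ k * u k p (L k * x)" for p k x
  have B0: "0 \<le> sin_power_bound k p" for k p
    using sin_power_bound[of p k 0] by linarith
  have L1: "L k \<ge> 1" for k
    using B0 by (auto simp: L_def borel_scale_def intro!: mult_nonneg_nonneg sum_nonneg)
  have bound: "\<bar>d p k x\<bar> \<le> (1/2) ^ k" if "p < k" for p k x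
  proof -
    have "sin_power_bound k p \<le> (\<Sum>p<k. sin_power_bound k p)"
      using that B0 by (intro member_le_sum) auto
    then have "2 ^ k * \<bar>c k\<bar> * sin_power_bound k p \<le> 2 ^ k * \<bar>c k\<bar> * (\<Sum>p<k. sin_power_bound k p)"
      by (intro mult_left_mono) auto
    then have *: "2 ^ k * \<bar>c k\<bar> * sin_power_bound k p \<le> L k"
      unfolding L_def borel_scale_def by linarith
    have "L k ^ p * L k \<le> L k ^ k"
      using power_increasing[of "Suc p" k "L k"] that L1 by (simp add: mult_ac)
    then have "L k ^ p / L k ^ k \<le> 1 / L k"
      using L1[of k] by (simp add: field_simps)
    then have "\<bar>c k\<bar> * (L k ^ p / L k ^ k) * \<bar>u k p (L k * x)\<bar> \<le> \<bar>c k\<bar> * (1 / L k) * sin_power_bound k p"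
      using sin_power_bound[of p k] L1[of k] unfolding u_def
      by (intro mult_mono) auto
    also have "\<dots> \<le> (1/2) ^ k" using * L1[of k] by (simp add: field_simps power_divide)
    finally show ?thesis using L1[of k] by (simp add: d_def abs_mult)
  qed
  have su: "smooth UNIV (\<lambda>x::real. sin x ^ k)" for k
    using bounded_smooth_sin_power unfolding bounded_smooth_def by blast
  have der: "(d p k has_real_derivative d (Suc p) k x) (at x)" for p k x
  proof -
    have "(u k p has_real_derivative u k (Suc p) y) (at y)" for y
      using smooth_has_vderiv[OF smooth_funpow_vderiv[OF su]]
      by (simp add: u_def real_vector_derivative_iff)
    then have "((\<lambda>x. u k p (L k * x)) has_real_derivative u k (Suc p) (L k * x) * L k) (at x)"
      by (rule DERIV_chain2) (auto intro!: derivative_eq_intros)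
    from DERIV_cmult[OF this, of "c k * L k ^ p / L k ^ k"]
    show ?thesis unfolding d_def by (simp add: mult_ac)
  qed
  \<comment> \<open>For fixed \<open>p\<close> the geometric bound is available for
    \<open>k > p\<close>, hence the eventual form of the Weierstrass test.\<close>
  have conv: "uniformly_convergent_on UNIV (\<lambda>n x. \<Sum>k<n. d p k x)" for p
  proof (rule Weierstrass_m_test'_ev)
    show "\<forall>\<^sub>F k in sequentially. \<forall>x\<in>UNIV. norm (d p k x) \<le> (1/2) ^ k"
      by (rule eventually_mono[OF eventually_gt_at_top[of p]]) (use bound in auto)
    show "summable (\<lambda>k. (1/2::real) ^ k)" by (rule summable_geometric) auto
  qed
  have summ: "summable (\<lambda>k. d p k x)" for p x
  proof (rule summable_comparison_test_ev)
    show "\<forall>\<^sub>F k in sequentially. norm (d p k x) \<le> (1/2) ^ k"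
      by (rule eventually_mono[OF eventually_gt_at_top[of p]]) (use bound in auto)
    show "summable (\<lambda>k. (1/2::real) ^ k)" by (rule summable_geometric) auto
  qed
  define D where "D p x = (\<Sum>k. d p k x)" for p x
  have derD: "(D p has_vector_derivative D (Suc p) x) (at x)" for p x
    unfolding D_def real_vector_derivative_iff[symmetric]
    by (rule has_field_derivative_series'(2)[of UNIV "\<lambda>k. d p k" "\<lambda>k. d (Suc p) k" 0])
      (use der conv summ in auto)
  have sm: "smooth UNIV (D 0)"
    using smooth_derivative_sequence[OF open_UNIV, of D 0] derD by blast
  have Dp: "(vderiv ^^ p) (D 0) = D p" for p
  proof (induction p)
    case (Suc p)
    have "vderiv (D p) = D (Suc p)" by (rule ext, rule vderiv_eqI, rule derD)
    then show ?case by (simp only: Suc funpow.simps comp_apply)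
  qed simp
  have "tcoeff (D 0) n = a n" for n
  proof -
    have d0: "d n k 0 = fact n * (c k * L k ^ n / L k ^ k * tcoeff (\<lambda>x. sin x ^ k) n)" for k
      by (simp add: d_def u_def tcoeff_def)
    \<comment> \<open>At 0 the series is finite, since \<open>sin x ^ k\<close> has order
      \<open>k\<close>.\<close>
    have "D n 0 = (\<Sum>k<Suc n. d n k 0)"
      unfolding D_def by (rule suminf_finite) (auto simp: d0 tcoeff_sin_power)
    also have "\<dots> = fact n * (\<Sum>k<Suc n. c k * L k ^ n / L k ^ k * tcoeff (\<lambda>x. sin x ^ k) n)"
      by (simp only: d0 sum_distrib_left)
    also have "\<dots> = fact n * a n"
      using L1[of n] borel_coeff.simps[of a n]
      by (simp add: tcoeff_sin_power c_def L_def)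
    finally show ?thesis by (simp add: tcoeff_def Dp)
  qed
  then show ?thesis using that sm by blast
qed

section \<open>Functions on a monomial curve\<close>

text \<open>From \<open>n = (i + 1) * l + i * q\<close> it follows that \<open>n\<close> and
  \<open>l\<close> agree modulo \<open>i\<close>. Together with \<open>gap_index_dvd\<close> this
  assigns each exponent of the semigroup to exactly one \<open>l < i\<close>, so that no Taylor term
  is counted twice.\<close>

lemma gap_index_unique:
  fixes i l n :: nat
  assumes "l < i" "(i + 1) * l \<le> n" "i dvd n - (i + 1) * l" shows "l = n mod i"
proof -
  obtain q where "n - (i + 1) * l = i * q" using assms(3) by blast
  then have "n = l + i * (l + q)" using assms(2) by (simp add: algebra_simps)
  then show ?thesis using assms(1) by simp
qed

lemma gap_index_dvd:
  fixes i n :: nat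
  shows "i dvd n - (i + 1) * (n mod i)"
proof -
  have "n - (i + 1) * (n mod i) = (n - n mod i) - i * (n mod i)" by (simp add: algebra_simps)
  also have "n - n mod i = i * (n div i)" by (metis minus_mod_eq_mult_div)
  finally show ?thesis by (metis dvd_triv_left right_diff_distrib')
qed

text \<open>The assumption on \<open>n\<close> says that \<open>n\<close> lies in the semigroup generated by \<open>i\<close> and \<open>i + 1\<close>.
  Borel's theorem takes care of the Taylor series, and the flat remainder is a smooth function of
  the coordinate with an odd exponent.\<close>

lemma monomial_curve_factor:
  assumes g: "smooth U g" "0 \<in> U" and i: "i > 0"
    and gaps: "\<And>n. tcoeff g n \<noteq> 0 \<Longrightarrow> (i + 1) * (n mod i) \<le> n"
  obtains W F where "(0, 0) \<in> W" "smooth W F"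
    "\<And>t. (t ^ i, t ^ (i + 1)) \<in> W \<Longrightarrow> t \<in> U \<and> F (t ^ i, t ^ (i + 1)) = g t"
proof -
  \<comment> \<open>\<open>A l\<close> takes the Taylor coefficients at the exponents
    \<open>i * m + (i + 1) * l\<close>, so that \<open>(t ^ (i + 1)) ^ l * A l (t ^ i)\<close> has
    just this part of the series of \<open>g\<close>.\<close>
  have "\<forall>l. \<exists>A. smooth UNIV A \<and> tcoeff A = (\<lambda>m. tcoeff g (i * m + (i + 1) * l))"
    using borel by metis
  then obtain A where A: "\<And>l. smooth UNIV (A l)"
    "\<And>l. tcoeff (A l) = (\<lambda>m. tcoeff g (i * m + (i + 1) * l))" by metis
  define r where "r t = g t - (\<Sum>l<i. t ^ ((i + 1) * l) * A l (t ^ i))" for t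
  have o: "open U" using smoothD(1)[OF g(1)] .
  have Ai: "smooth U (\<lambda>t. A l (t ^ i))" for l
    by (rule smooth_compose[OF A(1) smooth_power[OF smooth_ident[OF o]]]) auto
  have r: "smooth U r"
    unfolding r_def
    by (intro smooth_diff g smooth_sum smooth_mult smooth_power
        smooth_ident o Ai) auto
  have flat: "has_jet N r (\<lambda>_. 0)" for N
  proof -
    let ?c = "\<lambda>l n. if (i + 1) * l \<le> n \<and> i dvd (n - (i + 1) * l)
       then tcoeff (A l) ((n - (i + 1) * l) div i) else 0"
    have "has_jet N (\<lambda>t. t ^ ((i + 1) * l) * A l (t ^ i)) (?c l)" for l
      using smooth_has_jet[OF A(1)] i by (intro has_jet_power_compose) auto
    then have "has_jet N r (\<lambda>n. tcoeff g n - (\<Sum>l<i. ?c l n))"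
      unfolding r_def by (intro has_jet_diff smooth_has_jet[OF g] has_jet_sum)
    moreover have "tcoeff g n - (\<Sum>l<i. ?c l n) = 0" for n
    proof -
      have "?c l n = (if l = n mod i then tcoeff g n else 0)" if "l < i" for l
      proof (cases "l = n mod i")
        case True
        then show ?thesis
          using gaps[of n] gap_index_dvd[of i n] by (auto simp: A(2))
      next
        case False
        then show ?thesis using gap_index_unique[OF that] by auto
      qed
      then have "(\<Sum>l<i. ?c l n) = (\<Sum>l<i. if l = n mod i then tcoeff g n else 0)"
        by (intro sum.cong) auto
      then show ?thesis using i by simp
    qed
    ultimately show ?thesis by simp
  qed
  \<comment> \<open>One of the two exponents is odd, and the odd root of that coordinate recovers
    \<open>t\<close> with its sign; \<open>z\<close> selects the coordinate.\<close>
  define k where "k = (if odd i then i else i + 1)"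
  define z where "z w = (if odd i then fst w else snd w)" for w :: "real \<times> real"
  have k: "odd k" by (simp add: k_def)
  define W where "W = {w. root k (z w) \<in> U}"
  define F where "F w = (\<Sum>l<i. snd w ^ l * A l (fst w)) + r (root k (z w))" for w
  have zl: "bounded_linear z"
    unfolding z_def by (cases "odd i") (simp_all add: bounded_linear_fst bounded_linear_snd)
  have "open (z -` {x. root k x \<in> U})"
    using smoothD(1)[OF smooth_flat_root[OF k r g(2) flat]] zl
    by (intro open_vimage) (auto intro: linear_continuous_on)
  then have oW: "open W" by (simp add: W_def vimage_def)
  have "smooth W (\<lambda>w. r (root k (z w)))"
    by (rule smooth_compose[OF smooth_flat_root[OF k r g(2) flat] smooth_linear[OF oW zl]])
      (auto simp: W_def)
  moreover have "smooth W (\<lambda>w. A l (fst w))" for l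
    by (rule smooth_compose[OF A(1) smooth_linear[OF oW bounded_linear_fst]]) auto
  ultimately have "smooth W F"
    unfolding F_def
    by (intro smooth_add smooth_sum oW smooth_mult smooth_power
        smooth_linear[OF oW bounded_linear_snd]) auto
  moreover have "(0, 0) \<in> W" using g(2) by (simp add: W_def z_def)
  moreover have "t \<in> U \<and> F (t ^ i, t ^ (i + 1)) = g t" if "(t ^ i, t ^ (i + 1)) \<in> W" for t
  proof -
    have "z (t ^ i, t ^ (i + 1)) = t ^ k" by (simp add: z_def k_def)
    then have rt: "root k (z (t ^ i, t ^ (i + 1))) = t" using k by (simp add: odd_real_root_power_cancel)
    then show ?thesis using that by (simp add: W_def F_def r_def power_mult[symmetric] del: power_Suc mult_Suc)
  qed
  ultimately show ?thesis using that by blast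
qed

section \<open>Expansion of functions of two variables along a curve\<close>

lemma differentiable_lipschitz_at:
  assumes "(f has_derivative f') (at x)"
  obtains C d where "d > 0" "C \<ge> 0" "\<And>y. norm (y - x) < d \<Longrightarrow> norm (f y - f x) \<le> C * norm (y - x)"
proof -
  have bl: "bounded_linear f'" using assms by (rule has_derivative_bounded_linear)
  then obtain K where K: "K \<ge> 0" "\<And>v. norm (f' v) \<le> norm v * K"
    using bounded_linear.nonneg_bounded by blast
  obtain d where d: "d > 0" "\<And>y. norm (y - x) < d \<Longrightarrow> norm (f y - f x - f' (y - x)) \<le> 1 * norm (y - x)"
    using assms unfolding has_derivative_at_alt by (metis zero_less_one)
  have "norm (f y - f x) \<le> (1 + K) * norm (y - x)" if "norm (y - x) < d" for y
    using d(2)[OF that] K(2)[of "y - x"] norm_triangle_sub[of "f y - f x" "f' (y - x)"]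
    by (simp add: algebra_simps)
  then show ?thesis using that d(1) K(1) by (metis add_nonneg_nonneg zero_le_one)
qed

text \<open>The mean value inequality is applied to \<open>F\<close> minus its linear part on the
  ball of radius \<open>norm z\<close>; there the derivative is \<open>O(norm z)\<close>, because
  both partial derivatives satisfy a Lipschitz estimate at 0.\<close>

lemma smooth_plane_quadratic_remainder:
  fixes F :: "real \<times> real \<Rightarrow> real"
  assumes F: "smooth W F" "0 \<in> W"
  obtains K d where "d > 0"
    "\<And>z. norm z < d \<Longrightarrow> \<bar>F z - F 0 - frechet_derivative F (at 0) z\<bar> \<le> K * (norm z)\<^sup>2"
proof -
  let ?F' = "\<lambda>w. frechet_derivative F (at w)"
  obtain d0 where d0: "d0 > 0" "ball 0 d0 \<subseteq> W"
    using smoothD(1)[OF F(1)] F(2) open_contains_ball by blast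
  obtain d1 C1 where 1: "d1 > 0" "C1 \<ge> 0"
    "\<And>y. norm (y - 0) < d1 \<Longrightarrow> norm (?F' y (1, 0) - ?F' 0 (1, 0)) \<le> C1 * norm (y - 0)"
    using differentiable_lipschitz_at[OF smooth_has_derivative[OF smooth_frechet[OF F(1), of "(1,0)"] F(2)]]
    by blast
  obtain d2 C2 where 2: "d2 > 0" "C2 \<ge> 0"
    "\<And>y. norm (y - 0) < d2 \<Longrightarrow> norm (?F' y (0, 1) - ?F' 0 (0, 1)) \<le> C2 * norm (y - 0)"
    using differentiable_lipschitz_at[OF smooth_has_derivative[OF smooth_frechet[OF F(1), of "(0,1)"] F(2)]]
    by blast
  define d where "d = min d0 (min d1 d2)"
  have "\<bar>F z - F 0 - ?F' 0 z\<bar> \<le> (C1 + C2) * (norm z)\<^sup>2" if z: "norm z < d" for z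
  proof -
    have bl: "bounded_linear (?F' 0)"
      using smooth_has_derivative[OF F] by (rule has_derivative_bounded_linear)
    have W: "w \<in> W" if "w \<in> cball 0 (norm z)" for w
      using that z by (intro subsetD[OF d0(2)]) (auto simp: d_def)
    have "norm ((F z - ?F' 0 z) - (F 0 - ?F' 0 0)) \<le> ((C1 + C2) * norm z) * norm (z - 0)"
    proof (rule differentiable_bound)
      show "convex (cball (0::real \<times> real) (norm z))" by simp
      show "((\<lambda>w. F w - ?F' 0 w) has_derivative (\<lambda>v. ?F' w v - ?F' 0 v)) (at w within cball 0 (norm z))"
        if "w \<in> cball 0 (norm z)" for w
        by (intro has_derivative_diff has_derivative_at_withinI[OF smooth_has_derivative[OF F(1) W[OF that]]]
            bounded_linear_imp_has_derivative bl)
      show "onorm (\<lambda>v. ?F' w v - ?F' 0 v) \<le> (C1 + C2) * norm z" if w: "w \<in> cball 0 (norm z)" for w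
      proof (rule onorm_le)
        fix v :: "real \<times> real"
        obtain a b where v: "v = (a, b)" by (cases v)
        have ab: "\<bar>a\<bar> \<le> norm v" "\<bar>b\<bar> \<le> norm v"
          using norm_fst_le[of a b] norm_snd_le[of b a] by (simp_all add: v)
        have "?F' w v - ?F' 0 v = a * (?F' w (1, 0) - ?F' 0 (1, 0)) + b * (?F' w (0, 1) - ?F' 0 (0, 1))"
          unfolding v frechet_derivative_plane[OF F(1) W[OF w], of a b] frechet_derivative_plane[OF F, of a b]
          by (simp add: algebra_simps)
        also have "norm \<dots> \<le> \<bar>a\<bar> * (C1 * norm w) + \<bar>b\<bar> * (C2 * norm w)"
          using 1(3)[of w] 2(3)[of w] w z
          by (intro order_trans[OF norm_triangle_ineq] add_mono) (auto simp: abs_mult d_def intro!: mult_left_mono)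
        also have "\<dots> \<le> norm v * (C1 * norm z) + norm v * (C2 * norm z)"
          using ab w 1 2 by (intro add_mono mult_mono) auto
        finally show "norm (?F' w v - ?F' 0 v) \<le> (C1 + C2) * norm z * norm v"
          by (simp add: algebra_simps)
      qed
    qed auto
    then show ?thesis
      using linear_0[OF bounded_linear.linear[OF bl]] by (simp add: power2_eq_square algebra_simps)
  qed
  moreover have "d > 0" using d0 1 2 by (simp add: d_def)
  ultimately show ?thesis using that by blast
qed

lemma bigo_const_at_0:
  fixes h :: "real \<Rightarrow> real"
  assumes "isCont h 0" shows "h \<in> O[at 0](\<lambda>_. 1)"
proof -
  have "\<forall>\<^sub>F t in at 0. dist (h t) (h 0) < 1"
    using assms unfolding isCont_def tendsto_iff by simp
  then have "\<forall>\<^sub>F t in at 0. norm (h t) \<le> (\<bar>h 0\<bar> + 1) * norm (1::real)"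
    by (rule eventually_mono) (auto simp: dist_real_def)
  then show ?thesis by (rule bigoI)
qed

text \<open>For \<open>i \<ge> 2\<close> the error order \<open>i + i\<close> is at least
  \<open>i + 2\<close>, so the linear part of \<open>F\<close> alone decides the coefficients of
  degrees \<open>i\<close> and \<open>i + 1\<close>.\<close>

lemma smooth_plane_compose_bigo:
  fixes F :: "real \<times> real \<Rightarrow> real"
  assumes F: "smooth W F" "(0, 0) \<in> W" and i: "i > 0"
    and XY: "X \<in> O_pow i" "Y \<in> O_pow i"
  shows "(\<lambda>t. F (X t, Y t) - (F (0, 0) + X t * frechet_derivative F (at (0, 0)) (1, 0)
      + Y t * frechet_derivative F (at (0, 0)) (0, 1))) \<in> O_pow (i + i)"
proof -
  let ?F' = "frechet_derivative F (at 0)"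
  have z: "(0, 0) = (0::real \<times> real)" by (simp add: zero_prod_def)
  obtain K d where K: "d > 0" "\<And>z. norm z < d \<Longrightarrow> \<bar>F z - F 0 - ?F' z\<bar> \<le> K * (norm z)\<^sup>2"
    using smooth_plane_quadratic_remainder[OF F(1)] F(2) unfolding z by blast
  obtain A where A: "A > 0" "\<forall>\<^sub>F t in at 0. norm (X t) \<le> A * norm (t ^ i)"
    using landau_o.bigE[OF XY(1)] by blast
  obtain B where B: "B > 0" "\<forall>\<^sub>F t in at 0. norm (Y t) \<le> B * norm (t ^ i)"
    using landau_o.bigE[OF XY(2)] by blast
  have "((\<lambda>t::real. (A + B) * \<bar>t\<bar> ^ i) \<longlongrightarrow> (A + B) * \<bar>0\<bar> ^ i) (at 0)" by (intro tendsto_intros)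
  then have "((\<lambda>t::real. (A + B) * \<bar>t\<bar> ^ i) \<longlongrightarrow> 0) (at 0)" using i by (simp add: power_0_left)
  then have "\<forall>\<^sub>F t::real in at 0. (A + B) * \<bar>t\<bar> ^ i < d" using K(1) by (rule order_tendstoD)
  then have "\<forall>\<^sub>F t in at 0. norm (F (X t, Y t) - (F (0, 0) + X t * ?F' (1, 0) + Y t * ?F' (0, 1)))
      \<le> (\<bar>K\<bar> * (A + B)\<^sup>2) * norm (t ^ (i + i))"
    using A(2) B(2)
  proof eventually_elim
    case (elim t)
    have n: "norm (X t, Y t) \<le> (A + B) * \<bar>t\<bar> ^ i"
      using norm_Pair_le[of "X t" "Y t"] elim by (simp add: power_abs algebra_simps)
    then have "norm (X t, Y t) < d" using elim by linarith
    from K(2)[OF this] have "\<bar>F (X t, Y t) - F 0 - ?F' (X t, Y t)\<bar> \<le> K * (norm (X t, Y t))\<^sup>2" .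
    also have "\<dots> \<le> \<bar>K\<bar> * ((A + B) * \<bar>t\<bar> ^ i)\<^sup>2"
      using n by (intro mult_mono power_mono) auto
    finally show ?case
      using frechet_derivative_plane[OF F, of "X t" "Y t"]
      by (simp add: z power_add power_abs power2_eq_square abs_mult algebra_simps)
  qed
  then show ?thesis unfolding z by (rule bigoI)
qed

text \<open>The value of \<open>e\<close> is left open: it cancels in the determinant of
  \<open>cusp_jet\<close>.\<close>

lemma power_jet:
  assumes "(\<lambda>t. \<phi> t - (\<phi>1 * t + \<phi>2 * t ^ 2)) \<in> O_pow 3"
  obtains e where "(\<lambda>t. \<phi> t ^ k - (\<phi>1 ^ k * t ^ k + e * t ^ (k + 1))) \<in> O_pow (k + 2)"
proof -
  have "\<exists>e. (\<lambda>t. \<phi> t ^ k - (\<phi>1 ^ k * t ^ k + e * t ^ (k + 1))) \<in> O_pow (k + 2)"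
  proof (induction k)
    case 0
    show ?case by (rule exI[of _ 0]) simp
  next
    case (Suc k)
    then obtain e where e: "(\<lambda>t. \<phi> t ^ k - (\<phi>1 ^ k * t ^ k + e * t ^ (k + 1))) \<in> O_pow (k + 2)"
      by blast
    note * = cmult_power_bigo
    have "(\<lambda>t. (\<phi> t - (\<phi>1 * t + \<phi>2 * t ^ 2)) + (\<phi>1 * t ^ 1 + \<phi>2 * t ^ 2)) \<in> O_pow 1"
      by (intro sum_in_bigo(1) * bigo_power_mono[OF assms]) auto
    then have f1: "\<phi> \<in> O[at 0](\<lambda>t. t)" by simp
    have "(\<lambda>t. \<phi> t * (\<phi> t ^ k - (\<phi>1 ^ k * t ^ k + e * t ^ (k + 1)))
        + (\<phi>1 ^ k * t ^ k + e * t ^ (k + 1)) * (\<phi> t - (\<phi>1 * t + \<phi>2 * t ^ 2))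
        + (e * \<phi>2) * t ^ (k + 3))
      \<in> O_pow (Suc k + 2)"
    proof (intro sum_in_bigo(1) *)
      show "(\<lambda>t. \<phi> t * (\<phi> t ^ k - (\<phi>1 ^ k * t ^ k + e * t ^ (k + 1)))) \<in> O_pow (Suc k + 2)"
        using landau_o.big.mult[OF f1 e] by simp
      have "(\<lambda>t. \<phi>1 ^ k * t ^ k + e * t ^ (k + 1)) \<in> O_pow k"
        by (intro sum_in_bigo(1) *) auto
      from landau_o.big.mult[OF this assms]
      show "(\<lambda>t. (\<phi>1 ^ k * t ^ k + e * t ^ (k + 1)) * (\<phi> t - (\<phi>1 * t + \<phi>2 * t ^ 2)))
          \<in> O_pow (Suc k + 2)"
        by (simp add: numeral_3_eq_3 mult_ac)
    qed simp
    also have "(\<lambda>t. \<phi> t * (\<phi> t ^ k - (\<phi>1 ^ k * t ^ k + e * t ^ (k + 1)))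
        + (\<phi>1 ^ k * t ^ k + e * t ^ (k + 1)) * (\<phi> t - (\<phi>1 * t + \<phi>2 * t ^ 2))
        + (e * \<phi>2) * t ^ (k + 3))
      = (\<lambda>t. \<phi> t ^ Suc k - (\<phi>1 ^ Suc k * t ^ Suc k + (\<phi>1 ^ k * \<phi>2 + e * \<phi>1) * t ^ (Suc k + 1)))"
      by (simp add: fun_eq_iff algebra_simps power2_eq_square numeral_3_eq_3)
    finally show ?case by blast
  qed
  then show ?thesis using that by blast
qed

lemma three_term_jet:
  assumes "i \<ge> 2" "(\<lambda>t. g t - (c + a * t ^ i + b * t ^ (i + 1))) \<in> O_pow (i + 2)"
  shows "has_jet (i + 2) g (\<lambda>n. if n = 0 then c else if n = i then a else if n = i + 1 then b else 0)"
    (is "has_jet _ _ ?f")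
proof -
  have "(\<Sum>n<i + 2. ?f n * t ^ n) = c + a * t ^ i + b * t ^ (i + 1)" for t :: real
  proof -
    have "(\<Sum>n<i. ?f n * t ^ n) = (\<Sum>n<i. if n = 0 then c else 0)"
      by (intro sum.cong) auto
    also have "\<dots> = c" using assms(1) by simp
    finally show ?thesis using assms(1) by (simp add: numeral_2_eq_2)
  qed
  then show ?thesis using assms(2) unfolding has_jet_def by simp
qed

lemma three_term_taylor:
  assumes g: "smooth U g" "0 \<in> U" and i: "i \<ge> 2"
    and jet: "(\<lambda>t. g t - (c + a * t ^ i + b * t ^ (i + 1))) \<in> O_pow (i + 2)"
  shows "tcoeff g i = a" "tcoeff g (i + 1) = b"
    "\<And>n. 0 < n \<Longrightarrow> n < i \<Longrightarrow> tcoeff g n = 0"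
  using has_jet_unique[OF smooth_has_jet[OF g] three_term_jet[OF i jet]] i by auto

section \<open>Plane cusps and their jets\<close>

text \<open>Degree 5 is the point: the two parameters can be matched there against a coefficient
  vector in the plane.\<close>

lemma cubic_reparam_taylor:
  fixes \<alpha> \<beta> :: real
  defines "\<psi> \<equiv> \<lambda>s. s + \<alpha> * s ^ 2 + \<beta> * s ^ 3"
  assumes p: "smooth U p" "0 \<in> U" "tcoeff p 1 = 0" "tcoeff p 2 = 0"
  defines "P \<equiv> \<lambda>s. p (\<psi> s)"
  shows "tcoeff P 1 = 0" "tcoeff P 2 = 0" "tcoeff P 3 = tcoeff p 3"
    "tcoeff P 4 = 3 * \<alpha> * tcoeff p 3 + tcoeff p 4"
    "tcoeff P 5 = 3 * (\<alpha>\<^sup>2 + \<beta>) * tcoeff p 3 + 4 * \<alpha> * tcoeff p 4 + tcoeff p 5"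
proof -
  let ?a = "tcoeff p 0" and ?b = "tcoeff p 3" and ?c = "tcoeff p 4" and ?d = "tcoeff p 5"
  have sm: "smooth UNIV \<psi>"
    unfolding \<psi>_def by (intro smooth_add smooth_mult smooth_power smooth_ident
        smooth_const open_UNIV)
  have op: "open {s. \<psi> s \<in> U}"
    using open_vimage[OF smoothD(1)[OF p(1)] smooth_continuous[OF sm]] by (simp add: vimage_def)
  have smP: "smooth {s. \<psi> s \<in> U} P"
    unfolding P_def by (rule smooth_compose[OF p(1) smooth_subset[OF sm _ op]]) auto
  have "(\<lambda>t. p t - (?a + ?b * t ^ 3 + ?c * t ^ 4 + ?d * t ^ 5)) \<in> O_pow 6"
    using smooth_has_jet[OF p(1,2), of 6] p(3,4)
    by (simp add: has_jet_def eval_nat_numeral)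
  moreover have lim: "filterlim \<psi> (at 0) (at 0)"
  proof (rule filterlim_atI)
    have "(\<psi> \<longlongrightarrow> \<psi> 0) (at 0)"
      unfolding \<psi>_def by (intro tendsto_intros)
    then show "(\<psi> \<longlongrightarrow> 0) (at 0)" by (simp add: \<psi>_def)
    have "((\<lambda>s. 1 + \<alpha> * s + \<beta> * s ^ 2) \<longlongrightarrow> 1 + \<alpha> * 0 + \<beta> * 0 ^ 2) (at (0::real))"
      by (intro tendsto_intros)
    then have "\<forall>\<^sub>F s in at 0. 1 + \<alpha> * s + \<beta> * s ^ 2 > 0"
      by (rule order_tendstoD) simp
    then show "\<forall>\<^sub>F s in at 0. \<psi> s \<noteq> 0"
      using eventually_neq_at_within[of 0 0 UNIV]
    proof eventually_elim
      case (elim s)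
      have "\<psi> s = s * (1 + \<alpha> * s + \<beta> * s ^ 2)"
        by (simp add: \<psi>_def algebra_simps power2_eq_square power3_eq_cube)
      then show ?case using elim by simp
    qed
  qed
  ultimately have 1: "(\<lambda>s. p (\<psi> s) - (?a + ?b * \<psi> s ^ 3 + ?c * \<psi> s ^ 4 + ?d * \<psi> s ^ 5)) \<in> O[at 0](\<lambda>s. \<psi> s ^ 6)"
    by (rule landau_o.big.compose)
  have b1: "f \<in> O[at 0](\<lambda>_. 1)" if "continuous_on UNIV f" for f :: "real \<Rightarrow> real"
    using that bigo_const_at_0 by (simp add: continuous_on_eq_continuous_at)
  have "(\<lambda>s. s ^ 6 * (1 + \<alpha> * s + \<beta> * s ^ 2) ^ 6) \<in> O[at 0](\<lambda>s::real. s ^ 6 * 1)"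
    by (intro landau_o.big.mult_left b1 continuous_intros)
  then have "(\<lambda>s. \<psi> s ^ 6) \<in> O_pow 6"
    by (simp add: \<psi>_def power_mult_distrib[symmetric] algebra_simps power2_eq_square power3_eq_cube)
  from landau_o.big_trans[OF 1 this]
  have 2: "(\<lambda>s. P s - (?a + ?b * \<psi> s ^ 3 + ?c * \<psi> s ^ 4 + ?d * \<psi> s ^ 5)) \<in> O_pow 6"
    by (simp add: P_def)
  define x where "x s = \<alpha> + \<beta> * s" for s
  have cx: "continuous_on UNIV x" unfolding x_def by (intro continuous_intros)
  \<comment> \<open>With \<open>\<psi> s = s * (1 + s * x s)\<close> the powers 3, 4 and 5 of
    \<open>\<psi> s\<close> are expanded; \<open>R\<close> gathers what is divisible by
    \<open>s ^ 6\<close>.\<close>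
  define R where "R s = ?b * (6 * \<alpha> * \<beta> + 3 * \<beta>\<^sup>2 * s + x s ^ 3)
    + ?c * (4 * \<beta> + 6 * x s ^ 2 + 4 * s * x s ^ 3 + s ^ 2 * x s ^ 4)
    + ?d * (5 * x s + 10 * s * x s ^ 2 + 10 * s ^ 2 * x s ^ 3 + 5 * s ^ 3 * x s ^ 4 + s ^ 4 * x s ^ 5)" for s
  have "(\<lambda>s. s ^ 6 * R s) \<in> O[at 0](\<lambda>s::real. s ^ 6 * 1)"
    unfolding R_def by (intro landau_o.big.mult_left b1 continuous_intros cx)
  then have "(\<lambda>s. (P s - (?a + ?b * \<psi> s ^ 3 + ?c * \<psi> s ^ 4 + ?d * \<psi> s ^ 5)) + s ^ 6 * R s) \<in> O_pow 6"
    by (intro sum_in_bigo(1) 2) simp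
  also have "(\<lambda>s. (P s - (?a + ?b * \<psi> s ^ 3 + ?c * \<psi> s ^ 4 + ?d * \<psi> s ^ 5)) + s ^ 6 * R s) =
    (\<lambda>s. P s - (?a + ?b * s ^ 3 + (3 * \<alpha> * ?b + ?c) * s ^ 4
      + (3 * (\<alpha>\<^sup>2 + \<beta>) * ?b + 4 * \<alpha> * ?c + ?d) * s ^ 5))"
    (is "?l = ?r")
  proof
    fix s
    show "?l s = ?r s" unfolding \<psi>_def R_def x_def by algebra
  qed
  finally have "has_jet 6 P (\<lambda>n. if n = 0 then ?a else if n = 3 then ?b else if n = 4 then 3 * \<alpha> * ?b + ?c
      else if n = 5 then 3 * (\<alpha>\<^sup>2 + \<beta>) * ?b + 4 * \<alpha> * ?c + ?d else 0)"
    by (simp add: has_jet_def eval_nat_numeral)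
  from has_jet_unique[OF smooth_has_jet[OF smP] this]
  show "tcoeff P 1 = 0" "tcoeff P 2 = 0" "tcoeff P 3 = tcoeff p 3"
    "tcoeff P 4 = 3 * \<alpha> * tcoeff p 3 + tcoeff p 4"
    "tcoeff P 5 = 3 * (\<alpha>\<^sup>2 + \<beta>) * tcoeff p 3 + 4 * \<alpha> * tcoeff p 4 + tcoeff p 5"
    using p(2) by (simp_all add: \<psi>_def)
qed

text \<open>The determinant expresses independence of the coefficient vectors of degrees
  \<open>i\<close> and \<open>i + 1\<close>. The constant terms are free, so that the curve need not
  pass through the origin.\<close>

definition cusp_jet :: "nat \<Rightarrow> (real \<Rightarrow> real) \<Rightarrow> (real \<Rightarrow> real) \<Rightarrow> bool" where
  "cusp_jet i p q \<longleftrightarrow> (\<forall>n. 0 < n \<and> n < i \<longrightarrow> tcoeff p n = 0 \<and> tcoeff q n = 0) \<and>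
     tcoeff p i * tcoeff q (i + 1) - tcoeff p (i + 1) * tcoeff q i \<noteq> 0"

text \<open>The semigroup generated by 3 and 4 misses 5, and a cubic change of parameter removes the
  term of degree 5.\<close>

lemma cusp_jet_normalize:
  assumes i: "i = 2 \<or> i = 3" and p: "smooth U p" and q: "smooth U q" and U: "0 \<in> U"
    and jet: "cusp_jet i p q"
  obtains \<alpha> \<beta> where "cusp_jet i (\<lambda>s. p (s + \<alpha> * s ^ 2 + \<beta> * s ^ 3)) (\<lambda>s. q (s + \<alpha> * s ^ 2 + \<beta> * s ^ 3))"
    "\<forall>n. tcoeff (\<lambda>s. p (s + \<alpha> * s ^ 2 + \<beta> * s ^ 3)) n \<noteq> 0 \<longrightarrow> (i + 1) * (n mod i) \<le> n"
    "\<forall>n. tcoeff (\<lambda>s. q (s + \<alpha> * s ^ 2 + \<beta> * s ^ 3)) n \<noteq> 0 \<longrightarrow> (i + 1) * (n mod i) \<le> n"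
proof (cases "i = 2")
  case True
  \<comment> \<open>The semigroup generated by 2 and 3 misses only 1, so the parameter is kept in
    this case.\<close>
  have *: "(2 + 1) * (n mod 2) \<le> n" if "n \<noteq> 1" for n :: nat using that by presburger
  have "tcoeff p 1 = 0" "tcoeff q 1 = 0" using jet True by (auto simp: cusp_jet_def)
  then have "tcoeff p n \<noteq> 0 \<longrightarrow> (i + 1) * (n mod i) \<le> n"
    "tcoeff q n \<noteq> 0 \<longrightarrow> (i + 1) * (n mod i) \<le> n" for n
    using *[of n] True by (cases "n = 1"; simp)+
  then show ?thesis using jet by (intro that[of 0 0]) simp_all
next
  case False
  then have i3: "i = 3" using i by simp
  have v: "tcoeff p 1 = 0" "tcoeff p 2 = 0" "tcoeff q 1 = 0" "tcoeff q 2 = 0"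
    using jet by (auto simp: cusp_jet_def i3)
  define D where "D = tcoeff p 3 * tcoeff q 4 - tcoeff p 4 * tcoeff q 3"
  have D: "D \<noteq> 0" using jet by (simp add: cusp_jet_def i3 D_def)
  \<comment> \<open>Cramer's rule: \<open>a\<close> and \<open>b\<close> are the coordinates of the
    vector of degree 5 in the basis of the vectors of degrees 3 and 4.\<close>
  define a where "a = (tcoeff p 5 * tcoeff q 4 - tcoeff p 4 * tcoeff q 5) / D"
  define b where "b = (tcoeff p 3 * tcoeff q 5 - tcoeff p 5 * tcoeff q 3) / D"
  \<comment> \<open>The choice solves \<open>4 * \<alpha> + b = 0\<close> and
    \<open>3 * (\<alpha>\<^sup>2 + \<beta>) + a = 0\<close>, which makes the new coefficient of
    degree 5 vanish in both components.\<close>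
  define \<alpha> where "\<alpha> = - b / 4"
  define \<beta> where "\<beta> = - a / 3 - \<alpha>\<^sup>2"
  have ab: "tcoeff p 5 = a * tcoeff p 3 + b * tcoeff p 4"
    "tcoeff q 5 = a * tcoeff q 3 + b * tcoeff q 4"
  proof -
    have "D * tcoeff p 5 = D * (a * tcoeff p 3 + b * tcoeff p 4)"
      using D by (simp add: a_def b_def distrib_left) (simp add: D_def algebra_simps)
    then show "tcoeff p 5 = a * tcoeff p 3 + b * tcoeff p 4" using D by simp
    have "D * tcoeff q 5 = D * (a * tcoeff q 3 + b * tcoeff q 4)"
      using D by (simp add: a_def b_def distrib_left) (simp add: D_def algebra_simps)
    then show "tcoeff q 5 = a * tcoeff q 3 + b * tcoeff q 4" using D by simp
  qed
  let ?P = "\<lambda>s. p (s + \<alpha> * s ^ 2 + \<beta> * s ^ 3)" and ?Q = "\<lambda>s. q (s + \<alpha> * s ^ 2 + \<beta> * s ^ 3)"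
  note tp = cubic_reparam_taylor[OF p U v(1,2), of \<alpha> \<beta>]
  note tq = cubic_reparam_taylor[OF q U v(3,4), of \<alpha> \<beta>]
  have *: "(3 + 1) * (n mod 3) \<le> n" if "n \<noteq> 1" "n \<noteq> 2" "n \<noteq> 5" for n :: nat using that by presburger
  have z5: "tcoeff ?P 5 = 0" "tcoeff ?Q 5 = 0"
    unfolding tp(5) tq(5) ab by (simp_all add: \<alpha>_def \<beta>_def algebra_simps)
  have "cusp_jet 3 ?P ?Q"
  proof -
    have "n = 1 \<or> n = 2" if "0 < n" "n < 3" for n :: nat using that by auto
    moreover have "tcoeff ?P 3 * tcoeff ?Q 4 - tcoeff ?P 4 * tcoeff ?Q 3 = D"
      unfolding tp(3,4) tq(3,4) D_def by (simp add: algebra_simps)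
    ultimately show ?thesis using tp(1,2) tq(1,2) D unfolding cusp_jet_def by auto
  qed
  moreover have "tcoeff ?P n \<noteq> 0 \<longrightarrow> (i + 1) * (n mod i) \<le> n"
    "tcoeff ?Q n \<noteq> 0 \<longrightarrow> (i + 1) * (n mod i) \<le> n" for n
    using *[of n] z5 tp(1,2) tq(1,2) i3 by (cases "n = 1 \<or> n = 2 \<or> n = 5"; auto)+
  ultimately show ?thesis using i3 by (intro that[of \<alpha> \<beta>]) blast+
qed

text \<open>Applied to both components of a curve, this identifies the Jacobian determinant at the
  origin with the determinant in \<open>cusp_jet\<close>, which thereby becomes the hypothesis of
  the inverse function theorem.\<close>

lemma monomial_factor_partials:
  assumes g: "smooth U g" "0 \<in> U" and F: "smooth W F" "(0, 0) \<in> W" and i: "i \<ge> 2"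
    and eq: "\<And>t. (t ^ i, t ^ (i + 1)) \<in> W \<Longrightarrow> F (t ^ i, t ^ (i + 1)) = g t"
  shows "tcoeff g i = frechet_derivative F (at (0, 0)) (1, 0)"
    "tcoeff g (i + 1) = frechet_derivative F (at (0, 0)) (0, 1)"
proof -
  let ?a = "frechet_derivative F (at (0, 0)) (1, 0)" and ?b = "frechet_derivative F (at (0, 0)) (0, 1)"
  have "(\<lambda>t. F (t ^ i, t ^ (i + 1)) - (F (0, 0) + t ^ i * ?a + t ^ (i + 1) * ?b)) \<in> O_pow (i + i)"
    using i by (intro smooth_plane_compose_bigo[OF F] power_bigo_power) auto
  then have *: "(\<lambda>t. F (t ^ i, t ^ (i + 1)) - (F (0, 0) + ?a * t ^ i + ?b * t ^ (i + 1))) \<in> O_pow (i + 2)"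
    using bigo_power_mono[of _ "i + i" "i + 2"] i by (simp add: mult.commute)
  have "((\<lambda>t::real. (t ^ i, t ^ (i + 1))) \<longlongrightarrow> (0 ^ i, 0 ^ (i + 1))) (at 0)"
    by (intro tendsto_intros)
  then have "\<forall>\<^sub>F t::real in at 0. (t ^ i, t ^ (i + 1)) \<in> W"
    using i smoothD(1)[OF F(1)] F(2) by (intro topological_tendstoD) (auto simp: power_0_left)
  then have "\<forall>\<^sub>F t in at 0. F (t ^ i, t ^ (i + 1)) - (F (0, 0) + ?a * t ^ i + ?b * t ^ (i + 1)) =
      g t - (F (0, 0) + ?a * t ^ i + ?b * t ^ (i + 1))"
    by (rule eventually_mono) (simp only: eq)
  from landau_o.big.in_cong[OF this] *
  have "(\<lambda>t. g t - (F (0, 0) + ?a * t ^ i + ?b * t ^ (i + 1))) \<in> O_pow (i + 2)"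
    by blast
  from three_term_taylor(1,2)[OF g i this]
  show "tcoeff g i = ?a" "tcoeff g (i + 1) = ?b" .
qed

text \<open>Both diffeomorphisms arise as inverses: \<open>\<Phi>\<close> of the plane map
  \<open>(F1, F2)\<close> that sends the model cusp to the reparametrised curve, and
  \<open>\<phi>\<close> of the polynomial change of parameter \<open>\<psi>\<close>.\<close>

lemma cusp_jet_normal_form:
  assumes i: "i = 2 \<or> i = 3" and p: "smooth U p" and q: "smooth U q" and U: "0 \<in> U"
    and jet: "cusp_jet i p q"
  obtains U0 V0 \<phi> \<psi> W W' \<Phi> \<Psi> where "0 \<in> U0" "U0 \<subseteq> U" "\<phi> 0 = (0::real)"
    "homeomorphism U0 V0 \<phi> \<psi>" "smooth U0 \<phi>" "smooth V0 \<psi>"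
    "homeomorphism W W' \<Phi> \<Psi>" "smooth W \<Phi>" "smooth W' \<Psi>"
    "\<forall>t\<in>U0. (p t, q t) \<in> W \<and> \<Phi> (p t, q t) = (\<phi> t ^ i, \<phi> t ^ (i + 1))"
proof -
  obtain \<alpha> \<beta> where ab: "cusp_jet i (\<lambda>s. p (s + \<alpha> * s ^ 2 + \<beta> * s ^ 3)) (\<lambda>s. q (s + \<alpha> * s ^ 2 + \<beta> * s ^ 3))"
    "\<forall>n. tcoeff (\<lambda>s. p (s + \<alpha> * s ^ 2 + \<beta> * s ^ 3)) n \<noteq> 0 \<longrightarrow> (i + 1) * (n mod i) \<le> n"
    "\<forall>n. tcoeff (\<lambda>s. q (s + \<alpha> * s ^ 2 + \<beta> * s ^ 3)) n \<noteq> 0 \<longrightarrow> (i + 1) * (n mod i) \<le> n"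
    by (rule cusp_jet_normalize[OF i p q U jet])
  define \<psi> where "\<psi> s = s + \<alpha> * s ^ 2 + \<beta> * s ^ 3" for s
  define P where "P s = p (\<psi> s)" for s
  define Q where "Q s = q (\<psi> s)" for s
  note ab = ab[folded \<psi>_def, folded P_def Q_def]
  have i2: "i \<ge> 2" "i > 0" using i by auto
  have sm: "smooth UNIV \<psi>"
    unfolding \<psi>_def by (intro smooth_add smooth_mult smooth_power smooth_ident
        smooth_const open_UNIV)
  have op: "open {s. \<psi> s \<in> U}"
    using open_vimage[OF smoothD(1)[OF p] smooth_continuous[OF sm]] by (simp add: vimage_def)
  have smP: "smooth {s. \<psi> s \<in> U} P" "smooth {s. \<psi> s \<in> U} Q"
    unfolding P_def Q_def
    using smooth_compose[OF p smooth_subset[OF sm _ op]]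
      smooth_compose[OF q smooth_subset[OF sm _ op]] by auto
  have \<psi>0: "\<psi> 0 = 0" by (simp add: \<psi>_def)
  then have U0: "0 \<in> {s. \<psi> s \<in> U}" using U by simp
  obtain W1 F1 where F1: "(0, 0) \<in> W1" "smooth W1 F1"
    "\<And>t. (t ^ i, t ^ (i + 1)) \<in> W1 \<Longrightarrow> t \<in> {s. \<psi> s \<in> U} \<and> F1 (t ^ i, t ^ (i + 1)) = P t"
    by (rule monomial_curve_factor[OF smP(1) U0 i2(2) ab(2)[rule_format]]) blast+
  obtain W2 F2 where F2: "(0, 0) \<in> W2" "smooth W2 F2"
    "\<And>t. (t ^ i, t ^ (i + 1)) \<in> W2 \<Longrightarrow> t \<in> {s. \<psi> s \<in> U} \<and> F2 (t ^ i, t ^ (i + 1)) = Q t"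
    by (rule monomial_curve_factor[OF smP(2) U0 i2(2) ab(3)[rule_format]]) blast+
  note part1 = monomial_factor_partials[OF smP(1) U0 F1(2,1) i2(1)]
  note part2 = monomial_factor_partials[OF smP(2) U0 F2(2,1) i2(1)]
  have J: "jacobian F1 F2 (0, 0) \<noteq> 0"
    using ab(1) part1 part2 F1(3) F2(3) unfolding jacobian_def cusp_jet_def by simp
  have oW: "open (W1 \<inter> W2)" using smoothD(1) F1(2) F2(2) by blast
  have sm12: "smooth (W1 \<inter> W2) F1" "smooth (W1 \<inter> W2) F2" "(0, 0) \<in> W1 \<inter> W2"
    using smooth_subset[OF F1(2) _ oW] smooth_subset[OF F2(2) _ oW] F1(1) F2(1) by auto
  obtain U' V g where g: "open U'" "U' \<subseteq> W1 \<inter> W2" "(0, 0) \<in> U'" "open V"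
    "homeomorphism U' V (\<lambda>z. (F1 z, F2 z)) g" "smooth V g"
    using smooth_local_inverse_plane[OF sm12 J] by metis
  have "(\<psi> has_vector_derivative 1) (at 0)"
    unfolding \<psi>_def real_vector_derivative_iff[symmetric]
    by (auto intro!: derivative_eq_intros)
  then have "vderiv \<psi> 0 \<noteq> 0" using vderiv_eqI by fastforce
  then obtain A B \<phi> where \<phi>: "open A" "0 \<in> A" "open B" "\<psi> 0 \<in> B" "homeomorphism A B \<psi> \<phi>" "smooth B \<phi>"
    using smooth_local_inverse_real[OF sm UNIV_I] by metis
  have \<phi>\<psi>: "\<And>s. s \<in> A \<Longrightarrow> \<psi> s \<in> B \<and> \<phi> (\<psi> s) = s" "\<And>t. t \<in> B \<Longrightarrow> \<phi> t \<in> A \<and> \<psi> (\<phi> t) = t"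
    using \<phi>(5) by (auto simp: homeomorphism_def)
  \<comment> \<open>Cut down so that the model points
    \<open>(\<phi> t ^ i, \<phi> t ^ (i + 1))\<close> stay in the set \<open>U'\<close> on which
    \<open>(F1, F2)\<close> is inverted.\<close>
  define U0 where "U0 = B \<inter> (\<lambda>t. (\<phi> t ^ i, \<phi> t ^ (i + 1))) -` U'"
  define V0 where "V0 = A \<inter> (\<lambda>s. (s ^ i, s ^ (i + 1))) -` U'"
  have oU0: "open U0" unfolding U0_def
    by (intro continuous_open_preimage continuous_intros smooth_continuous[OF \<phi>(6)] \<phi> g)
  have oV0: "open V0" unfolding V0_def
    by (intro continuous_open_preimage continuous_intros \<phi> g)
  have im: "\<phi> ` U0 = V0"
  proof
    show "\<phi> ` U0 \<subseteq> V0" using \<phi>\<psi> by (auto simp: U0_def V0_def)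
    show "V0 \<subseteq> \<phi> ` U0"
    proof
      fix s assume "s \<in> V0"
      then have "\<psi> s \<in> U0" "\<phi> (\<psi> s) = s" using \<phi>\<psi>(1) by (auto simp: U0_def V0_def)
      then show "s \<in> \<phi> ` U0" by force
    qed
  qed
  show ?thesis
  proof (rule that[of U0 \<phi> V0 \<psi> V U' g "\<lambda>z. (F1 z, F2 z)"])
    show "0 \<in> U0" using \<phi>(2,4) \<phi>\<psi>(1)[of 0] \<psi>0 g(3) i2 by (auto simp: U0_def power_0_left)
    show "\<phi> 0 = 0" using \<phi>\<psi>(1)[of 0] \<phi>(2) \<psi>0 by simp
    show "homeomorphism U0 V0 \<phi> \<psi>"
      by (rule homeomorphism_of_subsets[OF homeomorphism_symD[OF \<phi>(5)] _ _ im]) (auto simp: U0_def V0_def)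
    show "smooth U0 \<phi>" using smooth_subset[OF \<phi>(6) _ oU0] by (auto simp: U0_def)
    show "smooth V0 \<psi>" using smooth_subset[OF sm _ oV0] by auto
    show "homeomorphism V U' g (\<lambda>z. (F1 z, F2 z))" using g(5) by (rule homeomorphism_symD)
    show "smooth V g" by fact
    show "smooth U' (\<lambda>z. (F1 z, F2 z))"
      using smooth_subset[OF smooth_Pair[OF sm12(1,2)] g(2,1)] .
    have key: "\<phi> t \<in> {s. \<psi> s \<in> U} \<and> \<psi> (\<phi> t) = t \<and> F1 (\<phi> t ^ i, \<phi> t ^ (i + 1)) = p t \<and>
        F2 (\<phi> t ^ i, \<phi> t ^ (i + 1)) = q t" if "t \<in> U0" for t
    proof -
      have "(\<phi> t ^ i, \<phi> t ^ (i + 1)) \<in> W1 \<inter> W2" using that g(2) by (auto simp: U0_def)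
      moreover have "\<psi> (\<phi> t) = t" using that \<phi>\<psi>(2) by (auto simp: U0_def)
      ultimately show ?thesis using F1(3)[of "\<phi> t"] F2(3)[of "\<phi> t"] by (simp add: P_def Q_def del: power_Suc)
    qed
    then show "U0 \<subseteq> U" by force
    show "\<forall>t\<in>U0. (p t, q t) \<in> V \<and> g (p t, q t) = (\<phi> t ^ i, \<phi> t ^ (i + 1))"
    proof
      fix t assume t: "t \<in> U0"
      have "(\<phi> t ^ i, \<phi> t ^ (i + 1)) \<in> U'" using t by (auto simp: U0_def)
      then have "(F1 (\<phi> t ^ i, \<phi> t ^ (i + 1)), F2 (\<phi> t ^ i, \<phi> t ^ (i + 1))) \<in> V \<and>
          g (F1 (\<phi> t ^ i, \<phi> t ^ (i + 1)), F2 (\<phi> t ^ i, \<phi> t ^ (i + 1))) = (\<phi> t ^ i, \<phi> t ^ (i + 1))"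
        using g(5) unfolding homeomorphism_def by blast
      then show "(p t, q t) \<in> V \<and> g (p t, q t) = (\<phi> t ^ i, \<phi> t ^ (i + 1))" using key[OF t] by simp
    qed
  qed
qed

text \<open>The model cusp has determinant 1. The source map multiplies it by the powers
  \<open>i\<close> and \<open>i + 1\<close> of its derivative at 0, the target map by its Jacobian
  determinant; none of these factors is zero.\<close>

lemma cusp_normal_form_jet:
  assumes i: "i \<ge> 2" and F: "smooth W F1" "smooth W F2" "(0, 0) \<in> W" "jacobian F1 F2 (0, 0) \<noteq> 0"
    and \<phi>: "smooth U \<phi>" "0 \<in> U" "\<phi> 0 = 0" "vderiv \<phi> 0 \<noteq> 0"
    and W: "\<And>t. t \<in> U \<Longrightarrow> (\<phi> t ^ i, \<phi> t ^ (i + 1)) \<in> W"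
  shows "cusp_jet i (\<lambda>t. F1 (\<phi> t ^ i, \<phi> t ^ (i + 1))) (\<lambda>t. F2 (\<phi> t ^ i, \<phi> t ^ (i + 1)))"
proof -
  let ?f = "vderiv \<phi> 0"
  have "tcoeff \<phi> 0 = 0" "tcoeff \<phi> 1 = ?f" by (simp_all add: tcoeff_def \<phi>)
  then have \<phi>jet: "(\<lambda>t. \<phi> t - (?f * t + tcoeff \<phi> 2 * t ^ 2)) \<in> O_pow 3"
    using smooth_has_jet[OF \<phi>(1,2), of 3] by (simp add: has_jet_def eval_nat_numeral)
  obtain e where e: "(\<lambda>t. \<phi> t ^ i - (?f ^ i * t ^ i + e * t ^ (i + 1))) \<in> O_pow (i + 2)"
    using power_jet[OF \<phi>jet] .
  obtain e' where e': "(\<lambda>t. \<phi> t ^ (i + 1) - (?f ^ (i + 1) * t ^ (i + 1) + e' * t ^ (i + 1 + 1))) \<in> O_pow (i + 1 + 2)"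
    using power_jet[OF \<phi>jet] .
  note * = cmult_power_bigo
  have "(\<lambda>t. (\<phi> t ^ (i + 1) - (?f ^ (i + 1) * t ^ (i + 1) + e' * t ^ (i + 1 + 1))) + e' * t ^ (i + 2)) \<in> O_pow (i + 2)"
    by (intro sum_in_bigo(1) bigo_power_mono[OF e'] *) auto
  then have e2: "(\<lambda>t. \<phi> t ^ (i + 1) - ?f ^ (i + 1) * t ^ (i + 1)) \<in> O_pow (i + 2)"
    by simp
  have "(\<lambda>t. (\<phi> t ^ i - (?f ^ i * t ^ i + e * t ^ (i + 1))) + (?f ^ i * t ^ i + e * t ^ (i + 1))) \<in> O_pow i"
    by (intro sum_in_bigo(1) bigo_power_mono[OF e] *) auto
  then have X: "(\<lambda>t. \<phi> t ^ i) \<in> O_pow i" by simp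
  have "(\<lambda>t. (\<phi> t ^ (i + 1) - ?f ^ (i + 1) * t ^ (i + 1)) + ?f ^ (i + 1) * t ^ (i + 1)) \<in> O_pow i"
    by (intro sum_in_bigo(1) bigo_power_mono[OF e2] *) auto
  then have Y: "(\<lambda>t. \<phi> t ^ (i + 1)) \<in> O_pow i" by simp
  have o: "open U" using smoothD(1)[OF \<phi>(1)] .
  have main: "tcoeff (\<lambda>t. F (\<phi> t ^ i, \<phi> t ^ (i + 1))) i = frechet_derivative F (at (0, 0)) (1, 0) * ?f ^ i \<and>
      tcoeff (\<lambda>t. F (\<phi> t ^ i, \<phi> t ^ (i + 1))) (i + 1) =
        frechet_derivative F (at (0, 0)) (1, 0) * e + frechet_derivative F (at (0, 0)) (0, 1) * ?f ^ (i + 1) \<and>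
      (\<forall>n. 0 < n \<and> n < i \<longrightarrow> tcoeff (\<lambda>t. F (\<phi> t ^ i, \<phi> t ^ (i + 1))) n = 0)"
    if F: "smooth W F" for F
  proof -
    let ?a = "frechet_derivative F (at (0, 0)) (1, 0)" and ?b = "frechet_derivative F (at (0, 0)) (0, 1)"
    let ?g = "\<lambda>t. F (\<phi> t ^ i, \<phi> t ^ (i + 1))"
    have "(\<lambda>t. ?g t - (F (0, 0) + \<phi> t ^ i * ?a + \<phi> t ^ (i + 1) * ?b)) \<in> O_pow (i + i)"
      using i by (intro smooth_plane_compose_bigo[OF F \<open>(0, 0) \<in> W\<close>] X Y) auto
    then have "(\<lambda>t. ?g t - (F (0, 0) + \<phi> t ^ i * ?a + \<phi> t ^ (i + 1) * ?b)) \<in> O_pow (i + 2)"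
      by (rule bigo_power_mono) (use i in auto)
    moreover have "(\<lambda>t. ?a * (\<phi> t ^ i - (?f ^ i * t ^ i + e * t ^ (i + 1)))) \<in> O_pow (i + 2)"
      using e by (cases "?a = 0") auto
    moreover have "(\<lambda>t. ?b * (\<phi> t ^ (i + 1) - ?f ^ (i + 1) * t ^ (i + 1))) \<in> O_pow (i + 2)"
      using e2 by (cases "?b = 0") auto
    ultimately have "(\<lambda>t. (?g t - (F (0, 0) + \<phi> t ^ i * ?a + \<phi> t ^ (i + 1) * ?b)) +
        ?a * (\<phi> t ^ i - (?f ^ i * t ^ i + e * t ^ (i + 1))) + ?b * (\<phi> t ^ (i + 1) - ?f ^ (i + 1) * t ^ (i + 1)))
      \<in> O_pow (i + 2)"
      by (intro sum_in_bigo(1))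
    then have jet: "(\<lambda>t. ?g t - (F (0, 0) + (?a * ?f ^ i) * t ^ i + (?a * e + ?b * ?f ^ (i + 1)) * t ^ (i + 1)))
      \<in> O_pow (i + 2)"
      by (simp add: algebra_simps)
    have "smooth U (\<lambda>t. (\<phi> t ^ i, \<phi> t ^ (i + 1)))"
      by (intro smooth_Pair smooth_power \<phi>)
    then have "smooth U ?g" by (rule smooth_compose[OF F]) (use W in auto)
    from three_term_taylor[OF this \<phi>(2) i jet] show ?thesis by blast
  qed
  have "?f ^ i * ?f ^ (i + 1) * jacobian F1 F2 (0, 0) \<noteq> 0" using F(4) \<phi>(4) by simp
  then show ?thesis
    using main[OF F(1)] main[OF F(2)] unfolding cusp_jet_def jacobian_def
    by (simp add: algebra_simps)
qed

section \<open>Cusps in the hyperbolic plane\<close>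

text \<open>At an endpoint \<open>t\<close> only agreement on one side is available. It passes to
  the derivatives at all points of \<open>U \<inter> I\<close>, endpoints included, so the induction
  continues.\<close>

lemma funpow_vderiv_agree:
  fixes F G :: "real \<Rightarrow> 'a::euclidean_space"
  assumes FG: "smooth U F" "smooth U G" and I: "is_interval I" "interior I \<noteq> {}"
    and eq: "\<And>t. t \<in> U \<inter> I \<Longrightarrow> F t = G t" and t: "t \<in> U \<inter> I"
  shows "(vderiv ^^ k) F t = (vderiv ^^ k) G t"
  using t
proof (induction k arbitrary: t)
  case (Suc k)
  have "vderiv ((vderiv ^^ k) F) t = vderiv ((vderiv ^^ k) G) t"
  proof (rule vderiv_within_eq[OF smooth_funpow_vderiv[OF FG(1)] I Suc.prems])
    show "(vderiv ^^ k) F s = (vderiv ^^ k) G s" if "s \<in> U \<inter> I" for s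
      by (rule Suc.IH[OF that])
    show "((vderiv ^^ k) G has_vector_derivative vderiv ((vderiv ^^ k) G) t) (at t within I)"
      using smooth_has_vderiv[OF smooth_funpow_vderiv[OF FG(2)], of t] Suc.prems
      by (auto intro: has_vector_derivative_at_within[of _ _ t])
  qed
  then show ?case by simp
qed (use eq in simp)

lemma tcoeff_agree:
  assumes "smooth U F" "smooth U G" "is_interval I" "interior I \<noteq> {}"
    and "\<And>t. t \<in> U \<inter> I \<Longrightarrow> F t = G t" and "0 \<in> U \<inter> I"
  shows "tcoeff F n = tcoeff G n"
  using funpow_vderiv_agree[OF assms] by (simp add: tcoeff_def)

section \<open>The hyperbolic plane as a graph over its last two coordinates\<close>

definition chart :: "real ^ 3 \<Rightarrow> real \<times> real" where
  "chart x = (x $ 2, x $ 3)"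

definition chart_inv :: "real \<times> real \<Rightarrow> real ^ 3" where
  "chart_inv z = vector [sqrt (1 + (fst z)\<^sup>2 + (snd z)\<^sup>2), fst z, snd z]"

lemma chart_chart_inv [simp]: "chart (chart_inv z) = z"
  by (simp add: chart_def chart_inv_def)

lemma chart_inv_in_hyperbolic: "chart_inv z \<in> hyperbolic_plane"
proof -
  have "0 < 1 + (fst z)\<^sup>2 + (snd z)\<^sup>2" by (simp add: add_pos_nonneg)
  then show ?thesis
    by (simp add: hyperbolic_plane_def lorentz_def chart_inv_def power2_eq_square[symmetric])
qed

lemma chart_inv_chart:
  assumes "x \<in> hyperbolic_plane" shows "chart_inv (chart x) = x"
proof -
  have "1 + (x $ 2)\<^sup>2 + (x $ 3)\<^sup>2 = (x $ 1)\<^sup>2" "x $ 1 > 0"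
    using assms by (auto simp: hyperbolic_plane_def lorentz_def power2_eq_square)
  then show ?thesis
    by (simp add: vec_eq_iff forall_3 chart_def chart_inv_def)
qed

lemma bounded_linear_chart: "bounded_linear chart"
  unfolding chart_def by (intro bounded_linear_Pair bounded_linear_vec_nth)

lemma smooth_chart_inv: "smooth UNIV chart_inv"
proof (rule smooth_vec)
  have f: "smooth UNIV (fst :: real \<times> real \<Rightarrow> real)" "smooth UNIV (snd :: real \<times> real \<Rightarrow> real)"
    by (auto intro!: smooth_linear bounded_linear_fst bounded_linear_snd)
  have "smooth UNIV (\<lambda>z::real \<times> real. 1 + (fst z)\<^sup>2 + (snd z)\<^sup>2)"
    by (intro smooth_add smooth_power f smooth_const open_UNIV)
  then have "smooth UNIV (\<lambda>z::real \<times> real. sqrt (1 + (fst z)\<^sup>2 + (snd z)\<^sup>2))"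
    by (rule smooth_compose[OF smooth_sqrt_real]) (auto simp: add_pos_nonneg)
  then show "smooth UNIV (\<lambda>z. chart_inv z $ i)" for i :: 3
    using exhaust_3[of i] f by (auto simp: chart_inv_def)
qed

text \<open>By the chain rule the derivative of \<open>(F1, F2)\<close> at \<open>z\<close> has a
  left inverse, hence trivial kernel.\<close>

lemma jacobian_nonzero_if_left_inverse:
  fixes H :: "real \<times> real \<Rightarrow> real \<times> real"
  assumes F: "smooth W F1" "smooth W F2" "z \<in> W"
    and H: "smooth V H" "(F1 z, F2 z) \<in> V"
    and inv: "\<And>w. w \<in> W \<Longrightarrow> H (F1 w, F2 w) = w"
  shows "jacobian F1 F2 z \<noteq> 0"
proof
  let ?A = "frechet_derivative F1 (at z)" and ?B = "frechet_derivative F2 (at z)"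
  let ?L = "\<lambda>v. (?A v, ?B v)"
  let ?H' = "frechet_derivative H (at (F1 z, F2 z))"
  assume J: "jacobian F1 F2 z = 0"
  have "((\<lambda>w. H (F1 w, F2 w)) has_derivative (\<lambda>v. ?H' (?L v))) (at z)"
    using has_derivative_compose[OF has_derivative_Pair[OF smooth_has_derivative[OF F(1,3)]
          smooth_has_derivative[OF F(2,3)]] smooth_has_derivative[OF H]] .
  then have "((\<lambda>w. w) has_derivative (\<lambda>v. ?H' (?L v))) (at z)"
    by (rule has_derivative_transform_within_open[OF _ smoothD(1)[OF F(1)] F(3)]) (simp add: inv)
  then have "(\<lambda>v. ?H' (?L v)) = (\<lambda>v. v)"
    using has_derivative_unique[OF _ has_derivative_ident] by blast
  then have id: "?H' (?L v) = v" for v by metis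
  have "linear ?H'"
    using smooth_has_derivative[OF H] has_derivative_linear by blast
  then have H0: "?H' (0, 0) = 0" using linear_0 by (metis zero_prod_def)
  have zero: "v = 0" if "?A v = 0" "?B v = 0" for v
    using id[of v] H0 that by simp
  let ?p1 = "?A (1, 0)" and ?p2 = "?A (0, 1)" and ?q1 = "?B (1, 0)" and ?q2 = "?B (0, 1)"
  have AB: "?A (a, b) = a * ?p1 + b * ?p2" "?B (a, b) = a * ?q1 + b * ?q2" for a b
    by (rule frechet_derivative_plane[OF F(1,3), unfolded real_scaleR_def]
        frechet_derivative_plane[OF F(2,3), unfolded real_scaleR_def])+
  have J': "?p1 * ?q2 = ?p2 * ?q1" using J by (simp add: jacobian_def)
  \<comment> \<open>If the determinant is zero, these vectors, orthogonal to the rows of the matrix,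
    lie in the kernel. So the rows vanish, and then \<open>(1, 0)\<close> is a kernel vector as
    well.\<close>
  have "(?p2, - ?p1) = 0" using J' by (intro zero) (simp_all add: AB[of ?p2 "- ?p1"] mult.commute)
  moreover have "(?q2, - ?q1) = 0" using J' by (intro zero) (simp_all add: AB[of ?q2 "- ?q1"] mult.commute)
  ultimately have "?p1 = 0" "?q1 = 0" by (auto simp: zero_prod_def)
  then have "(1::real, 0::real) = 0" by (intro zero)
  then show False by (simp add: zero_prod_def)
qed

lemma vderiv_nonzero_if_left_inverse:
  assumes "smooth U \<phi>" "t \<in> U" "smooth V \<theta>" "\<phi> t \<in> V" "\<And>s. s \<in> U \<Longrightarrow> \<theta> (\<phi> s) = (s::real)"
  shows "vderiv \<phi> t \<noteq> (0::real)"
proof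
  assume 0: "vderiv \<phi> t = 0"
  have "(\<phi> has_real_derivative vderiv \<phi> t) (at t)" "(\<theta> has_real_derivative vderiv \<theta> (\<phi> t)) (at (\<phi> t))"
    using smooth_has_vderiv[OF assms(1,2)] smooth_has_vderiv[OF assms(3,4)]
    by (simp_all add: real_vector_derivative_iff)
  from DERIV_chain2[OF this(2,1)] have "((\<lambda>s. \<theta> (\<phi> s)) has_real_derivative 0) (at t)" by (simp add: 0)
  then have "((\<lambda>s. s) has_real_derivative 0) (at t)"
    by (rule has_field_derivative_transform_within_open[OF _ smoothD(1)[OF assms(1)] assms(2)])
      (rule assms(5))
  then show False using DERIV_unique[OF _ DERIV_ident] by fastforce
qed

lemma smooth_translation: "smooth UNIV (\<lambda>t. a + t :: real)"
  by (intro smooth_add smooth_const smooth_ident open_UNIV)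

text \<open>The normal form of the plane curve is transported: the source is translated from
  \<open>t0\<close> to 0, and the target diffeomorphism is composed with the chart. Since
  \<open>C\<close> extends \<open>c\<close> beyond a possible endpoint, the source diffeomorphism is
  one of open sets.\<close>

lemma is_cusp_if_cusp_jet:
  assumes i: "i = 2 \<or> i = 3" and C: "smooth U C" "t0 \<in> U" and t0: "t0 \<in> J"
    and eq: "\<And>t. t \<in> U \<inter> J \<Longrightarrow> C t = c t" and H: "\<And>t. t \<in> J \<Longrightarrow> c t \<in> hyperbolic_plane"
    and jet: "cusp_jet i (\<lambda>t. C (t0 + t) $ 2) (\<lambda>t. C (t0 + t) $ 3)"
  shows "is_cusp i (i + 1) J hyperbolic_plane c t0"
proof -
  let ?p = "\<lambda>t. C (t0 + t) $ 2" and ?q = "\<lambda>t. C (t0 + t) $ 3"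
  let ?U = "{t. t0 + t \<in> U}"
  have oU: "open ?U"
    using open_vimage[OF smoothD(1)[OF C(1)] smooth_continuous[OF smooth_translation]] by (simp add: vimage_def)
  have "smooth ?U (\<lambda>t. C (t0 + t))"
    by (rule smooth_compose[OF C(1) smooth_subset[OF smooth_translation _ oU]]) auto
  then have pq: "smooth ?U ?p" "smooth ?U ?q" by (auto intro: smooth_nth)
  have "0 \<in> ?U" using C(2) by simp
  obtain U0 V0 \<phi> \<psi> W W' \<Phi> \<Psi> where nf: "0 \<in> U0" "U0 \<subseteq> ?U" "\<phi> 0 = (0::real)"
    "homeomorphism U0 V0 \<phi> \<psi>" "smooth U0 \<phi>" "smooth V0 \<psi>"
    "homeomorphism W W' \<Phi> \<Psi>" "smooth W \<Phi>" "smooth W' \<Psi>"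
    "\<forall>t\<in>U0. (?p t, ?q t) \<in> W \<and> \<Phi> (?p t, ?q t) = (\<phi> t ^ i, \<phi> t ^ (i + 1))"
    by (rule cusp_jet_normal_form[OF i pq \<open>0 \<in> ?U\<close> jet])
  define UU where "UU = {t. - t0 + t \<in> U0}"
  have oUU: "open UU"
    using open_vimage[OF smoothD(1)[OF nf(5)] smooth_continuous[OF smooth_translation[of "- t0"]]]
    by (simp add: UU_def vimage_def)
  let ?\<phi> = "\<lambda>t. \<phi> (- t0 + t)"
  have "(\<lambda>t. - t0 + t) ` UU = U0"
  proof
    show "U0 \<subseteq> (\<lambda>t. - t0 + t) ` UU"
    proof
      fix s assume "s \<in> U0"
      then show "s \<in> (\<lambda>t. - t0 + t) ` UU"
        by (intro image_eqI[of _ _ "t0 + s"]) (auto simp: UU_def)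
    qed
  qed (auto simp: UU_def)
  moreover have "(\<lambda>s. t0 + s) ` U0 = UU"
  proof
    show "UU \<subseteq> (\<lambda>s. t0 + s) ` U0"
    proof
      fix t assume "t \<in> UU"
      then show "t \<in> (\<lambda>s. t0 + s) ` U0"
        by (intro image_eqI[of _ _ "- t0 + t"]) (auto simp: UU_def)
    qed
  qed (auto simp: UU_def)
  ultimately have "homeomorphism UU U0 (\<lambda>t. - t0 + t) (\<lambda>s. t0 + s)"
    unfolding homeomorphism_def by (auto intro!: continuous_intros)
  from homeomorphism_compose[OF this nf(4)]
  have "homeomorphism UU V0 ?\<phi> (\<lambda>s. t0 + \<psi> s)" by (simp add: o_def)
  moreover have "smooth UU ?\<phi>"
    by (rule smooth_compose[OF nf(5) smooth_subset[OF smooth_translation _ oUU]]) (auto simp: UU_def)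
  moreover have "smooth V0 (\<lambda>s. t0 + \<psi> s)"
    using smoothD(1)[OF nf(6)] by (intro smooth_add smooth_const nf(6))
  ultimately have diff\<phi>: "diffeomorphism_on UU V0 ?\<phi>" by (auto intro: diffeomorphism_onI)
  define WW where "WW = hyperbolic_plane \<inter> chart -` W"
  have oC: "open (chart -` W)"
    by (intro open_vimage smoothD(1)[OF nf(8)] linear_continuous_on bounded_linear_chart)
  have "homeomorphism WW W chart chart_inv"
    unfolding homeomorphism_def
  proof (intro conjI ballI)
    show "chart ` WW = W"
    proof
      show "W \<subseteq> chart ` WW"
      proof
        fix z assume "z \<in> W"
        then show "z \<in> chart ` WW"
          using chart_inv_in_hyperbolic by (intro image_eqI[of _ _ "chart_inv z"]) (auto simp: WW_def)
      qed
    qed (auto simp: WW_def)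
    show "chart_inv ` W = WW"
    proof
      show "WW \<subseteq> chart_inv ` W"
      proof
        fix x assume "x \<in> WW"
        then show "x \<in> chart_inv ` W"
          by (intro image_eqI[of _ _ "chart x"]) (auto simp: WW_def chart_inv_chart)
      qed
    qed (auto simp: WW_def chart_inv_in_hyperbolic)
    show "continuous_on WW chart" by (rule linear_continuous_on[OF bounded_linear_chart])
    show "continuous_on W chart_inv"
      using smooth_continuous[OF smooth_chart_inv] continuous_on_subset by blast
  qed (auto simp: WW_def chart_inv_chart)
  from homeomorphism_compose[OF this nf(7)]
  have "homeomorphism WW W' (\<lambda>x. \<Phi> (chart x)) (\<lambda>z. chart_inv (\<Psi> z))" by (simp add: o_def)
  moreover have "smooth (chart -` W) (\<lambda>x. \<Phi> (chart x))"
    by (rule smooth_compose[OF nf(8) smooth_linear[OF oC bounded_linear_chart]]) auto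
  moreover have "smooth W' (\<lambda>z. chart_inv (\<Psi> z))"
    by (rule smooth_compose[OF smooth_chart_inv nf(9)]) auto
  ultimately have diff\<Phi>: "diffeomorphism_on WW W' (\<lambda>x. \<Phi> (chart x))"
    by (auto intro: diffeomorphism_onI simp: WW_def)
  have pts: "c t \<in> WW \<and> \<Phi> (chart (c t)) = (?\<phi> t ^ i, ?\<phi> t ^ (i + 1))" if t: "t \<in> UU \<inter> J" for t
  proof -
    have 1: "- t0 + t \<in> U0" using t by (simp add: UU_def)
    then have "t \<in> U" using nf(2) by auto
    then have "chart (c t) = (?p (- t0 + t), ?q (- t0 + t))" using eq[of t] t by (simp add: chart_def)
    then show ?thesis using bspec[OF nf(10) 1] H[of t] t by (simp add: WW_def)
  qed
  have t0': "t0 \<in> UU" using nf(1) by (simp add: UU_def)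
  have "openin (top_of_set hyperbolic_plane) WW" unfolding WW_def using oC by (auto simp: openin_open)
  moreover have "(0 ^ i, 0 ^ (i + 1)) \<in> W'"
  proof -
    have "chart (c t0) \<in> W" using pts[of t0] t0' t0 by (simp add: WW_def)
    then have "\<Phi> (chart (c t0)) \<in> W'" using homeomorphism_image1[OF nf(7)] by blast
    then show ?thesis using pts[of t0] t0' t0 nf(3) by simp
  qed
  moreover have "0 \<in> V0" using nf(1,3) homeomorphism_image1[OF nf(4)] by force
  ultimately show ?thesis
    unfolding is_cusp_def A_equivalent_germs_def
    using t0 t0' oUU smoothD(1)[OF nf(6)] smoothD(1)[OF nf(9)] diff\<phi> diff\<Phi> pts pts[of t0] nf(3)
    by (intro conjI exI[of _ UU] exI[of _ V0] exI[of _ ?\<phi>] exI[of _ WW] exI[of _ W']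
        exI[of _ "\<lambda>x. \<Phi> (chart x)"]) auto
qed

text \<open>In the chart, the inverse \<open>G\<close> of the target diffeomorphism presents the
  curve on \<open>J\<close> as the image of a reparametrised model cusp, whose jet is known.
  Agreement on \<open>J\<close> suffices to transfer the coefficients to the extension
  \<open>C\<close>.\<close>

lemma cusp_jet_if_is_cusp:
  assumes i: "i \<ge> 2" and C: "smooth U C" "t0 \<in> U"
    and J: "is_interval J" "interior J \<noteq> {}"
    and eq: "\<And>t. t \<in> U \<inter> J \<Longrightarrow> C t = c t" and cusp: "is_cusp i (i + 1) J hyperbolic_plane c t0"
  shows "cusp_jet i (\<lambda>t. C (t0 + t) $ 2) (\<lambda>t. C (t0 + t) $ 3)"
proof -
  from cusp obtain A V \<phi> W W' \<Phi> where t0: "t0 \<in> J" and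
    d: "open A" "t0 \<in> A" "open V" "(0::real) \<in> V" "diffeomorphism_on A V \<phi>" "\<phi> t0 = 0"
      "openin (top_of_set hyperbolic_plane) W" "c t0 \<in> W" "openin (top_of_set UNIV) W'"
      "(0 ^ i, 0 ^ (i + 1)) \<in> (W' :: (real \<times> real) set)" "diffeomorphism_on W W' \<Phi>" "\<Phi> (c t0) = (0 ^ i, 0 ^ (i + 1))"
      "\<forall>t\<in>A \<inter> J. c t \<in> W \<and> \<Phi> (c t) = (\<phi> t ^ i, \<phi> t ^ (i + 1))"
    unfolding is_cusp_def A_equivalent_germs_def by blast
  have z: "(0 ^ i, 0 ^ (i + 1)) = (0::real, 0::real)" using i by (simp add: power_0_left)
  obtain \<theta> where \<theta>: "homeomorphism A V \<phi> \<theta>" "smooth_map_on A \<phi>" "smooth_map_on V \<theta>"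
    using d(5) unfolding diffeomorphism_on_def by blast
  have sm\<phi>: "smooth A \<phi>" "smooth V \<theta>"
    using smooth_map_on_open \<theta> d(1,3) by blast+
  have \<phi>': "vderiv \<phi> t0 \<noteq> 0"
    by (rule vderiv_nonzero_if_left_inverse[OF sm\<phi>(1) d(2) sm\<phi>(2)])
      (use \<theta>(1) d(4,6) in \<open>auto simp: homeomorphism_def\<close>)
  obtain G where G: "homeomorphism W W' \<Phi> G" "smooth_map_on W \<Phi>" "smooth_map_on W' G"
    using d(11) unfolding diffeomorphism_on_def by blast
  have oW': "open W'" using d(9) by simp
  have smG: "smooth W' G" by (rule smooth_map_on_open[OF G(3) oW'])
  have WH: "W \<subseteq> hyperbolic_plane" using d(7) openin_imp_subset by blast
  have Gc: "G (\<Phi> (c t)) = c t" "\<Phi> (c t) \<in> W'" if "t \<in> A \<inter> J" for t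
    using bspec[OF d(13) that] homeomorphism_apply1[OF G(1)] homeomorphism_image1[OF G(1)] by blast+
  have GW: "G z \<in> W" "\<Phi> (G z) = z" if "z \<in> W'" for z using that G(1) by (auto simp: homeomorphism_def)
  define F1 where "F1 z = G z $ 2" for z
  define F2 where "F2 z = G z $ 3" for z
  have smF: "smooth W' F1" "smooth W' F2"
    unfolding F1_def F2_def by (intro smooth_nth smG)+
  have Fchart: "(F1 z, F2 z) = chart (G z)" for z by (simp add: F1_def F2_def chart_def)
  have "(0, 0) \<in> W'" using d(10) unfolding z .
  obtain X \<Phi>' where X: "c t0 \<in> X" "smooth X \<Phi>'" "\<forall>y\<in>X \<inter> W. \<Phi>' y = \<Phi> y"
    by (rule smooth_map_on_local[OF G(2) d(8)])
  have jac: "jacobian F1 F2 (0, 0) \<noteq> 0"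
  proof -
    \<comment> \<open>A smooth left inverse of \<open>(F1, F2)\<close> is \<open>chart_inv\<close>
      followed by a local extension \<open>\<Phi>'\<close> of the target diffeomorphism to an open
      set of the ambient space.\<close>
    define V1 where "V1 = chart_inv -` X"
    have oV1: "open V1" unfolding V1_def
      by (intro open_vimage smoothD(1)[OF X(2)] smooth_continuous[OF smooth_chart_inv])
    define W1 where "W1 = W' \<inter> G -` X"
    have oW1: "open W1" unfolding W1_def
      by (intro continuous_open_preimage smooth_continuous smG oW' smoothD(1)[OF X(2)])
    have G0: "G (0, 0) = c t0" using Gc(1)[of t0] t0 d(2) unfolding d(12) z by simp
    have inv: "chart_inv (F1 w, F2 w) = G w" if "w \<in> W'" for w
      using GW(1)[OF that] WH chart_inv_chart Fchart by auto
    show ?thesis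
    proof (rule jacobian_nonzero_if_left_inverse)
      show "smooth W1 F1" "smooth W1 F2"
        using smooth_subset[OF smF(1) _ oW1] smooth_subset[OF smF(2) _ oW1] by (auto simp: W1_def)
      show "(0, 0) \<in> W1" using \<open>(0, 0) \<in> W'\<close> G0 X(1) by (simp add: W1_def)
      show "smooth V1 (\<lambda>w. \<Phi>' (chart_inv w))"
        by (rule smooth_compose[OF X(2) smooth_subset[OF smooth_chart_inv _ oV1]])
          (auto simp: V1_def)
      show "(F1 (0, 0), F2 (0, 0)) \<in> V1" using inv[OF \<open>(0, 0) \<in> W'\<close>] G0 X(1) by (simp add: V1_def)
      show "\<Phi>' (chart_inv (F1 w, F2 w)) = w" if "w \<in> W1" for w
        using that inv[of w] GW[of w] X(3) by (auto simp: W1_def)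
    qed
  qed
  let ?\<phi> = "\<lambda>t. \<phi> (t0 + t)"
  have oB0: "open ((\<lambda>t. t0 + t) -` (U \<inter> A))"
    using smoothD(1)[OF C(1)] d(1)
    by (intro open_vimage open_Int smooth_continuous[OF smooth_translation])
  have smB: "smooth ((\<lambda>t. t0 + t) -` (U \<inter> A)) ?\<phi>"
    by (rule smooth_compose[OF sm\<phi>(1) smooth_subset[OF smooth_translation _ oB0]]) auto
  define D where "D = (\<lambda>t. t0 + t) -` (U \<inter> A) \<inter> (\<lambda>t. (?\<phi> t ^ i, ?\<phi> t ^ (i + 1))) -` W'"
  have oD: "open D" unfolding D_def
    by (intro continuous_open_preimage continuous_intros smooth_continuous[OF smB] oB0 oW')
  have smD: "smooth D ?\<phi>" by (rule smooth_subset[OF smB _ oD]) (auto simp: D_def)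
  have "0 \<in> D" using C(2) d(2,6,10) by (simp add: D_def)
  have "(\<phi> has_vector_derivative vderiv \<phi> t0) (at t0)" by (rule smooth_has_vderiv[OF sm\<phi>(1) d(2)])
  then have "(?\<phi> has_vector_derivative vderiv \<phi> t0) (at 0)"
    using DERIV_shift[of \<phi> "vderiv \<phi> t0" 0 t0]
    by (simp add: real_vector_derivative_iff[symmetric] add.commute)
  then have v: "vderiv ?\<phi> 0 \<noteq> 0" using vderiv_eqI \<phi>' by metis
  let ?f1 = "\<lambda>t. F1 (?\<phi> t ^ i, ?\<phi> t ^ (i + 1))" and ?f2 = "\<lambda>t. F2 (?\<phi> t ^ i, ?\<phi> t ^ (i + 1))"
  have jet: "cusp_jet i ?f1 ?f2"
    by (rule cusp_normal_form_jet[OF i smF \<open>(0, 0) \<in> W'\<close> jac smD \<open>0 \<in> D\<close> _ v])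
      (use d(6) in \<open>auto simp: D_def\<close>)
  define J' where "J' = (\<lambda>s. - t0 + s) ` J"
  have J': "is_interval J'" "interior J' \<noteq> {}" "0 \<in> J'"
  proof -
    show "is_interval J'" unfolding J'_def using J(1) by (simp only: is_interval_translation)
    show "interior J' \<noteq> {}" unfolding J'_def interior_translation using J(2) by simp
    show "0 \<in> J'" unfolding J'_def using t0 by (intro image_eqI[of _ _ t0]) auto
  qed
  have "smooth D (\<lambda>t. (?\<phi> t ^ i, ?\<phi> t ^ (i + 1)))"
    by (intro smooth_Pair smooth_power smD)
  then have smf: "smooth D ?f1" "smooth D ?f2"
    using smooth_compose[OF smF(1)] smooth_compose[OF smF(2)] by (auto simp: D_def)
  have smC: "smooth D (\<lambda>t. C (t0 + t))"
    by (rule smooth_compose[OF C(1) smooth_subset[OF smooth_translation _ oD]]) (auto simp: D_def)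
  have eq': "C (t0 + t) = G (?\<phi> t ^ i, ?\<phi> t ^ (i + 1))" if t: "t \<in> D \<inter> J'" for t
  proof -
    have 1: "t0 + t \<in> A \<inter> J" "t0 + t \<in> U" using t by (auto simp: D_def J'_def)
    then have "C (t0 + t) = G (\<Phi> (c (t0 + t)))" using Gc(1) eq by auto
    then show ?thesis using bspec[OF d(13) 1(1)] by simp
  qed
  have "tcoeff (\<lambda>t. C (t0 + t) $ 2) n = tcoeff ?f1 n" for n
    by (rule tcoeff_agree[OF smooth_nth[OF smC] smf(1) J'(1,2)])
      (use eq' \<open>0 \<in> D\<close> J'(3) in \<open>auto simp: F1_def\<close>)
  moreover have "tcoeff (\<lambda>t. C (t0 + t) $ 3) n = tcoeff ?f2 n" for n
    by (rule tcoeff_agree[OF smooth_nth[OF smC] smf(2) J'(1,2)])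
      (use eq' \<open>0 \<in> D\<close> J'(3) in \<open>auto simp: F2_def\<close>)
  ultimately show ?thesis using jet by (simp add: cusp_jet_def)
qed

section \<open>The Lorentzian frame\<close>

lemma bounded_bilinear_lorentz: "bounded_bilinear lorentz"
  unfolding bilinear_conv_bounded_bilinear[symmetric] bilinear_def linear_iff
  by (simp add: lorentz_def algebra_simps)

lemma bounded_bilinear_lorentz_cross: "bounded_bilinear lorentz_cross"
  unfolding bilinear_conv_bounded_bilinear[symmetric] bilinear_def linear_iff
  by (simp add: lorentz_cross_def vec_eq_iff forall_3 algebra_simps)

lemmas lorentz_linear =
  bounded_bilinear.add_left[OF bounded_bilinear_lorentz]
  bounded_bilinear.add_right[OF bounded_bilinear_lorentz]
  bounded_bilinear.scaleR_left[OF bounded_bilinear_lorentz]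
  bounded_bilinear.scaleR_right[OF bounded_bilinear_lorentz]

lemmas lorentz_cross_linear =
  bounded_bilinear.add_left[OF bounded_bilinear_lorentz_cross]
  bounded_bilinear.add_right[OF bounded_bilinear_lorentz_cross]
  bounded_bilinear.diff_left[OF bounded_bilinear_lorentz_cross]
  bounded_bilinear.scaleR_left[OF bounded_bilinear_lorentz_cross]
  bounded_bilinear.scaleR_right[OF bounded_bilinear_lorentz_cross]

lemma lorentz_commute: "lorentz x y = lorentz y x"
  by (simp add: lorentz_def)

lemma lorentz_cross_self [simp]: "lorentz_cross x x = 0"
  by (simp add: lorentz_cross_def vec_eq_iff forall_3)

lemma lorentz_cross_antisym: "lorentz_cross y x = - lorentz_cross x y"
  by (simp add: lorentz_cross_def vec_eq_iff forall_3)

lemma lorentz_cross_frame: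
  assumes "(g, v) \<in> Delta1"
  defines "u \<equiv> lorentz_cross g v"
  shows "lorentz u u = 1" "lorentz g u = 0" "lorentz v u = 0"
    "lorentz_cross u v = g" "lorentz_cross g u = - v"
proof -
  have 1: "- (g$1 * g$1) + g$2 * g$2 + g$3 * g$3 = -1" "- (v$1 * v$1) + v$2 * v$2 + v$3 * v$3 = 1"
    "- (g$1 * v$1) + g$2 * v$2 + g$3 * v$3 = 0"
    using assms(1) by (auto simp: Delta1_def hyperbolic_plane_def de_Sitter_plane_def lorentz_def)
  have u: "u$1 = - (g$2 * v$3 - g$3 * v$2)" "u$2 = g$3 * v$1 - g$1 * v$3" "u$3 = g$1 * v$2 - g$2 * v$1"
    by (simp_all add: u_def lorentz_cross_def)
  show "lorentz u u = 1" unfolding lorentz_def u using 1 by algebra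
  show "lorentz g u = 0" unfolding lorentz_def u by algebra
  show "lorentz v u = 0" unfolding lorentz_def u by algebra
  have "- (u$2 * v$3 - u$3 * v$2) = g$1" "u$3 * v$1 - u$1 * v$3 = g$2" "u$1 * v$2 - u$2 * v$1 = g$3"
    unfolding u using 1 by algebra+
  then show "lorentz_cross u v = g" by (simp add: lorentz_cross_def vec_eq_iff forall_3)
  have "- (g$2 * u$3 - g$3 * u$2) = - (v$1)" "g$3 * u$1 - g$1 * u$3 = - (v$2)" "g$1 * u$2 - g$2 * u$1 = - (v$3)"
    unfolding u using 1 by algebra+
  then show "lorentz_cross g u = - v" by (simp add: lorentz_cross_def vec_eq_iff forall_3)
qed

text \<open>The vectors of the frame of the horocyclic parallel with parameter \<open>l\<close>, in terms of the frame
  \<open>(g, v, u)\<close> of the original curve.\<close>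

definition par_point :: "real \<Rightarrow> real \<Rightarrow> real ^ 3 \<Rightarrow> real ^ 3 \<Rightarrow> real ^ 3 \<Rightarrow> real ^ 3" where
  "par_point \<sigma> l g v u = g + l *\<^sub>R v + (l\<^sup>2 / 2) *\<^sub>R (g + \<sigma> *\<^sub>R u)"

definition par_nu :: "real \<Rightarrow> real \<Rightarrow> real ^ 3 \<Rightarrow> real ^ 3 \<Rightarrow> real ^ 3 \<Rightarrow> real ^ 3" where
  "par_nu \<sigma> l g v u = v + l *\<^sub>R (g + \<sigma> *\<^sub>R u)"

definition par_mu :: "real \<Rightarrow> real \<Rightarrow> real ^ 3 \<Rightarrow> real ^ 3 \<Rightarrow> real ^ 3 \<Rightarrow> real ^ 3" where
  "par_mu \<sigma> l g v u = u - (\<sigma> * l) *\<^sub>R v - (\<sigma> * l\<^sup>2 / 2) *\<^sub>R (g + \<sigma> *\<^sub>R u)"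

context
  fixes \<sigma> :: real and g v :: "real ^ 3"
  assumes \<sigma>: "\<sigma> \<in> {1, -1}" and gv: "(g, v) \<in> Delta1"
begin

lemma par_point_hyperbolic: "par_point \<sigma> l g v (lorentz_cross g v) \<in> hyperbolic_plane"
proof -
  let ?u = "lorentz_cross g v"
  let ?P = "par_point \<sigma> l g v ?u"
  have fr: "lorentz g g = -1" "lorentz v v = 1" "lorentz g v = 0" "lorentz v g = 0" and g1: "g $ 1 > 0"
    using gv by (auto simp: Delta1_def hyperbolic_plane_def de_Sitter_plane_def lorentz_commute)
  note fr = fr lorentz_cross_frame(1-3)[OF gv]
  have fr': "lorentz ?u g = 0" "lorentz ?u v = 0" using fr lorentz_commute by metis+
  have s2: "\<sigma> * \<sigma> = 1" using \<sigma> by auto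
  have "lorentz ?P ?P = - 1"
    unfolding par_point_def using s2
    by (simp add: lorentz_linear fr fr') (simp add: power2_eq_square; algebra)
  moreover have "lorentz g ?P = - 1 - l\<^sup>2 / 2"
    unfolding par_point_def by (simp add: lorentz_linear fr fr')
  \<comment> \<open>The quadratic equation leaves two sheets. The lower one is excluded by the
    negative product of \<open>g\<close> and \<open>?P\<close>: on opposite sheets the product is
    positive, by the Cauchy-Schwarz inequality in the last two coordinates.\<close>
  moreover have "?P $ 1 > 0"
  proof (rule ccontr)
    assume "\<not> ?P $ 1 > 0"
    then have neg: "?P $ 1 \<le> 0" by simp
    let ?x = "?P $ 1" and ?y = "?P $ 2" and ?z = "?P $ 3" and ?a = "g $ 1" and ?b = "g $ 2" and ?c = "g $ 3"
    have e1: "?x\<^sup>2 = 1 + ?y\<^sup>2 + ?z\<^sup>2" "?a\<^sup>2 = 1 + ?b\<^sup>2 + ?c\<^sup>2"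
      using \<open>lorentz ?P ?P = - 1\<close> fr(1) by (auto simp: lorentz_def power2_eq_square)
    have "- (?a * ?x) + ?b * ?y + ?c * ?z < 0"
      using \<open>lorentz g ?P = _\<close> zero_le_power2[of l] unfolding lorentz_def by linarith
    then have lt: "?b * ?y + ?c * ?z < ?a * ?x" by simp
    moreover have "?a * ?x \<le> 0" using g1 neg by (simp add: mult_le_0_iff)
    ultimately have "(?a * ?x)\<^sup>2 \<le> (?b * ?y + ?c * ?z)\<^sup>2"
      by (simp add: abs_le_square_iff[symmetric])
    moreover have "(?a * ?x)\<^sup>2 = (1 + ?b\<^sup>2 + ?c\<^sup>2) * (1 + ?y\<^sup>2 + ?z\<^sup>2)"
      by (simp only: power_mult_distrib e1)
    moreover have "(1 + ?b\<^sup>2 + ?c\<^sup>2) * (1 + ?y\<^sup>2 + ?z\<^sup>2) - (?b * ?y + ?c * ?z)\<^sup>2 =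
        1 + ?b\<^sup>2 + ?c\<^sup>2 + ?y\<^sup>2 + ?z\<^sup>2 + (?b * ?z - ?c * ?y)\<^sup>2"
      by (simp add: power2_eq_square algebra_simps)
    moreover have "1 + ?b\<^sup>2 + ?c\<^sup>2 + ?y\<^sup>2 + ?z\<^sup>2 + (?b * ?z - ?c * ?y)\<^sup>2 > 0"
      by (intro add_pos_nonneg) auto
    ultimately show False by linarith
  qed
  ultimately show ?thesis by (simp add: hyperbolic_plane_def)
qed

lemma par_frame_cross:
  "lorentz_cross (par_mu \<sigma> l g v (lorentz_cross g v)) (par_nu \<sigma> l g v (lorentz_cross g v)) =
     par_point \<sigma> l g v (lorentz_cross g v)"
proof -
  define u where "u = lorentz_cross g v"
  have fr: "lorentz_cross u v = g" "lorentz_cross g u = - v" "lorentz_cross g v = u"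
    using lorentz_cross_frame(4,5)[OF gv] by (simp_all add: u_def)
  have fr': "lorentz_cross v u = - g" "lorentz_cross u g = v" "lorentz_cross v g = - u"
    using fr lorentz_cross_antisym by (metis minus_minus)+
  show ?thesis
    unfolding u_def[symmetric] par_mu_def par_nu_def par_point_def
    by (simp add: lorentz_cross_linear fr fr' vec_eq_iff) (rule allI, cases "\<sigma> = 1", use \<sigma> in \<open>auto simp: field_simps power2_eq_square\<close>)
qed

end

text \<open>Leibniz formulas of the orders needed for cusps. The equation for
  \<open>vderiv x\<close> holds only on \<open>U \<inter> I\<close>, while the product is
  differentiated on all of \<open>U\<close>; \<open>funpow_vderiv_agree\<close> joins the two at
  \<open>t\<close>.\<close>

lemma product_derivatives:
  fixes x g w :: "real \<Rightarrow> real"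
  assumes sm: "smooth U x" "smooth U g" "smooth U w"
    and I: "is_interval I" "interior I \<noteq> {}" and t: "t \<in> U \<inter> I"
    and eq: "\<And>s. s \<in> U \<inter> I \<Longrightarrow> vderiv x s = g s * w s"
  shows "(vderiv ^^ 1) x t = g t * w t"
    and "(vderiv ^^ 2) x t = vderiv g t * w t + g t * vderiv w t"
    and "(vderiv ^^ 3) x t = (vderiv ^^ 2) g t * w t + 2 * vderiv g t * vderiv w t + g t * (vderiv ^^ 2) w t"
    and "(vderiv ^^ 4) x t = (vderiv ^^ 3) g t * w t + 3 * (vderiv ^^ 2) g t * vderiv w t
      + 3 * vderiv g t * (vderiv ^^ 2) w t + g t * (vderiv ^^ 3) w t"
proof -
  have "(vderiv ^^ k) (vderiv x) t = (vderiv ^^ k) (\<lambda>s. g s * w s) t" for k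
    by (rule funpow_vderiv_agree[OF smooth_vderiv[OF sm(1)] smooth_mult[OF sm(2,3)] I eq t])
  then have x: "(vderiv ^^ Suc k) x t = (vderiv ^^ k) (\<lambda>s. g s * w s) t" for k
    by (simp add: funpow_swap1)
  have cong: "vderiv p s = vderiv q s" if "smooth U p" "smooth U q" "s \<in> U" "\<And>s. s \<in> U \<Longrightarrow> p s = q s"
    for p q :: "real \<Rightarrow> real" and s
    using funpow_vderiv_agree[of U p q UNIV s 1] that by simp
  let ?g1 = "vderiv g" and ?w1 = "vderiv w"
  let ?g2 = "vderiv ?g1" and ?w2 = "vderiv ?w1"
  let ?g3 = "vderiv ?g2" and ?w3 = "vderiv ?w2"
  have s: "smooth U ?g1" "smooth U ?w1" "smooth U ?g2" "smooth U ?w2"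
    using sm smooth_vderiv by blast+
  note m = smooth_mult
  have 1: "vderiv (\<lambda>s. g s * w s) s = ?g1 s * w s + g s * ?w1 s" if "s \<in> U" for s
    using vderiv_mult[OF sm(2,3) that] .
  have sm1: "smooth U (vderiv (\<lambda>s. g s * w s))" using smooth_vderiv[OF m[OF sm(2,3)]] .
  have 2: "vderiv (vderiv (\<lambda>s. g s * w s)) s = ?g2 s * w s + 2 * (?g1 s * ?w1 s) + g s * ?w2 s" if "s \<in> U" for s
  proof -
    have "vderiv (vderiv (\<lambda>s. g s * w s)) s = vderiv (\<lambda>s. ?g1 s * w s + g s * ?w1 s) s"
      using 1 by (intro cong[OF sm1 _ that] smooth_add m s sm)
    also have "\<dots> = vderiv (\<lambda>s. ?g1 s * w s) s + vderiv (\<lambda>s. g s * ?w1 s) s"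
      using vderiv_add[OF m[OF s(1) sm(3)] m[OF sm(2) s(2)] that] .
    finally show ?thesis using vderiv_mult[OF s(1) sm(3) that] vderiv_mult[OF sm(2) s(2) that] by simp
  qed
  have sm2: "smooth U (vderiv (vderiv (\<lambda>s. g s * w s)))" using smooth_vderiv[OF sm1] .
  have o: "open U" using smoothD(1)[OF sm(1)] .
  have 3: "vderiv (vderiv (vderiv (\<lambda>s. g s * w s))) s =
      ?g3 s * w s + 3 * ?g2 s * ?w1 s + 3 * ?g1 s * ?w2 s + g s * ?w3 s" if "s \<in> U" for s
  proof -
    have a: "smooth U (\<lambda>s. 2 * (?g1 s * ?w1 s))" by (intro m smooth_const o s)
    have "vderiv (vderiv (vderiv (\<lambda>s. g s * w s))) s =
        vderiv (\<lambda>s. ?g2 s * w s + 2 * (?g1 s * ?w1 s) + g s * ?w2 s) s"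
      using 2 by (intro cong[OF sm2 _ that] smooth_add m s sm smooth_const o)
    also have "\<dots> = vderiv (\<lambda>s. ?g2 s * w s + 2 * (?g1 s * ?w1 s)) s + vderiv (\<lambda>s. g s * ?w2 s) s"
      by (rule vderiv_add[OF smooth_add[OF m[OF s(3) sm(3)] a] m[OF sm(2) s(4)] that])
    also have "\<dots> = vderiv (\<lambda>s. ?g2 s * w s) s + vderiv (\<lambda>s. 2 * (?g1 s * ?w1 s)) s + vderiv (\<lambda>s. g s * ?w2 s) s"
      by (simp only: vderiv_add[OF m[OF s(3) sm(3)] a that])
    also have "vderiv (\<lambda>s. 2 * (?g1 s * ?w1 s)) s = vderiv (\<lambda>s. 2) s * (?g1 s * ?w1 s) + 2 * vderiv (\<lambda>s. ?g1 s * ?w1 s) s"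
      by (rule vderiv_mult[OF smooth_const[OF o] m[OF s(1,2)] that])
    also have "vderiv (\<lambda>s. 2::real) s = 0" by (rule vderiv_eqI) (rule has_vector_derivative_const)
    finally show ?thesis
      using vderiv_mult[OF s(3) sm(3) that] vderiv_mult[OF sm(2) s(4) that] vderiv_mult[OF s(1,2) that] by (simp add: algebra_simps)
  qed
  have "t \<in> U" using t by simp
  show "(vderiv ^^ 1) x t = g t * w t" using x[of 0] by simp
  show "(vderiv ^^ 2) x t = vderiv g t * w t + g t * vderiv w t"
    using x[of 1] 1[OF \<open>t \<in> U\<close>] by (simp add: numeral_2_eq_2)
  show "(vderiv ^^ 3) x t = (vderiv ^^ 2) g t * w t + 2 * vderiv g t * vderiv w t + g t * (vderiv ^^ 2) w t"
    using x[of 2] 2[OF \<open>t \<in> U\<close>] by (simp add: eval_nat_numeral)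
  show "(vderiv ^^ 4) x t = (vderiv ^^ 3) g t * w t + 3 * (vderiv ^^ 2) g t * vderiv w t
      + 3 * vderiv g t * (vderiv ^^ 2) w t + g t * (vderiv ^^ 3) w t"
    using x[of 3] 3[OF \<open>t \<in> U\<close>] by (simp add: eval_nat_numeral)
qed

lemma tcoeff_shift: "tcoeff (\<lambda>t. x (t0 + t)) n = (vderiv ^^ n) x t0 / fact n"
proof -
  have v: "vderiv (\<lambda>t. h (t0 + t)) = (\<lambda>t. vderiv h (t0 + t))" for h :: "real \<Rightarrow> real"
    using DERIV_shift[of h _ _ t0]
    by (simp add: vderiv_def vector_derivative_def fun_eq_iff add.commute
        real_vector_derivative_iff[symmetric])
  have "(vderiv ^^ n) (\<lambda>t. x (t0 + t)) = (\<lambda>t. (vderiv ^^ n) x (t0 + t))" for n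
    by (induction n) (simp_all add: v)
  then show ?thesis by (simp add: tcoeff_def)
qed

text \<open>With \<open>C' = g w\<close> and \<open>g = 0\<close> at \<open>t\<close>, the second
  and third derivatives are \<open>g' w\<close> and \<open>g'' w + 2 g' w'\<close>, with determinant
  \<open>2 g'^2 d\<close>. If \<open>g'\<close> vanishes too, the third and fourth are
  \<open>g'' w\<close> and \<open>g''' w + 3 g'' w'\<close>, with determinant
  \<open>3 g''^2 d\<close>. Since \<open>w\<close> is nonzero in the chart, vanishing of the lower
  derivatives means vanishing of \<open>g\<close> and \<open>g'\<close>.\<close>

lemma cusp_jet_iff_velocity:
  fixes C w :: "real \<Rightarrow> real ^ 3" and g :: "real \<Rightarrow> real"
  assumes C: "smooth U C" and g: "smooth U g" and w: "smooth U w"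
    and I: "is_interval I" "interior I \<noteq> {}" and t: "t \<in> U \<inter> I"
    and eq: "\<And>s. s \<in> U \<inter> I \<Longrightarrow> (C has_vector_derivative g s *\<^sub>R w s) (at s within I)"
    and w0: "w t $ 2 \<noteq> 0 \<or> w t $ 3 \<noteq> 0"
  defines "p \<equiv> \<lambda>s. C (t + s) $ 2" and "q \<equiv> \<lambda>s. C (t + s) $ 3"
    and "d \<equiv> w t $ 2 * vderiv w t $ 3 - w t $ 3 * vderiv w t $ 2"
  shows "cusp_jet 2 p q \<longleftrightarrow> g t = 0 \<and> vderiv g t \<noteq> 0 \<and> d \<noteq> 0"
    and "cusp_jet 3 p q \<longleftrightarrow> g t = 0 \<and> vderiv g t = 0 \<and> vderiv (vderiv g) t \<noteq> 0 \<and> d \<noteq> 0"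
proof -
  have comp: "vderiv (\<lambda>s. h s $ j) s = vderiv h s $ j" if "smooth U h" "s \<in> U" for h :: "real \<Rightarrow> real ^ 3" and j s
    using bounded_linear.has_vector_derivative[OF bounded_linear_vec_nth smooth_has_vderiv[OF that]]
    by (rule vderiv_eqI)
  have vC: "vderiv C s = g s *\<^sub>R w s" if "s \<in> U \<inter> I" for s
    by (rule vderiv_within_eq[OF C I that _ eq[OF that]]) simp
  have vCj: "vderiv (\<lambda>s. C s $ j) s = g s * w s $ j" if "s \<in> U \<inter> I" for s j
    using comp[OF C, of s j] vC[OF that] that by simp
  have D2: "(vderiv ^^ 2) (\<lambda>s. C s $ j) t = vderiv g t * w t $ j + g t * vderiv (\<lambda>s. w s $ j) t" for j
    by (rule product_derivatives(2)[OF smooth_nth[OF C] g smooth_nth[OF w] I t vCj])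
  have D3: "(vderiv ^^ 3) (\<lambda>s. C s $ j) t = (vderiv ^^ 2) g t * w t $ j
      + 2 * vderiv g t * vderiv (\<lambda>s. w s $ j) t + g t * (vderiv ^^ 2) (\<lambda>s. w s $ j) t" for j
    by (rule product_derivatives(3)[OF smooth_nth[OF C] g smooth_nth[OF w] I t vCj])
  have D4: "(vderiv ^^ 4) (\<lambda>s. C s $ j) t = (vderiv ^^ 3) g t * w t $ j
      + 3 * (vderiv ^^ 2) g t * vderiv (\<lambda>s. w s $ j) t
      + 3 * vderiv g t * (vderiv ^^ 2) (\<lambda>s. w s $ j) t + g t * (vderiv ^^ 3) (\<lambda>s. w s $ j) t" for j
    by (rule product_derivatives(4)[OF smooth_nth[OF C] g smooth_nth[OF w] I t vCj])
  have w': "vderiv (\<lambda>s. w s $ j) t = vderiv w t $ j" for j using comp[OF w, of t j] t by simp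
  have 1: "tcoeff p 1 = g t * w t $ 2" "tcoeff q 1 = g t * w t $ 3"
    unfolding p_def q_def tcoeff_shift[of "\<lambda>s. C s $ 2"] tcoeff_shift[of "\<lambda>s. C s $ 3"] by (simp_all add: vCj[OF t])
  have g0: "c = 0" if "c * w t $ 2 = 0" "c * w t $ 3 = 0" for c
    using that w0 by auto
  have 2: "tcoeff p 2 = vderiv g t * w t $ 2 / 2" "tcoeff q 2 = vderiv g t * w t $ 3 / 2" if "g t = 0"
    unfolding p_def q_def tcoeff_shift[of "\<lambda>s. C s $ 2"] tcoeff_shift[of "\<lambda>s. C s $ 3"] D2
    using that by simp_all
  have 3: "tcoeff p 3 = (vderiv (vderiv g) t * w t $ 2 + 2 * vderiv g t * vderiv w t $ 2) / 6"
    "tcoeff q 3 = (vderiv (vderiv g) t * w t $ 3 + 2 * vderiv g t * vderiv w t $ 3) / 6" if "g t = 0"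
    unfolding p_def q_def tcoeff_shift[of "\<lambda>s. C s $ 2"] tcoeff_shift[of "\<lambda>s. C s $ 3"] D3
    using that by (simp_all add: w' eval_nat_numeral)
  have 4: "tcoeff p 4 = ((vderiv ^^ 3) g t * w t $ 2 + 3 * vderiv (vderiv g) t * vderiv w t $ 2) / 24"
    "tcoeff q 4 = ((vderiv ^^ 3) g t * w t $ 3 + 3 * vderiv (vderiv g) t * vderiv w t $ 3) / 24"
    if "g t = 0" "vderiv g t = 0"
    unfolding p_def q_def tcoeff_shift[of "\<lambda>s. C s $ 2"] tcoeff_shift[of "\<lambda>s. C s $ 3"] D4
    using that by (simp_all add: w' numeral_2_eq_2 fact_numeral)
  \<comment> \<open>The factors 6 here and 48 below are \<open>2! * 3! / 2\<close> and
    \<open>3! * 4! / 3\<close>.\<close>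
  have det2: "tcoeff p 2 * tcoeff q 3 - tcoeff p 3 * tcoeff q 2 = (vderiv g t)\<^sup>2 * d / 6"
    if "g t = 0"
    unfolding 2[OF that] 3[OF that] d_def by (simp add: field_simps power2_eq_square)
  have det3: "tcoeff p 3 * tcoeff q 4 - tcoeff p 4 * tcoeff q 3 = (vderiv (vderiv g) t)\<^sup>2 * d / 48"
    if "g t = 0" "vderiv g t = 0"
    unfolding 4[OF that] 3[OF that(1)] d_def using that(2) by (simp add: field_simps power2_eq_square)
  have lt: "0 < n \<and> n < 2 \<longleftrightarrow> n = 1" "0 < n \<and> n < 3 \<longleftrightarrow> n = 1 \<or> n = 2" for n :: nat by auto
  have e2: "tcoeff p 2 = 0 \<and> tcoeff q 2 = 0 \<longleftrightarrow> vderiv g t = 0" if "g t = 0"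
    unfolding 2[OF that] using w0 by auto
  have d3: "tcoeff p 3 * tcoeff q 4 - tcoeff p 4 * tcoeff q 3 \<noteq> 0 \<longleftrightarrow>
      vderiv (vderiv g) t \<noteq> 0 \<and> d \<noteq> 0" if "g t = 0" "vderiv g t = 0"
    unfolding det3[OF that] by simp
  have "cusp_jet 2 p q \<longleftrightarrow> g t = 0 \<and>
      tcoeff p 2 * tcoeff q 3 - tcoeff p 3 * tcoeff q 2 \<noteq> 0"
    using 1 g0[of "g t"] unfolding cusp_jet_def lt by auto
  then show "cusp_jet 2 p q \<longleftrightarrow> g t = 0 \<and> vderiv g t \<noteq> 0 \<and> d \<noteq> 0"
    using det2 by auto
  have "cusp_jet 3 p q \<longleftrightarrow> g t = 0 \<and> (tcoeff p 2 = 0 \<and> tcoeff q 2 = 0) \<and>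
      tcoeff p 3 * tcoeff q 4 - tcoeff p 4 * tcoeff q 3 \<noteq> 0"
    using 1 g0[of "g t"] unfolding cusp_jet_def lt by auto
  also have "\<dots> \<longleftrightarrow> g t = 0 \<and> vderiv g t = 0 \<and>
      tcoeff p 3 * tcoeff q 4 - tcoeff p 4 * tcoeff q 3 \<noteq> 0"
    using e2 by blast
  finally show "cusp_jet 3 p q \<longleftrightarrow> g t = 0 \<and> vderiv g t = 0 \<and> vderiv (vderiv g) t \<noteq> 0 \<and> d \<noteq> 0"
    using d3 by blast
qed

section \<open>Horocyclic parallels and evolutes\<close>

lemma is_cusp_iff_cusp_jet:
  assumes "i = 2 \<or> i = 3" "smooth U C" "t0 \<in> U" "t0 \<in> J" "is_interval J" "interior J \<noteq> {}"
    and "\<And>t. t \<in> U \<inter> J \<Longrightarrow> C t = c t" "\<And>t. t \<in> J \<Longrightarrow> c t \<in> hyperbolic_plane"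
  shows "is_cusp i (i + 1) J hyperbolic_plane c t0 \<longleftrightarrow>
    cusp_jet i (\<lambda>t. C (t0 + t) $ 2) (\<lambda>t. C (t0 + t) $ 3)"
proof
  assume "is_cusp i (i + 1) J hyperbolic_plane c t0"
  then show "cusp_jet i (\<lambda>t. C (t0 + t) $ 2) (\<lambda>t. C (t0 + t) $ 3)"
    using assms(1) by (intro cusp_jet_if_is_cusp[OF _ assms(2,3,5,6,7)]) auto
next
  assume "cusp_jet i (\<lambda>t. C (t0 + t) $ 2) (\<lambda>t. C (t0 + t) $ 3)"
  then show "is_cusp i (i + 1) J hyperbolic_plane c t0"
    using is_cusp_if_cusp_jet[OF assms(1-4,7,8)] by blast
qed

lemma is_cusp_iff_velocity:
  fixes C w :: "real \<Rightarrow> real ^ 3" and g :: "real \<Rightarrow> real"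
  assumes C: "smooth U C" and g: "smooth U g" and w: "smooth U w"
    and J: "is_interval J" "interior J \<noteq> {}" and t: "t \<in> U \<inter> J"
    and eq: "\<And>s. s \<in> U \<inter> J \<Longrightarrow> C s = c s" and H: "\<And>s. s \<in> J \<Longrightarrow> c s \<in> hyperbolic_plane"
    and der: "\<And>s. s \<in> U \<inter> J \<Longrightarrow> (c has_vector_derivative g s *\<^sub>R w s) (at s within J)"
    and w0: "w t $ 2 \<noteq> 0 \<or> w t $ 3 \<noteq> 0"
  defines "d \<equiv> w t $ 2 * vderiv w t $ 3 - w t $ 3 * vderiv w t $ 2"
  shows "is_cusp 2 3 J hyperbolic_plane c t \<longleftrightarrow> g t = 0 \<and> vderiv g t \<noteq> 0 \<and> d \<noteq> 0"
    and "is_cusp 3 4 J hyperbolic_plane c t \<longleftrightarrow> g t = 0 \<and> vderiv g t = 0 \<and> vderiv (vderiv g) t \<noteq> 0 \<and> d \<noteq> 0"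
proof -
  have derC: "(C has_vector_derivative g s *\<^sub>R w s) (at s within J)" if s: "s \<in> U \<inter> J" for s
  proof -
    have "vderiv C s = g s *\<^sub>R w s"
      by (rule vderiv_within_eq[OF C J s eq der[OF s]])
    then show ?thesis
      using smooth_has_vderiv[OF C, of s] s has_vector_derivative_at_within[of C _ s J] by simp
  qed
  note v = cusp_jet_iff_velocity[OF C g w J t derC w0, folded d_def]
  have t': "t \<in> U" "t \<in> J" using t by auto
  show "is_cusp 2 3 J hyperbolic_plane c t \<longleftrightarrow> g t = 0 \<and> vderiv g t \<noteq> 0 \<and> d \<noteq> 0"
    using is_cusp_iff_cusp_jet[of 2, OF _ C t' J eq H] v(1) by simp
  show "is_cusp 3 4 J hyperbolic_plane c t \<longleftrightarrow> g t = 0 \<and> vderiv g t = 0 \<and> vderiv (vderiv g) t \<noteq> 0 \<and> d \<noteq> 0"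
    using is_cusp_iff_cusp_jet[of 3, OF _ C t' J eq H] v(2) by simp
qed

section \<open>Local solutions of the equation of the parallels\<close>

lemma smooth_exp_real: "smooth UNIV (exp :: real \<Rightarrow> real)"
proof -
  have "(exp has_vector_derivative exp x) (at x)" for x :: real
    using DERIV_exp[of x] by (simp only: real_vector_derivative_iff)
  then show ?thesis
    using smooth_derivative_sequence[OF open_UNIV, of "\<lambda>_. exp" 0] by blast
qed

lemma smooth_antiderivative:
  fixes h :: "real \<Rightarrow> real"
  assumes h: "smooth U h" and d: "{a..b} \<subseteq> U" and t: "t \<in> {a<..<b}"
  obtains H where "smooth {a<..<b} H" "H t = 0"
    "\<And>x. x \<in> {a<..<b} \<Longrightarrow> (H has_real_derivative h x) (at x)"
proof -
  obtain g where g: "\<And>x. x \<in> {a..b} \<Longrightarrow> (g has_vector_derivative h x) (at x within {a..b})"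
    using antiderivative_continuous[OF continuous_on_subset[OF smooth_continuous[OF h] d]] by metis
  let ?H = "\<lambda>x. g x - g t"
  have der: "(?H has_real_derivative h x) (at x)" if x: "x \<in> {a<..<b}" for x
  proof -
    have "at x within {a..b} = at x" using x by (intro at_within_interior) simp
    then have "(g has_real_derivative h x) (at x)"
      using g[of x] x by (simp add: real_vector_derivative_iff)
    then show ?thesis by (auto intro!: derivative_eq_intros)
  qed
  have "smooth {a<..<b} h" by (rule smooth_subset[OF h]) (use d in force)+
  then have "smooth {a<..<b} ?H"
    by (rule smooth_vderivI[rotated])
      (use der in \<open>simp add: real_vector_derivative_iff\<close>)
  then show ?thesis using der by (intro that[of ?H]) auto
qed

text \<open>The substitution \<open>x \<mapsto> 1 / x\<close> makes the Bernoulli equation of the parallels linear.\<close>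

lemma bernoulli_local_solution:
  fixes m n :: "real \<Rightarrow> real" and \<sigma> l :: real
  assumes m: "smooth U m" and n: "smooth U n" and t: "t \<in> U"
  obtains d lam where "d > 0" "smooth {t - d<..<t + d} lam" "lam t = l" "{t - d<..<t + d} \<subseteq> U"
    "\<And>x. x \<in> {t - d<..<t + d} \<Longrightarrow>
      (lam has_real_derivative - \<sigma> * ((lam x)\<^sup>2 * n x / 2 + lam x * m x)) (at x)"
proof -
  obtain r where r: "r > 0" "{t - r..t + r} \<subseteq> U"
    using ball_subset_open[OF smoothD(1)[OF m] t] .
  let ?V = "{t - r<..<t + r}"
  have tV: "t \<in> ?V" using r by simp
  have VU: "?V \<subseteq> U" using r(2) by force
  obtain a where a: "smooth ?V a" "a t = 0" "\<And>x. x \<in> ?V \<Longrightarrow> (a has_real_derivative m x) (at x)"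
    using smooth_antiderivative[OF m r(2) tV] by metis
  let ?E = "\<lambda>x. exp (- \<sigma> * a x)"
  have smE: "smooth ?V (\<lambda>x. exp (c * a x))" for c
    by (rule smooth_compose[OF smooth_exp_real])
      (auto intro!: smooth_mult smooth_const a)
  obtain r2 where r2: "r2 > 0" "{t - r2..t + r2} \<subseteq> ?V"
    using ball_subset_open[of ?V t] tV by auto
  let ?V2 = "{t - r2<..<t + r2}"
  have tV2: "t \<in> ?V2" using r2 by simp
  have V2V: "?V2 \<subseteq> ?V" using r2(2) by force
  have smnE: "smooth ?V (\<lambda>x. n x * ?E x)"
    by (rule smooth_mult[OF smooth_subset[OF n VU open_greaterThanLessThan] smE])
  obtain b where b: "smooth ?V2 b" "b t = 0" "\<And>x. x \<in> ?V2 \<Longrightarrow> (b has_real_derivative n x * ?E x) (at x)"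
    using smooth_antiderivative[OF smnE r2(2) tV2] by metis
  \<comment> \<open>Variation of constants for
    \<open>D' = \<sigma> * m * D + l * \<sigma> / 2 * n\<close> with \<open>D t = 1\<close>. The
    solution sought is \<open>l / D\<close>; keeping \<open>l\<close> in the numerator also covers
    the zero solution for \<open>l = 0\<close>.\<close>
  define D where "D x = exp (\<sigma> * a x) * (1 + l * \<sigma> / 2 * b x)" for x
  have smD: "smooth ?V2 D"
    unfolding D_def using smooth_subset[OF smE V2V]
    by (intro smooth_mult smooth_add smooth_const b) auto
  have derD: "(D has_real_derivative \<sigma> * m x * D x + l * \<sigma> / 2 * n x) (at x)" if x: "x \<in> ?V2" for x
  proof -
    have "x \<in> ?V" using V2V x by blast
    have 1: "(D has_real_derivative exp (\<sigma> * a x) * (l * \<sigma> / 2 * (n x * ?E x)) +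
        exp (\<sigma> * a x) * (\<sigma> * m x) * (1 + l * \<sigma> / 2 * b x)) (at x)"
      unfolding D_def by (rule derivative_eq_intros a(3)[OF \<open>x \<in> ?V\<close>] b(3)[OF x] refl | simp)+
    have "exp (\<sigma> * a x) * ?E x = 1" by (simp add: exp_minus field_simps)
    then have 2: "exp (\<sigma> * a x) * (l * \<sigma> / 2 * (n x * ?E x)) = l * \<sigma> / 2 * n x"
      by (metis (no_types, opaque_lifting) mult.left_commute mult.right_neutral)
    show ?thesis using 1 unfolding 2 by (simp add: D_def algebra_simps)
  qed
  have Dt: "D t = 1" using a(2) b(2) by (simp add: D_def)
  \<comment> \<open>The quotient \<open>l / D\<close> is formed only where \<open>D\<close> is
    positive, which holds near \<open>t\<close>.\<close>
  have "open (?V2 \<inter> D -` {0<..})"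
    by (intro continuous_open_preimage smooth_continuous[OF smD]) auto
  moreover have "t \<in> ?V2 \<inter> D -` {0<..}" using tV2 Dt by simp
  ultimately obtain d where d: "d > 0" "{t - d..t + d} \<subseteq> ?V2 \<inter> D -` {0<..}"
    using ball_subset_open by blast
  let ?W = "{t - d<..<t + d}"
  have W: "?W \<subseteq> ?V2" "\<And>x. x \<in> ?W \<Longrightarrow> D x > 0"
    using d(2) by (auto simp: subset_iff)
  show ?thesis
  proof (rule that[of d "\<lambda>x. l / D x"])
    show "smooth ?W (\<lambda>x. l / D x)"
      using smooth_subset[OF smD W(1)] W(2)
      by (intro smooth_divide smooth_const) force+
    show "?W \<subseteq> U" using W(1) V2V VU by blast
    show "((\<lambda>x. l / D x) has_real_derivative - \<sigma> * ((l / D x)\<^sup>2 * n x / 2 + l / D x * m x)) (at x)"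
      if x: "x \<in> ?W" for x
    proof -
      have "D x \<noteq> 0" using W(2)[OF x] by simp
      have "x \<in> ?V2" using W(1) x by blast
      have "((\<lambda>x. l / D x) has_real_derivative
          (0 * D x - l * (\<sigma> * m x * D x + l * \<sigma> / 2 * n x)) / (D x * D x)) (at x)"
        by (rule DERIV_divide[OF DERIV_const derD[OF \<open>x \<in> ?V2\<close>] \<open>D x \<noteq> 0\<close>])
      moreover have "(0 * D x - l * (\<sigma> * m x * D x + l * \<sigma> / 2 * n x)) / (D x * D x) =
          - \<sigma> * ((l / D x)\<^sup>2 * n x / 2 + l / D x * m x)"
        using \<open>D x \<noteq> 0\<close> by (simp add: field_simps power2_eq_square)
      ultimately show ?thesis by simp
    qed
  qed (use d(1) Dt in auto)
qed

lemma extension_has_vector_derivative: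
  fixes F :: "real \<Rightarrow> 'a::euclidean_space"
  assumes "smooth U F" "\<And>s. s \<in> U \<inter> I \<Longrightarrow> F s = f s" "t \<in> U \<inter> I"
  shows "(f has_vector_derivative vderiv F t) (at t within I)"
proof -
  obtain e where e: "e > 0" "ball t e \<subseteq> U"
    using smoothD(1)[OF assms(1)] assms(3) open_contains_ball by blast
  have "(F has_vector_derivative vderiv F t) (at t within I)"
    using smooth_has_vderiv[OF assms(1), of t] assms(3) has_vector_derivative_at_within[of F _ t I] by simp
  then show ?thesis
    by (rule has_vector_derivative_transform_within[OF _ e(1)])
      (use assms(2,3) e in \<open>auto simp: dist_commute subset_iff\<close>)
qed

lemma smooth_par:
  assumes "smooth U l" "smooth U G" "smooth U V" "smooth U M"
  shows "smooth U (\<lambda>t. par_point \<sigma> (l t) (G t) (V t) (M t))"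
    "smooth U (\<lambda>t. par_nu \<sigma> (l t) (G t) (V t) (M t))"
    "smooth U (\<lambda>t. par_mu \<sigma> (l t) (G t) (V t) (M t))"
proof -
  note o = smoothD(1)[OF assms(1)]
  have half: "smooth U (\<lambda>t. c * (l t)\<^sup>2 / 2)" for c
    by (intro smooth_divide smooth_mult smooth_power smooth_const assms o) auto
  show "smooth U (\<lambda>t. par_point \<sigma> (l t) (G t) (V t) (M t))"
    "smooth U (\<lambda>t. par_nu \<sigma> (l t) (G t) (V t) (M t))"
    "smooth U (\<lambda>t. par_mu \<sigma> (l t) (G t) (V t) (M t))"
    unfolding par_point_def par_nu_def par_mu_def using half[of 1] half[of \<sigma>]
    by (intro smooth_add smooth_diff smooth_scaleR smooth_const smooth_mult assms o; simp)+
qed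

section \<open>The moving frame along a Legendre curve\<close>

locale legendre_curve =
  fixes I :: "real set" and \<gamma> \<nu> :: "real \<Rightarrow> real ^ 3" and m n :: "real \<Rightarrow> real" and \<sigma> :: real
  assumes I: "is_interval I" "interior I \<noteq> {}"
    and legendre: "spacelike_Legendre_curve I \<gamma> \<nu>"
    and curvature: "has_Legendre_curvature I \<gamma> \<nu> m n"
    and \<sigma>: "\<sigma> \<in> {1, -1}"
begin

abbreviation "\<mu> \<equiv> Legendre_mu \<gamma> \<nu>"
abbreviation "frameP l t \<equiv> par_point \<sigma> l (\<gamma> t) (\<nu> t) (\<mu> t)"
abbreviation "frameN l t \<equiv> par_nu \<sigma> l (\<gamma> t) (\<nu> t) (\<mu> t)"
abbreviation "frameM l t \<equiv> par_mu \<sigma> l (\<gamma> t) (\<nu> t) (\<mu> t)"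
abbreviation "evolute \<equiv> horocyclic_evolute \<sigma> \<gamma> \<nu>"
abbreviation "parallel \<equiv> horocyclic_parallel \<sigma> \<gamma> \<nu>"

lemma Delta1: "t \<in> I \<Longrightarrow> (\<gamma> t, \<nu> t) \<in> Delta1"
  using legendre by (simp add: spacelike_Legendre_curve_def)

lemma \<mu>_eq: "\<mu> t = lorentz_cross (\<gamma> t) (\<nu> t)"
  by (simp add: Legendre_mu_def)

lemma frame_derivatives:
  assumes "J \<subseteq> I" "t \<in> J"
  shows "(\<gamma> has_vector_derivative m t *\<^sub>R \<mu> t) (at t within J)"
    and "(\<nu> has_vector_derivative n t *\<^sub>R \<mu> t) (at t within J)"
    and "(\<mu> has_vector_derivative m t *\<^sub>R \<gamma> t - n t *\<^sub>R \<nu> t) (at t within J)"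
proof -
  have t: "t \<in> I" using assms by auto
  show 1: "(\<gamma> has_vector_derivative m t *\<^sub>R \<mu> t) (at t within J)"
    and 2: "(\<nu> has_vector_derivative n t *\<^sub>R \<mu> t) (at t within J)"
    using curvature t assms(1) has_vector_derivative_within_subset
    unfolding has_Legendre_curvature_def by blast+
  have "((\<lambda>t. lorentz_cross (\<gamma> t) (\<nu> t)) has_vector_derivative
      lorentz_cross (\<gamma> t) (n t *\<^sub>R \<mu> t) + lorentz_cross (m t *\<^sub>R \<mu> t) (\<nu> t)) (at t within J)"
    by (rule bounded_bilinear.has_vector_derivative[OF bounded_bilinear_lorentz_cross 1 2])
  then show "(\<mu> has_vector_derivative m t *\<^sub>R \<gamma> t - n t *\<^sub>R \<nu> t) (at t within J)"
    using lorentz_cross_frame(4,5)[OF Delta1[OF t]]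
    by (simp add: lorentz_cross_linear \<mu>_eq[symmetric] \<mu>_eq[abs_def, symmetric] fun_eq_iff)
qed

text \<open>One computation for both kinds of curves: \<open>l\<close> is arbitrary, and
  \<open>e\<close> measures how far it is from solving the equation of the parallels. Parallels are
  the case \<open>e = 0\<close>, the evolute is the case \<open>l * n + m = 0\<close>, and in each
  the point moves along a single frame vector.\<close>

lemma par_derivatives:
  fixes l :: "real \<Rightarrow> real"
  assumes J: "J \<subseteq> I" "t \<in> J" and l: "(l has_real_derivative l') (at t within J)"
  defines "P \<equiv> \<lambda>t. frameP (l t) t"
    and "N \<equiv> \<lambda>t. frameN (l t) t"
    and "M \<equiv> \<lambda>t. frameM (l t) t"
    and "e \<equiv> l' + \<sigma> * ((l t)\<^sup>2 * n t / 2 + l t * m t)"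
  shows "(P has_vector_derivative (l t * n t + m t) *\<^sub>R M t + e *\<^sub>R N t) (at t within J)"
    and "(N has_vector_derivative n t *\<^sub>R M t + e *\<^sub>R (\<gamma> t + \<sigma> *\<^sub>R \<mu> t)) (at t within J)"
    and "(M has_vector_derivative (l t * n t + m t) *\<^sub>R P t - (n t + \<sigma> * e) *\<^sub>R N t) (at t within J)"
proof -
  note d = frame_derivatives[OF J]
  have l2: "((\<lambda>t. c * (l t)\<^sup>2 / 2) has_real_derivative c * l t * l') (at t within J)" for c
    by (rule derivative_eq_intros l refl | simp)+
  have sc: "((\<lambda>t. a t *\<^sub>R x t) has_vector_derivative a' *\<^sub>R x t + a t *\<^sub>R x') (at t within J)"
    if "(a has_real_derivative a') (at t within J)" "(x has_vector_derivative x') (at t within J)"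
    for a :: "real \<Rightarrow> real" and a' and x :: "real \<Rightarrow> real ^ 3" and x'
    using has_vector_derivative_scaleR[OF that] by (simp add: add.commute)
  have v: "((\<lambda>t. \<gamma> t + \<sigma> *\<^sub>R \<mu> t) has_vector_derivative
      m t *\<^sub>R \<mu> t + \<sigma> *\<^sub>R (m t *\<^sub>R \<gamma> t - n t *\<^sub>R \<nu> t)) (at t within J)"
    by (intro has_vector_derivative_add d
        bounded_linear.has_vector_derivative[OF bounded_linear_scaleR_right])
  have half: "((\<lambda>t. (l t)\<^sup>2 / 2) has_real_derivative l t * l') (at t within J)" using l2[of 1] by simp
  have sl: "((\<lambda>t. \<sigma> * l t) has_real_derivative \<sigma> * l') (at t within J)"
    by (rule DERIV_cmult[OF l])
  have "(P has_vector_derivative m t *\<^sub>R \<mu> t + (l' *\<^sub>R \<nu> t + l t *\<^sub>R (n t *\<^sub>R \<mu> t))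
      + ((l t * l') *\<^sub>R (\<gamma> t + \<sigma> *\<^sub>R \<mu> t)
        + ((l t)\<^sup>2 / 2) *\<^sub>R (m t *\<^sub>R \<mu> t + \<sigma> *\<^sub>R (m t *\<^sub>R \<gamma> t - n t *\<^sub>R \<nu> t)))) (at t within J)"
    unfolding P_def par_point_def
    by (intro has_vector_derivative_add sc d l half v)
  \<comment> \<open>The identity rests on \<open>\<sigma> * \<sigma> = 1\<close>; splitting by the
    sign leaves polynomial identities in each component.\<close>
  also have "m t *\<^sub>R \<mu> t + (l' *\<^sub>R \<nu> t + l t *\<^sub>R (n t *\<^sub>R \<mu> t))
      + ((l t * l') *\<^sub>R (\<gamma> t + \<sigma> *\<^sub>R \<mu> t)
        + ((l t)\<^sup>2 / 2) *\<^sub>R (m t *\<^sub>R \<mu> t + \<sigma> *\<^sub>R (m t *\<^sub>R \<gamma> t - n t *\<^sub>R \<nu> t)))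
    = (l t * n t + m t) *\<^sub>R M t + e *\<^sub>R N t"
    unfolding M_def N_def par_mu_def par_nu_def e_def vec_eq_iff
    by (rule allI, cases "\<sigma> = 1")
      (use \<sigma> in \<open>auto simp: field_simps power2_eq_square power3_eq_cube\<close>)
  finally show "(P has_vector_derivative (l t * n t + m t) *\<^sub>R M t + e *\<^sub>R N t) (at t within J)" .
  have "(N has_vector_derivative n t *\<^sub>R \<mu> t + (l' *\<^sub>R (\<gamma> t + \<sigma> *\<^sub>R \<mu> t)
      + l t *\<^sub>R (m t *\<^sub>R \<mu> t + \<sigma> *\<^sub>R (m t *\<^sub>R \<gamma> t - n t *\<^sub>R \<nu> t)))) (at t within J)"
    unfolding N_def par_nu_def by (intro has_vector_derivative_add sc d l v)
  also have "n t *\<^sub>R \<mu> t + (l' *\<^sub>R (\<gamma> t + \<sigma> *\<^sub>R \<mu> t)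
      + l t *\<^sub>R (m t *\<^sub>R \<mu> t + \<sigma> *\<^sub>R (m t *\<^sub>R \<gamma> t - n t *\<^sub>R \<nu> t)))
    = n t *\<^sub>R M t + e *\<^sub>R (\<gamma> t + \<sigma> *\<^sub>R \<mu> t)"
    unfolding M_def par_mu_def e_def vec_eq_iff
    by (rule allI, cases "\<sigma> = 1")
      (use \<sigma> in \<open>auto simp: field_simps power2_eq_square power3_eq_cube\<close>)
  finally show "(N has_vector_derivative n t *\<^sub>R M t + e *\<^sub>R (\<gamma> t + \<sigma> *\<^sub>R \<mu> t)) (at t within J)" .
  have "(M has_vector_derivative (m t *\<^sub>R \<gamma> t - n t *\<^sub>R \<nu> t)
      - ((\<sigma> * l') *\<^sub>R \<nu> t + (\<sigma> * l t) *\<^sub>R (n t *\<^sub>R \<mu> t))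
      - ((\<sigma> * l t * l') *\<^sub>R (\<gamma> t + \<sigma> *\<^sub>R \<mu> t)
        + (\<sigma> * (l t)\<^sup>2 / 2) *\<^sub>R (m t *\<^sub>R \<mu> t + \<sigma> *\<^sub>R (m t *\<^sub>R \<gamma> t - n t *\<^sub>R \<nu> t)))) (at t within J)"
    unfolding M_def par_mu_def by (intro has_vector_derivative_diff sc d sl l2 v)
  also have "(m t *\<^sub>R \<gamma> t - n t *\<^sub>R \<nu> t)
      - ((\<sigma> * l') *\<^sub>R \<nu> t + (\<sigma> * l t) *\<^sub>R (n t *\<^sub>R \<mu> t))
      - ((\<sigma> * l t * l') *\<^sub>R (\<gamma> t + \<sigma> *\<^sub>R \<mu> t)
        + (\<sigma> * (l t)\<^sup>2 / 2) *\<^sub>R (m t *\<^sub>R \<mu> t + \<sigma> *\<^sub>R (m t *\<^sub>R \<gamma> t - n t *\<^sub>R \<nu> t)))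
    = (l t * n t + m t) *\<^sub>R P t - (n t + \<sigma> * e) *\<^sub>R N t"
    unfolding P_def N_def par_point_def par_nu_def e_def vec_eq_iff
    by (rule allI, cases "\<sigma> = 1")
      (use \<sigma> in \<open>auto simp: field_simps power2_eq_square power3_eq_cube\<close>)
  finally show "(M has_vector_derivative (l t * n t + m t) *\<^sub>R P t - (n t + \<sigma> * e) *\<^sub>R N t) (at t within J)" .
qed

lemma horocyclic_parallel_eq:
  "parallel l = (\<lambda>t. frameP (l t) t)"
  by (simp add: horocyclic_parallel_def par_point_def fun_eq_iff)

lemma horocyclic_evolute_eq:
  "evolute l = (\<lambda>t. frameP (l t) t)"
  by (simp add: horocyclic_evolute_def par_point_def fun_eq_iff)

lemma par_point_in_hyperbolic:
  "t \<in> I \<Longrightarrow> frameP l t \<in> hyperbolic_plane"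
  unfolding \<mu>_eq by (rule par_point_hyperbolic[OF \<sigma> Delta1])

lemma par_frame_det:
  fixes l :: real
  assumes "t \<in> I"
  defines "a \<equiv> frameM l t" and "b \<equiv> frameN l t"
  shows "a $ 2 * b $ 3 - a $ 3 * b $ 2 < 0"
proof -
  have "lorentz_cross a b \<in> hyperbolic_plane"
    using par_frame_cross[OF \<sigma> Delta1[OF assms(1)]] par_point_in_hyperbolic[OF assms(1)]
    unfolding a_def b_def \<mu>_eq by simp
  then show ?thesis by (simp add: hyperbolic_plane_def lorentz_cross_def)
qed

text \<open>The Lorentz product with \<open>\<nu>\<close> recovers the parameter. So a common point
  of evolute and parallel at \<open>t\<close> means \<open>lam t = f t\<close>, even where
  \<open>n\<close> vanishes.\<close>

lemma par_point_inj:
  assumes "t \<in> I" "frameP l t = par_point \<sigma> l' (\<gamma> t) (\<nu> t) (\<mu> t)"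
  shows "l = l'"
proof -
  have fr: "lorentz (\<gamma> t) (\<nu> t) = 0" "lorentz (\<nu> t) (\<nu> t) = 1"
    using Delta1[OF assms(1)] by (auto simp: Delta1_def de_Sitter_plane_def)
  have "lorentz (\<mu> t) (\<nu> t) = 0"
    using lorentz_cross_frame(3)[OF Delta1[OF assms(1)]] unfolding \<mu>_eq by (simp add: lorentz_commute)
  then have "lorentz (frameP k t) (\<nu> t) = k" for k
    by (simp add: par_point_def lorentz_linear fr)
  then show ?thesis using assms(2) by metis
qed

text \<open>\<open>m\<close> and \<open>n\<close> are given only through their values on
  \<open>I\<close>. Smooth extensions are read off from extensions of \<open>\<gamma>\<close> and
  \<open>\<nu>\<close> by the Lorentz product with \<open>\<mu>\<close>, which is a unit
  vector.\<close>

lemma local_frame: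
  assumes "t0 \<in> I"
  obtains U G N where "t0 \<in> U" "smooth U G" "smooth U N"
    "\<forall>t\<in>U \<inter> I. G t = \<gamma> t" "\<forall>t\<in>U \<inter> I. N t = \<nu> t"
    "\<forall>t\<in>U \<inter> I. lorentz (vderiv G t) (lorentz_cross (G t) (N t)) = m t"
    "\<forall>t\<in>U \<inter> I. lorentz (vderiv N t) (lorentz_cross (G t) (N t)) = n t"
proof -
  obtain U1 G where G: "t0 \<in> U1" "smooth U1 G" "\<forall>t\<in>U1 \<inter> I. G t = \<gamma> t"
    using legendre assms smooth_map_on_local[of I \<gamma> t0] unfolding spacelike_Legendre_curve_def by metis
  obtain U2 N where N: "t0 \<in> U2" "smooth U2 N" "\<forall>t\<in>U2 \<inter> I. N t = \<nu> t"
    using legendre assms smooth_map_on_local[of I \<nu> t0] unfolding spacelike_Legendre_curve_def by metis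
  have o: "open (U1 \<inter> U2)" using smoothD(1)[OF G(2)] smoothD(1)[OF N(2)] by blast
  have sm: "smooth (U1 \<inter> U2) G" "smooth (U1 \<inter> U2) N"
    using smooth_subset[OF G(2) _ o] smooth_subset[OF N(2) _ o] by auto
  have eq: "G t = \<gamma> t" "N t = \<nu> t" if "t \<in> (U1 \<inter> U2) \<inter> I" for t
    using that G(3) N(3) by auto
  have der: "vderiv G t = m t *\<^sub>R \<mu> t" "vderiv N t = n t *\<^sub>R \<mu> t" if t: "t \<in> (U1 \<inter> U2) \<inter> I" for t
    using t by (auto intro!: vderiv_within_eq[OF sm(1) I t eq(1)] vderiv_within_eq[OF sm(2) I t eq(2)]
        frame_derivatives)
  have "lorentz (\<mu> t) (\<mu> t) = 1" if "t \<in> I" for t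
    using lorentz_cross_frame(1)[OF Delta1[OF that]] by (simp add: \<mu>_eq)
  then show ?thesis
    using G(1) N(1) sm eq der
    by (intro that[of "U1 \<inter> U2" G N]) (simp_all add: lorentz_linear \<mu>_eq[symmetric])
qed

lemma par_nu_nonzero: "t \<in> I \<Longrightarrow> frameN l t \<noteq> 0"
  using par_frame_det[of t l] by fastforce

text \<open>Even if \<open>t0\<close> is an endpoint, it lies in the closure of the interior of
  \<open>I\<close>, so each of its relative neighbourhoods contains interior points. This makes
  derivatives within \<open>J\<close> unique.\<close>

lemma defines_parallel_interior:
  assumes "defines_parallel \<sigma> I m n t0 J lam" shows "interior J \<noteq> {}"
proof -
  obtain V where V: "open V" "t0 \<in> V" "V \<inter> I \<subseteq> J" "t0 \<in> J" "J \<subseteq> I"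
    using assms unfolding defines_parallel_def by blast
  have "t0 \<in> closure (interior I)"
    using V I closure_subset[of I] by (subst convex_closure_interior) (auto simp: is_interval_convex_1)
  then obtain s where "s \<in> V" "s \<in> interior I"
    using V(1,2) by (auto simp: closure_iff_nhds_not_empty)
  then have "s \<in> V \<inter> interior I" by blast
  moreover have "V \<inter> interior I \<subseteq> interior J"
    using V interior_subset by (intro interior_maximal) auto
  ultimately show ?thesis by blast
qed

lemma horocyclic_parallel_derivative:
  assumes J: "J \<subseteq> I" "t \<in> J" and lam: "parallel_ode_solution \<sigma> m n J lam"
  shows "(parallel lam has_vector_derivative
    (lam t * n t + m t) *\<^sub>R frameM (lam t) t) (at t within J)"
    and "((\<lambda>t. frameM (lam t) t) has_vector_derivative
      (lam t * n t + m t) *\<^sub>R frameP (lam t) t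
      - n t *\<^sub>R frameN (lam t) t) (at t within J)"
proof -
  have l: "(lam has_real_derivative - \<sigma> * ((lam t)\<^sup>2 * n t / 2 + lam t * m t)) (at t within J)"
    using lam J unfolding parallel_ode_solution_def by blast
  have "- \<sigma> * ((lam t)\<^sup>2 * n t / 2 + lam t * m t) + \<sigma> * ((lam t)\<^sup>2 * n t / 2 + lam t * m t) = 0"
    by (simp add: algebra_simps)
  note d = par_derivatives(1,3)[OF J l, unfolded this]
  show "(parallel lam has_vector_derivative
    (lam t * n t + m t) *\<^sub>R frameM (lam t) t) (at t within J)"
    unfolding horocyclic_parallel_eq using d(1) by simp
  show "((\<lambda>t. frameM (lam t) t) has_vector_derivative
      (lam t * n t + m t) *\<^sub>R frameP (lam t) t
      - n t *\<^sub>R frameN (lam t) t) (at t within J)"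
    using d(2) by simp
qed

text \<open>\<open>defines_parallel\<close> demands \<open>J = I\<close> as soon as a global
  solution with the given initial value exists, hence a case distinction on precisely this; in the
  other case a local solution is enough.\<close>

lemma parallel_exists:
  assumes t0: "t0 \<in> I"
  obtains J lam where "defines_parallel \<sigma> I m n t0 J lam" "lam t0 = l"
proof (cases "\<exists>lam'. parallel_ode_solution \<sigma> m n I lam' \<and> lam' t0 = l")
  case True
  then obtain lam where "parallel_ode_solution \<sigma> m n I lam" "lam t0 = l" by blast
  then have "defines_parallel \<sigma> I m n t0 I lam"
    unfolding defines_parallel_def using I(1) t0 by (auto intro!: exI[of _ UNIV])
  then show ?thesis using that \<open>lam t0 = l\<close> by blast
next
  case False
  obtain U G N where fr: "t0 \<in> U" "smooth U G" "smooth U N"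
    "\<forall>t\<in>U \<inter> I. lorentz (vderiv G t) (lorentz_cross (G t) (N t)) = m t"
    "\<forall>t\<in>U \<inter> I. lorentz (vderiv N t) (lorentz_cross (G t) (N t)) = n t"
    by (rule local_frame[OF t0])
  let ?m = "\<lambda>t. lorentz (vderiv G t) (lorentz_cross (G t) (N t))"
  let ?n = "\<lambda>t. lorentz (vderiv N t) (lorentz_cross (G t) (N t))"
  have M: "smooth U (\<lambda>t. lorentz_cross (G t) (N t))"
    by (rule smooth_bilinear[OF bounded_bilinear_lorentz_cross fr(2,3)])
  have sm: "smooth U ?m" "smooth U ?n"
    using smooth_bilinear[OF bounded_bilinear_lorentz smooth_vderiv[OF fr(2)] M]
      smooth_bilinear[OF bounded_bilinear_lorentz smooth_vderiv[OF fr(3)] M] by auto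
  obtain d lam where d: "d > 0" "smooth {t0 - d<..<t0 + d} lam" "lam t0 = l" "{t0 - d<..<t0 + d} \<subseteq> U"
    "\<forall>x\<in>{t0 - d<..<t0 + d}.
      (lam has_real_derivative - \<sigma> * ((lam x)\<^sup>2 * ?n x / 2 + lam x * ?m x)) (at x)"
    using bernoulli_local_solution[OF sm fr(1), of l \<sigma>] by metis
  let ?V = "{t0 - d<..<t0 + d}"
  let ?J = "?V \<inter> I"
  have "smooth_map_on ?J lam"
    unfolding smooth_map_on_def using d(2)
    by (intro ballI exI[of _ ?V] exI[of _ lam]) (auto simp: smooth_def)
  moreover have "(lam has_real_derivative - \<sigma> * ((lam t)\<^sup>2 * n t / 2 + lam t * m t)) (at t within ?J)"
    if t: "t \<in> ?J" for t
  proof -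
    have "t \<in> U \<inter> I" "t \<in> ?V" using t d(4) by auto
    then show ?thesis
      using bspec[OF d(5) \<open>t \<in> ?V\<close>] bspec[OF fr(4) \<open>t \<in> U \<inter> I\<close>] bspec[OF fr(5) \<open>t \<in> U \<inter> I\<close>]
      by (auto intro: has_field_derivative_at_within)
  qed
  ultimately have "parallel_ode_solution \<sigma> m n ?J lam"
    unfolding parallel_ode_solution_def by blast
  then have "defines_parallel \<sigma> I m n t0 ?J lam"
    unfolding defines_parallel_def using False d(1,3) t0 I(1)
    by (intro conjI exI[of _ ?V] disjI2 is_interval_Int) auto
  then show ?thesis using that d(3) by blast
qed

end

locale legendre_curve_evolute = legendre_curve +
  fixes f :: "real \<Rightarrow> real"
  assumes smooth_f: "smooth_map_on I f" and mf: "\<forall>t\<in>I. m t + f t * n t = 0"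
begin

lemma horocyclic_evolute_derivative:
  assumes t: "t \<in> I" and f': "(f has_real_derivative f') (at t within I)"
  defines "e \<equiv> f' - \<sigma> * n t * (f t)\<^sup>2 / 2"
  shows "(evolute f has_vector_derivative e *\<^sub>R frameN (f t) t) (at t within I)"
    and "((\<lambda>t. frameN (f t) t) has_vector_derivative
      n t *\<^sub>R frameM (f t) t + e *\<^sub>R (\<gamma> t + \<sigma> *\<^sub>R \<mu> t)) (at t within I)"
proof -
  have m: "m t = - f t * n t" using mf t by (simp add: eq_neg_iff_add_eq_0)
  have e: "f' + \<sigma> * ((f t)\<^sup>2 * n t / 2 + f t * m t) = e" "f t * n t + m t = 0"
    unfolding e_def m by (simp_all add: algebra_simps power2_eq_square)
  note d = par_derivatives(1,2)[OF subset_refl t f', unfolded e]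
  show "(evolute f has_vector_derivative e *\<^sub>R frameN (f t) t) (at t within I)"
    unfolding horocyclic_evolute_eq using d(1) by simp
  show "((\<lambda>t. frameN (f t) t) has_vector_derivative
      n t *\<^sub>R frameM (f t) t + e *\<^sub>R (\<gamma> t + \<sigma> *\<^sub>R \<mu> t)) (at t within I)"
    using d(2) .
qed

text \<open>Here \<open>e\<close> and \<open>e'\<close> are the values at \<open>t0\<close> of \<open>f' - \<sigma> n f\<^sup>2 / 2\<close> and of its derivative.\<close>

lemma cusp_conditions:
  assumes par: "defines_parallel \<sigma> I m n t0 J lam" and lf: "lam t0 = f t0"
  obtains e e' where
    "regular_point I (evolute f) t0 \<longleftrightarrow> e \<noteq> (0::real)"
    "is_cusp 2 3 I hyperbolic_plane (evolute f) t0 \<longleftrightarrow> e = 0 \<and> e' \<noteq> (0::real) \<and> n t0 \<noteq> 0"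
    "is_cusp 2 3 J hyperbolic_plane (parallel lam) t0 \<longleftrightarrow> e \<noteq> 0 \<and> n t0 \<noteq> 0"
    "is_cusp 3 4 J hyperbolic_plane (parallel lam) t0 \<longleftrightarrow> e = 0 \<and> e' \<noteq> 0 \<and> n t0 \<noteq> 0"
proof -
  obtain V where V: "open V" "t0 \<in> V" "V \<inter> I \<subseteq> J" and J: "t0 \<in> J" "J \<subseteq> I" "is_interval J"
    and ode: "parallel_ode_solution \<sigma> m n J lam"
    using par unfolding defines_parallel_def by blast
  have intJ: "interior J \<noteq> {}" by (rule defines_parallel_interior[OF par])
  have t0: "t0 \<in> I" using J by blast
  obtain U1 G N where fr: "t0 \<in> U1" "smooth U1 G" "smooth U1 N"
    "\<forall>t\<in>U1 \<inter> I. G t = \<gamma> t" "\<forall>t\<in>U1 \<inter> I. N t = \<nu> t"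
    "\<forall>t\<in>U1 \<inter> I. lorentz (vderiv N t) (lorentz_cross (G t) (N t)) = n t"
    by (rule local_frame[OF t0])
  obtain U2 F where F: "t0 \<in> U2" "smooth U2 F" "\<forall>t\<in>U2 \<inter> I. F t = f t"
    by (rule smooth_map_on_local[OF smooth_f t0])
  have "smooth_map_on J lam" using ode by (simp add: parallel_ode_solution_def)
  then obtain U3 L where L: "t0 \<in> U3" "smooth U3 L" "\<forall>t\<in>U3 \<inter> J. L t = lam t"
    by (rule smooth_map_on_local[OF _ J(1)])
  define U where "U = U1 \<inter> U2 \<inter> U3 \<inter> V"
  have oU: "open U" unfolding U_def
    by (intro open_Int smoothD(1)[OF fr(2)] smoothD(1)[OF F(2)] smoothD(1)[OF L(2)] V(1))
  have tU: "t0 \<in> U" using fr(1) F(1) L(1) V(2) by (simp add: U_def)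
  have tUJ: "t0 \<in> U \<inter> J" and tUI: "t0 \<in> U \<inter> I" using tU J t0 by auto
  \<comment> \<open>Inside \<open>U\<close> the intervals \<open>J\<close> and \<open>I\<close>
    coincide, so formulas for the evolute and for the parallel can be used side by side.\<close>
  have UJ: "U \<inter> J = U \<inter> I" using V(3) J(2) by (auto simp: U_def)
  have sm: "smooth U G" "smooth U N" "smooth U F" "smooth U L"
    using smooth_subset[OF fr(2) _ oU] smooth_subset[OF fr(3) _ oU]
      smooth_subset[OF F(2) _ oU] smooth_subset[OF L(2) _ oU] by (auto simp: U_def)
  have eq: "G t = \<gamma> t" "N t = \<nu> t" "F t = f t" "L t = lam t" if "t \<in> U \<inter> I" for t
    using that fr(4,5) F(3) L(3) UJ by (auto simp: U_def)
  define M where "M t = lorentz_cross (G t) (N t)" for t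
  define nn where "nn t = lorentz (vderiv N t) (M t)" for t
  have smM: "smooth U M"
    unfolding M_def by (rule smooth_bilinear[OF bounded_bilinear_lorentz_cross sm(1,2)])
  have smn: "smooth U nn"
    unfolding nn_def by (rule smooth_bilinear[OF bounded_bilinear_lorentz smooth_vderiv[OF sm(2)] smM])
  have eqM: "M t = \<mu> t" if "t \<in> U \<inter> I" for t using eq[OF that] by (simp add: M_def \<mu>_eq)
  have eqn: "nn t = n t" if "t \<in> U \<inter> I" for t
    using that fr(6) by (simp add: nn_def M_def U_def)
  have half: "smooth U (\<lambda>t. \<sigma> / 2 * (nn t * (k t)\<^sup>2))" if "smooth U k" for k
    by (intro smooth_mult smooth_power smooth_const oU smn that)
  define e where "e t = vderiv F t - \<sigma> / 2 * (nn t * (F t)\<^sup>2)" for t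
  have sme: "smooth U e"
    unfolding e_def by (intro smooth_diff smooth_vderiv sm half)
  have derf: "(f has_real_derivative vderiv F t) (at t within I)" if "t \<in> U \<inter> I" for t
    using extension_has_vector_derivative[OF sm(3) eq(3) that]
    by (simp add: real_vector_derivative_iff)
  have e_eq: "vderiv F t - \<sigma> * n t * (f t)\<^sup>2 / 2 = e t" if "t \<in> U \<inter> I" for t
    using eq[OF that] eqn[OF that] by (simp add: e_def)
  have E1: "(evolute f has_vector_derivative e t *\<^sub>R frameN (f t) t) (at t within I)"
    and E2: "((\<lambda>t. frameN (f t) t) has_vector_derivative
      n t *\<^sub>R frameM (f t) t + e t *\<^sub>R (\<gamma> t + \<sigma> *\<^sub>R \<mu> t)) (at t within I)"
    if t: "t \<in> U \<inter> I" for t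
    using horocyclic_evolute_derivative[OF _ derf[OF t]] t unfolding e_eq[OF t] by auto
  have reg: "regular_point I (evolute f) t0 \<longleftrightarrow> e t0 \<noteq> 0"
  proof -
    have lim: "at t0 within I \<noteq> bot"
      using connected_imp_perfect[of I t0] is_interval_connected[OF I(1)] I(2) t0
      by (metis at_within_eq_bot_iff interior_singleton trivial_limit_within)
    have "v = e t0 *\<^sub>R frameN (f t0) t0"
      if "(evolute f has_vector_derivative v) (at t0 within I)" for v
      using vector_derivative_unique_within[OF lim that E1[OF tUI]] .
    then show ?thesis
      using E1[OF tUI] par_nu_nonzero[OF t0, of "f t0"] unfolding regular_point_def
      by (metis scaleR_eq_0_iff)
  qed

  let ?nuE = "\<lambda>t. par_nu \<sigma> (F t) (G t) (N t) (M t)"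
  have nuE: "?nuE t = frameN (f t) t" if "t \<in> U \<inter> I" for t
    using eq[OF that] eqM[OF that] by simp
  have nuE': "vderiv ?nuE t = n t *\<^sub>R frameM (f t) t + e t *\<^sub>R (\<gamma> t + \<sigma> *\<^sub>R \<mu> t)"
    if t: "t \<in> U \<inter> I" for t
    by (rule vderiv_within_eq[OF smooth_par(2)[OF sm(3,1,2) smM] I t nuE E2[OF t]])
  let ?a = "frameM (f t0) t0" and ?b = "frameN (f t0) t0"
  have det: "?a $ 2 * ?b $ 3 - ?a $ 3 * ?b $ 2 < 0" by (rule par_frame_det[OF t0])
  have b0: "?nuE t0 $ 2 \<noteq> 0 \<or> ?nuE t0 $ 3 \<noteq> 0" using det nuE[OF tUI] by auto
  have E23: "is_cusp 2 3 I hyperbolic_plane (evolute f) t0 \<longleftrightarrow>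
      e t0 = 0 \<and> vderiv e t0 \<noteq> 0 \<and> n t0 \<noteq> 0"
  proof -
    have "is_cusp 2 3 I hyperbolic_plane (evolute f) t0 \<longleftrightarrow> e t0 = 0 \<and> vderiv e t0 \<noteq> 0 \<and>
        ?nuE t0 $ 2 * vderiv ?nuE t0 $ 3 - ?nuE t0 $ 3 * vderiv ?nuE t0 $ 2 \<noteq> 0"
    proof (rule is_cusp_iff_velocity(1)[OF smooth_par(1)[OF sm(3,1,2) smM, of \<sigma>] sme
          smooth_par(2)[OF sm(3,1,2) smM] I tUI _ _ _ b0])
      show "par_point \<sigma> (F s) (G s) (N s) (M s) = evolute f s" if "s \<in> U \<inter> I" for s
        using eq[OF that] eqM[OF that] by (simp add: horocyclic_evolute_eq)
      show "evolute f s \<in> hyperbolic_plane" if "s \<in> I" for s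
        unfolding horocyclic_evolute_eq by (rule par_point_in_hyperbolic[OF that])
      show "(evolute f has_vector_derivative e s *\<^sub>R ?nuE s) (at s within I)"
        if "s \<in> U \<inter> I" for s
        using E1[OF that] nuE[OF that] by simp
    qed
    \<comment> \<open>The determinant matters only if \<open>e t0 = 0\<close>. Then the derivative
      of \<open>?nuE\<close> loses its second term, and the determinant becomes
      \<open>- n t0\<close> times that of the frame.\<close>
    moreover have "?nuE t0 $ 2 * vderiv ?nuE t0 $ 3 - ?nuE t0 $ 3 * vderiv ?nuE t0 $ 2 =
        - n t0 * (?a $ 2 * ?b $ 3 - ?a $ 3 * ?b $ 2)" if "e t0 = 0"
      unfolding nuE'[OF tUI] nuE[OF tUI] that by (simp add: algebra_simps)
    ultimately show ?thesis using det by auto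
  qed

  define h where "h t = L t - F t" for t
  have smh: "smooth U h" unfolding h_def by (rule smooth_diff[OF sm(4,3)])
  have h0: "h t0 = 0" using eq[OF tUI] lf by (simp add: h_def)
  define g where "g t = h t * nn t" for t
  have smg: "smooth U g" unfolding g_def by (rule smooth_mult[OF smh smn])
  have m_eq: "m t = - f t * n t" if "t \<in> I" for t
    using mf that by (simp add: eq_neg_iff_add_eq_0)
  have g_eq: "g t = lam t * n t + m t" if "t \<in> U \<inter> I" for t
    using eq[OF that] eqn[OF that] m_eq[of t] that by (simp add: g_def h_def algebra_simps)
  \<comment> \<open>Completing the square: after substituting \<open>m = - f n\<close> the equation
    contains \<open>lam\<^sup>2 - 2 * lam * f = h\<^sup>2 - f\<^sup>2\<close>, and the term with
    \<open>f\<^sup>2\<close> is absorbed into \<open>e\<close>.\<close>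
  have vh: "vderiv h t = - e t - \<sigma> / 2 * (nn t * (h t)\<^sup>2)" if t: "t \<in> U \<inter> I" for t
  proof -
    have tJ: "t \<in> U \<inter> J" using t UJ by simp
    have "(lam has_real_derivative - \<sigma> * ((lam t)\<^sup>2 * n t / 2 + lam t * m t)) (at t within J)"
      using ode tJ unfolding parallel_ode_solution_def by blast
    then have "(lam has_vector_derivative - \<sigma> * ((lam t)\<^sup>2 * n t / 2 + lam t * m t)) (at t within J)"
      by (simp only: real_vector_derivative_iff)
    then have "vderiv L t = - \<sigma> * ((lam t)\<^sup>2 * n t / 2 + lam t * m t)"
      using eq(4) UJ by (intro vderiv_within_eq[OF sm(4) J(3) intJ tJ]) auto
    moreover have "vderiv h t = vderiv L t - vderiv F t"
      unfolding h_def using smooth_has_vderiv[OF sm(4), of t] smooth_has_vderiv[OF sm(3), of t] t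
      by (intro vderiv_eqI has_vector_derivative_diff) auto
    ultimately show ?thesis
      using eq[OF t] eqn[OF t] m_eq[of t] t
      by (simp add: e_def h_def algebra_simps power2_eq_square)
  qed
  have h1: "vderiv h t0 = - e t0" using vh[OF tUI] h0 by simp
  have h2: "vderiv (vderiv h) t0 = - vderiv e t0"
  proof -
    let ?k = "\<lambda>t. nn t * (h t)\<^sup>2"
    have dh: "(h has_real_derivative vderiv h t0) (at t0)"
      and dn: "(nn has_real_derivative vderiv nn t0) (at t0)"
      and de: "(e has_real_derivative vderiv e t0) (at t0)"
      using smooth_has_vderiv[OF smh tU] smooth_has_vderiv[OF smn tU]
        smooth_has_vderiv[OF sme tU] by (simp_all add: real_vector_derivative_iff)
    \<comment> \<open>\<open>h\<close> vanishes at \<open>t0\<close>, so its square vanishes there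
      to second order and the nonlinear term does not affect the second derivative of
      \<open>h\<close>.\<close>
    have dk: "(?k has_real_derivative 0) (at t0)"
      using DERIV_mult[OF dn DERIV_power[OF dh, of 2]] h0 by simp
    have "((\<lambda>t. - e t - \<sigma> / 2 * ?k t) has_real_derivative - vderiv e t0 - \<sigma> / 2 * 0) (at t0)"
      by (intro DERIV_diff DERIV_minus de DERIV_cmult dk)
    then have "vderiv (\<lambda>t. - e t - \<sigma> / 2 * ?k t) t0 = - vderiv e t0"
      by (intro vderiv_eqI) (simp add: real_vector_derivative_iff)
    moreover have "vderiv (vderiv h) t0 = vderiv (\<lambda>t. - e t - \<sigma> / 2 * ?k t) t0"
      using funpow_vderiv_agree[OF smooth_vderiv[OF smh]
          smooth_diff[OF smooth_uminus[OF sme] half[OF smh]] I vh tUI, of 1] by simp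
    ultimately show ?thesis by simp
  qed
  have g0: "g t0 = 0" using h0 by (simp add: g_def)
  have n0: "nn t0 = n t0" by (rule eqn[OF tUI])
  have vg: "vderiv g s = vderiv h s * nn s + h s * vderiv nn s" if "s \<in> U" for s
    unfolding g_def by (rule vderiv_mult[OF smh smn that])
  have g1: "vderiv g t0 = - e t0 * n t0" using vg[OF tU] h0 h1 n0 by simp
  \<comment> \<open>The term with \<open>vderiv nn t0\<close> drops out of the condition for a
    (3,4)-cusp: there \<open>vderiv g t0 = 0\<close> and \<open>n t0 \<noteq> 0\<close> force
    \<open>e t0 = 0\<close>.\<close>
  have g2: "vderiv (vderiv g) t0 = - vderiv e t0 * n t0 - 2 * e t0 * vderiv nn t0"
  proof -
    note s = smooth_mult[OF smooth_vderiv[OF smh] smn] smooth_mult[OF smh smooth_vderiv[OF smn]]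
    have "vderiv (vderiv g) t0 = vderiv (\<lambda>s. vderiv h s * nn s + h s * vderiv nn s) t0"
      using funpow_vderiv_agree[OF smooth_vderiv[OF smg] smooth_add[OF s], of UNIV t0 1] vg tU by simp
    also have "\<dots> = vderiv (\<lambda>s. vderiv h s * nn s) t0 + vderiv (\<lambda>s. h s * vderiv nn s) t0"
      by (rule vderiv_add[OF s tU])
    finally show ?thesis
      using vderiv_mult[OF smooth_vderiv[OF smh] smn tU] vderiv_mult[OF smh smooth_vderiv[OF smn] tU] h0 h1 h2 n0
      by simp
  qed
  let ?muP = "\<lambda>t. par_mu \<sigma> (L t) (G t) (N t) (M t)"
  have muP: "?muP t = frameM (lam t) t" if "t \<in> U \<inter> J" for t
    using eq[of t] eqM[of t] that UJ by simp
  have muP0: "?muP t0 = ?a" using muP[OF tUJ] lf by simp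
  have muP': "vderiv ?muP t0 = - n t0 *\<^sub>R ?b"
  proof -
    have "vderiv ?muP t0 = (lam t0 * n t0 + m t0) *\<^sub>R frameP (lam t0) t0
      - n t0 *\<^sub>R frameN (lam t0) t0"
      by (rule vderiv_within_eq[OF smooth_par(3)[OF sm(4,1,2) smM] J(3) intJ tUJ muP
            horocyclic_parallel_derivative(2)[OF J(2,1) ode]])
    then show ?thesis using g_eq[OF tUI] g0 lf by simp
  qed
  have a0: "?muP t0 $ 2 \<noteq> 0 \<or> ?muP t0 $ 3 \<noteq> 0" using det muP0 by auto
  have dP: "?muP t0 $ 2 * vderiv ?muP t0 $ 3 - ?muP t0 $ 3 * vderiv ?muP t0 $ 2 =
      - n t0 * (?a $ 2 * ?b $ 3 - ?a $ 3 * ?b $ 2)"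
    unfolding muP' muP0 by (simp add: algebra_simps)
  have pt: "par_point \<sigma> (L s) (G s) (N s) (M s) = parallel lam s" if "s \<in> U \<inter> J" for s
    using eq[of s] eqM[of s] that UJ by (simp add: horocyclic_parallel_eq)
  have inH: "parallel lam s \<in> hyperbolic_plane" if "s \<in> J" for s
    unfolding horocyclic_parallel_eq by (rule par_point_in_hyperbolic) (use that J(2) in blast)
  have derP: "(parallel lam has_vector_derivative g s *\<^sub>R ?muP s) (at s within J)"
    if "s \<in> U \<inter> J" for s
  proof -
    have "s \<in> J" "s \<in> U \<inter> I" using that UJ by auto
    then show ?thesis
      using horocyclic_parallel_derivative(1)[OF J(2) _ ode, of s] muP[OF that] g_eq[of s] by simp
  qed
  note sP = smooth_par(1)[OF sm(4,1,2) smM, of \<sigma>] smg smooth_par(3)[OF sm(4,1,2) smM]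
  have P: "is_cusp 2 3 J hyperbolic_plane (parallel lam) t0 \<longleftrightarrow>
      g t0 = 0 \<and> vderiv g t0 \<noteq> 0 \<and> - n t0 * (?a $ 2 * ?b $ 3 - ?a $ 3 * ?b $ 2) \<noteq> 0"
    "is_cusp 3 4 J hyperbolic_plane (parallel lam) t0 \<longleftrightarrow>
      g t0 = 0 \<and> vderiv g t0 = 0 \<and> vderiv (vderiv g) t0 \<noteq> 0 \<and>
      - n t0 * (?a $ 2 * ?b $ 3 - ?a $ 3 * ?b $ 2) \<noteq> 0"
    unfolding dP[symmetric] by (rule is_cusp_iff_velocity[OF sP J(3) intJ tUJ pt inH derP a0]; assumption)+
  have P23: "is_cusp 2 3 J hyperbolic_plane (parallel lam) t0 \<longleftrightarrow> e t0 \<noteq> 0 \<and> n t0 \<noteq> 0"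
    unfolding P(1) g0 g1 using det by auto
  have P34: "is_cusp 3 4 J hyperbolic_plane (parallel lam) t0 \<longleftrightarrow>
      e t0 = 0 \<and> vderiv e t0 \<noteq> 0 \<and> n t0 \<noteq> 0"
    unfolding P(2) g0 g1 g2 using det by auto
  show ?thesis by (rule that[OF reg E23 P23 P34])
qed

end

theorem proposition3p16:
  fixes I :: "real set" and \<gamma> \<nu> :: "real \<Rightarrow> real ^ 3" and m n f :: "real \<Rightarrow> real" and \<sigma> :: real
  assumes "is_interval I" and "interior I \<noteq> {}"
    and "spacelike_Legendre_curve I \<gamma> \<nu>"
    and "has_Legendre_curvature I \<gamma> \<nu> m n"
    and "I \<subseteq> closure {t \<in> I. n t \<noteq> 0}"
    and "smooth_map_on I f"
    and "\<forall>t\<in>I. m t + f t * n t = 0"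
    and "\<sigma> \<in> {1, -1}"
  shows
    "(\<forall>t\<^sub>0\<in>I. \<exists>J lam. defines_parallel \<sigma> I m n t\<^sub>0 J lam \<and>
        horocyclic_evolute \<sigma> \<gamma> \<nu> f t\<^sub>0 = horocyclic_parallel \<sigma> \<gamma> \<nu> lam t\<^sub>0 \<and>
        lam t\<^sub>0 * n t\<^sub>0 + m t\<^sub>0 = 0) \<and>
     horocyclic_evolute \<sigma> \<gamma> \<nu> f ` I \<subseteq> parallel_singular_values \<sigma> I \<gamma> \<nu> m n \<and>
     (\<forall>t\<^sub>0\<in>I. \<forall>J lam. defines_parallel \<sigma> I m n t\<^sub>0 J lam \<and>
        horocyclic_evolute \<sigma> \<gamma> \<nu> f t\<^sub>0 = horocyclic_parallel \<sigma> \<gamma> \<nu> lam t\<^sub>0 \<and>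
        lam t\<^sub>0 * n t\<^sub>0 + m t\<^sub>0 = 0 \<and> n t\<^sub>0 \<noteq> 0 \<longrightarrow>
        (regular_point I (horocyclic_evolute \<sigma> \<gamma> \<nu> f) t\<^sub>0 \<longleftrightarrow>
         is_cusp 2 3 J hyperbolic_plane (horocyclic_parallel \<sigma> \<gamma> \<nu> lam) t\<^sub>0)) \<and>
     (\<forall>t\<^sub>0\<in>I. \<forall>J lam. defines_parallel \<sigma> I m n t\<^sub>0 J lam \<and>
        horocyclic_evolute \<sigma> \<gamma> \<nu> f t\<^sub>0 = horocyclic_parallel \<sigma> \<gamma> \<nu> lam t\<^sub>0 \<and>
        lam t\<^sub>0 * n t\<^sub>0 + m t\<^sub>0 = 0 \<longrightarrow>
        (is_cusp 2 3 I hyperbolic_plane (horocyclic_evolute \<sigma> \<gamma> \<nu> f) t\<^sub>0 \<longleftrightarrow>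
         is_cusp 3 4 J hyperbolic_plane (horocyclic_parallel \<sigma> \<gamma> \<nu> lam) t\<^sub>0))"
proof -
  interpret legendre_curve_evolute I \<gamma> \<nu> m n \<sigma> f
    using assms by unfold_locales auto
  have ex: "\<exists>J lam. defines_parallel \<sigma> I m n t J lam \<and>
      horocyclic_evolute \<sigma> \<gamma> \<nu> f t = horocyclic_parallel \<sigma> \<gamma> \<nu> lam t \<and> lam t * n t + m t = 0"
    if t: "t \<in> I" for t
  proof -
    obtain J lam where "defines_parallel \<sigma> I m n t J lam" "lam t = f t"
      by (rule parallel_exists[OF t])
    moreover have "f t * n t + m t = 0" using assms(7) t by (simp add: add.commute)
    ultimately show ?thesis
      by (intro exI[of _ J] exI[of _ lam]) (simp add: horocyclic_evolute_eq horocyclic_parallel_eq)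
  qed
  moreover have "horocyclic_evolute \<sigma> \<gamma> \<nu> f ` I \<subseteq> parallel_singular_values \<sigma> I \<gamma> \<nu> m n"
  proof
    fix x assume "x \<in> horocyclic_evolute \<sigma> \<gamma> \<nu> f ` I"
    then obtain t where t: "t \<in> I" "x = horocyclic_evolute \<sigma> \<gamma> \<nu> f t" by blast
    obtain J lam where p: "defines_parallel \<sigma> I m n t J lam" "x = horocyclic_parallel \<sigma> \<gamma> \<nu> lam t"
      "lam t * n t + m t = 0"
      using ex[OF t(1)] t(2) by auto
    then have J: "J \<subseteq> I" "t \<in> J" "parallel_ode_solution \<sigma> m n J lam" by (auto simp: defines_parallel_def)
    then have "singular_point J (horocyclic_parallel \<sigma> \<gamma> \<nu> lam) t"
      using horocyclic_parallel_derivative(1)[OF J] p(3) by (simp add: singular_point_def)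
    then show "x \<in> parallel_singular_values \<sigma> I \<gamma> \<nu> m n"
      unfolding parallel_singular_values_def using p J by blast
  qed
  \<comment> \<open>The disjunct \<open>n t = 0\<close> stands for the extra hypothesis of (2), so
    that both equivalences share one set of assumptions.\<close>
  moreover have "(regular_point I (horocyclic_evolute \<sigma> \<gamma> \<nu> f) t \<longleftrightarrow>
        is_cusp 2 3 J hyperbolic_plane (horocyclic_parallel \<sigma> \<gamma> \<nu> lam) t) \<or> n t = 0"
    and "is_cusp 2 3 I hyperbolic_plane (horocyclic_evolute \<sigma> \<gamma> \<nu> f) t \<longleftrightarrow>
        is_cusp 3 4 J hyperbolic_plane (horocyclic_parallel \<sigma> \<gamma> \<nu> lam) t"
    if "t \<in> I" "defines_parallel \<sigma> I m n t J lam"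
      "horocyclic_evolute \<sigma> \<gamma> \<nu> f t = horocyclic_parallel \<sigma> \<gamma> \<nu> lam t" for t J lam
  proof -
    have "lam t = f t"
      using par_point_inj[OF that(1)] that(3) by (simp add: horocyclic_evolute_eq horocyclic_parallel_eq)
    from cusp_conditions[OF that(2) this]
    show "(regular_point I (horocyclic_evolute \<sigma> \<gamma> \<nu> f) t \<longleftrightarrow>
        is_cusp 2 3 J hyperbolic_plane (horocyclic_parallel \<sigma> \<gamma> \<nu> lam) t) \<or> n t = 0"
      and "is_cusp 2 3 I hyperbolic_plane (horocyclic_evolute \<sigma> \<gamma> \<nu> f) t \<longleftrightarrow>
        is_cusp 3 4 J hyperbolic_plane (horocyclic_parallel \<sigma> \<gamma> \<nu> lam) t"
      by metis+
  qed
  ultimately show ?thesis by blast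
qed

end
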